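(* There is an open dense subset $G\subset\hat{\mathbb{E}}$ such that for every $A\in G$ the image $\mathcal{HS}(A)=\{A'\in\hat{\mathbb{E}}: A\rightarrow A'\}$ of $A$ under the hyperbolic scattering relation has nonempty interior in the sphere $\{A' : \|A'\|=\|A\|\}$.
   Context: Fix $n\ge 2$, $d\ge 2$ and masses $m_1,\dots,m_n>0$. Let $\mathbb{E}=\{q=(q_1,\dots,q_n)\in(\mathbb{R}^d)^n:\sum_i m_iq_i=0\}$, with mass inner product $\langle\!\langle v,w\rangle\!\rangle=\sum_i m_i\, v_i\cdot w_i$ and norm $\|\cdot\|$. Let $\Delta=\{q: q_i=q_j\text{ for some }i\neq j\}$, $\hat{\mathbb{E}}=\mathbb{E}\setminus\Delta$, $S=\{s\in\mathbb{E}:\|s\|=1\}$, $\hat S=S\setminus\Delta$. The sphere $\{A':\|A'\|=\|A\|\}$ is taken in $\mathbb{E}$. Let $U(q)=\sum_{i<j}\frac{m_im_j}{|q_i-q_j|}$, let $\nabla U$ be its gradient with respect to the mass inner product, and let $\tilde\nabla U(s)=\nabla U(s)+U(s)s$ for $s\in\hat S$. Extended phase space: the set of $(\rho,s,v,w)$ with $\rho\ge 0$, $s\in\hat S$, $v\in\mathbb{R}$, $w\in\mathbb{E}$, $\langle\!\langle s,w\rangle\!\rangle=0$ and positive energy $h=\frac12v^2+\frac12\|w\|^2-\rho U(s)>0$, with the flow $\phi_\tau$ (possibly incomplete) of $$\rho'=-v\rho,\quad s'=w,\quad v'=\|w\|^2-\rho U(s),\quad w'=\rho\tilde\nabla U(s)-vw-\|w\|^2s,\qquad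 {}'=d/d\tau .$$ For $\rho>0$ this is Newton's equation $\ddot q=\nabla U(q)$ on $\hat{\mathbb{E}}$ with $q=s/\rho$, $\dot q=vs+w$, $dt=\rho^{-1}d\tau$. Collision-free equilibria at infinity: $\hat{\mathcal{E}}_\pm=\{(0,s,v,0): s\in\hat S,\ \pm v>0\}$; write $(s,v)$ for $(0,s,v,0)$. Let $\mathcal{H}_+$ (resp. $\mathcal{H}_-$) be the set of points $x$ for which $\phi_\tau(x)$ converges to a point $\pi_+(x)\in\hat{\mathcal{E}}_+$ as $\tau\to+\infty$ (resp. to a point $\pi_-(x)\in\hat{\mathcal{E}}_-$ as $\tau\to-\infty$), and $\mathcal{H}=\mathcal{H}_+\cap\mathcal{H}_-$. For $p\in\hat{\mathcal{E}}_-$, $q\in\hat{\mathcal{E}}_+$ write $p\rightarrow q$ if there is $x\in\mathcal{H}$ with $\pi_-(x)=p$, $\pi_+(x)=q$. For $A,A'\in\hat{\mathbb{E}}$ write $A\rightarrow A'$ if $(-A/\|A\|,-\|A\|)\rightarrow(A'/\|A'\|,\|A'\|)$. *)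

theory Defs
  imports "HOL-Analysis.Analysis"
begin

text \<open>
  The index type \<open>'n\<close> of the bodies plays the role of \<open>{1..n}\<close> and carries a linear order so that
  sums over \<open>i < j\<close> make sense; a configuration is an element of \<open>real^'d^'n\<close>. All topological
  notions refer to the standard topology of this type, which is also the one induced by
  the mass norm (all masses being positive).
\<close>

type_synonym ('d, 'n) config = "real^'d^'n"

definition mass_inner :: "('n::{finite,linorder} \<Rightarrow> real) \<Rightarrow> ('d::finite, 'n) config \<Rightarrow> ('d, 'n) config \<Rightarrow> real" where
  "mass_inner m v w = (\<Sum>i\<in>UNIV. m i * (v $ i \<bullet> w $ i))"

definition mass_norm :: "('n::{finite,linorder} \<Rightarrow> real) \<Rightarrow> ('d::finite, 'n) config \<Rightarrow> real" where
  "mass_norm m v = sqrt (mass_inner m v v)"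

definition centered :: "('n::{finite,linorder} \<Rightarrow> real) \<Rightarrow> ('d::finite, 'n) config set" where
  "centered m = {q. (\<Sum>i\<in>UNIV. m i *\<^sub>R (q $ i)) = 0}"

definition collisions :: "('d::finite, 'n::{finite,linorder}) config set" where
  "collisions = {q. \<exists>i j. i \<noteq> j \<and> q $ i = q $ j}"

definition centered_free :: "('n::{finite,linorder} \<Rightarrow> real) \<Rightarrow> ('d::finite, 'n) config set" where
  "centered_free m = centered m - collisions"

definition mass_sphere :: "('n::{finite,linorder} \<Rightarrow> real) \<Rightarrow> real \<Rightarrow> ('d::finite, 'n) config set" where
  "mass_sphere m r = {q \<in> centered m. mass_norm m q = r}"

definition unit_sphere_free :: "('n::{finite,linorder} \<Rightarrow> real) \<Rightarrow> ('d::finite, 'n) config set" where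
  "unit_sphere_free m = mass_sphere m 1 - collisions"

definition potential :: "('n::{finite,linorder} \<Rightarrow> real) \<Rightarrow> ('d::finite, 'n) config \<Rightarrow> real" where
  "potential m q = (\<Sum>(i, j) \<in> {(i, j). i < j}. m i * m j / norm (q $ i - q $ j))"

text \<open>
  The gradient on the space of centered configurations: the centered vector that represents, via
  the mass inner product, the derivative of the potential along centered directions.
  It is uniquely determined at collision-free points; elsewhere the value is irrelevant.
\<close>

definition grad_potential :: "('n::{finite,linorder} \<Rightarrow> real) \<Rightarrow> ('d::finite, 'n) config \<Rightarrow> ('d, 'n) config" where
  "grad_potential m q =
    (THE g. g \<in> centered m \<and>
       (potential m has_derivative (\<lambda>u. mass_inner m g u)) (at q within centered m))"

definition tangential_grad :: "('n::{finite,linorder} \<Rightarrow> real) \<Rightarrow> ('d::finite, 'n) config \<Rightarrow> ('d, 'n) config" where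
  "tangential_grad m s = grad_potential m s + potential m s *\<^sub>R s"

type_synonym ('d, 'n) phase = "real \<times> ('d, 'n) config \<times> real \<times> ('d, 'n) config"

fun energy :: "('n::{finite,linorder} \<Rightarrow> real) \<Rightarrow> ('d::finite, 'n) phase \<Rightarrow> real" where
  "energy m (\<rho>, s, v, w) = v\<^sup>2 / 2 + (mass_norm m w)\<^sup>2 / 2 - \<rho> * potential m s"

definition phase_space :: "('n::{finite,linorder} \<Rightarrow> real) \<Rightarrow> ('d::finite, 'n) phase set" where
  "phase_space m =
    {(\<rho>, s, v, w). \<rho> \<ge> 0 \<and> s \<in> unit_sphere_free m \<and> w \<in> centered m \<and>
       mass_inner m s w = 0 \<and> energy m (\<rho>, s, v, w) > 0}"

fun vector_field ::
    "('n::{finite,linorder} \<Rightarrow> real) \<Rightarrow> ('d::finite, 'n) phase \<Rightarrow> ('d, 'n) phase" where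
  "vector_field m (\<rho>, s, v, w) =
    (- v * \<rho>,
     w,
     (mass_norm m w)\<^sup>2 - \<rho> * potential m s,
     \<rho> *\<^sub>R tangential_grad m s - v *\<^sub>R w - (mass_norm m w)\<^sup>2 *\<^sub>R s)"

text \<open>
  The possibly incomplete flow is described by its orbits: \<open>orbit_on m I x \<gamma>\<close> says that the flow
  line through \<open>x\<close> exists for all times in the interval \<open>I\<close> (which contains 0) and that
  \<open>\<gamma> \<tau>\<close> is the image of \<open>x\<close> at time \<open>\<tau> \<in> I\<close>.
\<close>

definition orbit_on ::
    "('n::{finite,linorder} \<Rightarrow> real) \<Rightarrow> real set \<Rightarrow> ('d::finite, 'n) phase \<Rightarrow>
      (real \<Rightarrow> ('d, 'n) phase) \<Rightarrow> bool" where
  "orbit_on m I x \<gamma> \<longleftrightarrow>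
    \<gamma> 0 = x \<and>
    (\<forall>\<tau>\<in>I. \<gamma> \<tau> \<in> phase_space m \<and>
       (\<gamma> has_vector_derivative vector_field m (\<gamma> \<tau>)) (at \<tau> within I))"

definition equilibria_plus :: "('n::{finite,linorder} \<Rightarrow> real) \<Rightarrow> ('d::finite, 'n) phase set" where
  "equilibria_plus m = {(0, s, v, 0) | s v. s \<in> unit_sphere_free m \<and> v > 0}"

definition equilibria_minus :: "('n::{finite,linorder} \<Rightarrow> real) \<Rightarrow> ('d::finite, 'n) phase set" where
  "equilibria_minus m = {(0, s, v, 0) | s v. s \<in> unit_sphere_free m \<and> v < 0}"

text \<open>
  \<open>limit_plus m x q\<close> expresses \<open>x \<in> \<H>\<^sub>+\<close> and \<open>\<pi>\<^sub>+(x) = q\<close>, and \<open>limit_minus m x p\<close>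
  expresses \<open>x \<in> \<H>\<^sub>-\<close> and \<open>\<pi>\<^sub>-(x) = p\<close>.
\<close>

definition limit_plus ::
    "('n::{finite,linorder} \<Rightarrow> real) \<Rightarrow> ('d::finite, 'n) phase \<Rightarrow> ('d, 'n) phase \<Rightarrow> bool" where
  "limit_plus m x q \<longleftrightarrow> q \<in> equilibria_plus m \<and> (\<exists>\<gamma>. orbit_on m {0..} x \<gamma> \<and> (\<gamma> \<longlongrightarrow> q) at_top)"

definition limit_minus ::
    "('n::{finite,linorder} \<Rightarrow> real) \<Rightarrow> ('d::finite, 'n) phase \<Rightarrow> ('d, 'n) phase \<Rightarrow> bool" where
  "limit_minus m x p \<longleftrightarrow> p \<in> equilibria_minus m \<and> (\<exists>\<gamma>. orbit_on m {..0} x \<gamma> \<and> (\<gamma> \<longlongrightarrow> p) at_bot)"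

definition connects ::
    "('n::{finite,linorder} \<Rightarrow> real) \<Rightarrow> ('d::finite, 'n) phase \<Rightarrow> ('d, 'n) phase \<Rightarrow> bool" where
  "connects m p q \<longleftrightarrow> (\<exists>x. limit_minus m x p \<and> limit_plus m x q)"

definition scatters :: "('n::{finite,linorder} \<Rightarrow> real) \<Rightarrow> ('d::finite, 'n) config \<Rightarrow> ('d, 'n) config \<Rightarrow> bool" where
  "scatters m A A' \<longleftrightarrow>
    connects m (0, - (A /\<^sub>R mass_norm m A), - mass_norm m A, 0)
               (0, A' /\<^sub>R mass_norm m A', mass_norm m A', 0)"

definition scattering_image :: "('n::{finite,linorder} \<Rightarrow> real) \<Rightarrow> ('d::finite, 'n) config \<Rightarrow> ('d, 'n) config set" where
  "scattering_image m A = {A' \<in> centered_free m. scatters m A A'}"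

end

theory Submission imports Defs begin

text \<open>
  Scattering is studied for bodies that pass each other at large distances. After scaling space
  and time by the same factor \<open>1 / \<epsilon>\<close>, which does not change velocities, Newton's equation reads
  \<open>y'' = \<epsilon> \<nabla>U(y)\<close>. For small \<open>\<epsilon>\<close> the solutions are close to straight motions
  \<open>r *\<^sub>R A + c\<close> without collisions, and the outgoing velocity is \<open>A + \<epsilon> E(c)\<close>, where \<open>E(c)\<close> is
  uniformly close to the total kick, the integral of \<open>\<nabla>U\<close> along the straight motion. The solutions
  with incoming velocity \<open>A\<close> are produced by Banach's fixed point theorem for the deviation of the
  velocity (\<open>scattering_solutions\<close>); a change of the time parameter turns each of them into an orbit that
  connects the required equilibria at infinity (\<open>newtonian_trajectory_scatters\<close>). Neither step uses
  asymptotics of the positions beyond linear growth.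

  The total kick is explicit. It is the gradient with respect to \<open>c\<close> of a sum over all pairs of bodies
  of negative multiples of the logarithm of the impact parameter, the distance of the
  straight line of relative motion from \<open>0\<close>. Its derivative is degenerate in the directions of the
  translations and of \<open>A\<close>, and it takes values orthogonal to both.
  If there is an impact vector \<open>c0\<close> at which nothing else is degenerate, then by Brouwer's theorem, for
  small \<open>\<epsilon>\<close>, the projection of \<open>E(c)\<close> orthogonal to \<open>A\<close> takes all values near the total kick for \<open>c0\<close>
  among the centered vectors orthogonal to \<open>A\<close> (\<open>covering_stable\<close>, \<open>scattering_locally_onto\<close>). Since
  energy is conserved, the outgoing velocity lies on the sphere through \<open>A\<close>; being close to \<open>A\<close>, it is
  determined by that projection, so that the image contains a nonempty open subset of the sphere.

  Such impact vectors exist whenever no three of the points \<open>A $ i\<close> are collinear, which is an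
  open and dense condition (\<open>exists_nondegenerate_impacts\<close>). The bodies are added one at a time: the
  previous impact vectors are shrunk, so that their part of the form dominates, and the new body
  is placed such that the remaining part is nondegenerate on the radical of the dominating one.
\<close>

section \<open>Newton's force\<close>

text \<open>The attraction exerted by a unit mass at the relative position \<open>x\<close>; its value at \<open>0\<close> is \<open>0\<close>, so
  that sums over all pairs of bodies may include the diagonal.\<close>

definition newton_kernel :: "'a::real_inner \<Rightarrow> 'a" where
  "newton_kernel x = x /\<^sub>R (norm x ^ 3)"

text \<open>The accelerations of the bodies: at collision-free points this is the gradient of the
  potential with respect to the mass inner product.\<close>

definition force :: "('n::{finite,linorder} \<Rightarrow> real) \<Rightarrow> ('d::finite, 'n) config \<Rightarrow> ('d, 'n) config" where
  "force m q = (\<chi> i. \<Sum>j\<in>UNIV. m j *\<^sub>R newton_kernel (q $ j - q $ i))"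

lemma newton_kernel_0 [simp]: "newton_kernel 0 = 0"
  by (simp add: newton_kernel_def)

lemma newton_kernel_minus: "newton_kernel (- x) = - newton_kernel x"
  by (simp add: newton_kernel_def)

lemma newton_kernel_commute: "newton_kernel (x - y) = - newton_kernel (y - x)"
  by (metis minus_diff_eq newton_kernel_minus)

lemma norm_newton_kernel: "norm (newton_kernel x) = 1 / (norm x)\<^sup>2"
  by (cases "x = 0") (simp_all add: newton_kernel_def power2_eq_square power3_eq_cube divide_simps)

lemma newton_kernel_scaleR: "c > 0 \<Longrightarrow> newton_kernel (c *\<^sub>R x) = (1 / c\<^sup>2) *\<^sub>R newton_kernel x"
  by (simp add: newton_kernel_def power2_eq_square power3_eq_cube divide_simps)

lemma force_nth: "force m q $ i = (\<Sum>j\<in>UNIV. m j *\<^sub>R newton_kernel (q $ j - q $ i))"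
  by (simp add: force_def)

lemma force_scaleR: "c > 0 \<Longrightarrow> force m (c *\<^sub>R q) = (1 / c\<^sup>2) *\<^sub>R force m q"
  by (simp add: vec_eq_iff force_nth scaleR_right_diff_distrib [symmetric] newton_kernel_scaleR
    scaleR_sum_right scaleR_left_commute del: scaleR_right_diff_distrib)

text \<open>Action and reaction cancel: the work of an antisymmetric system of pair forces depends only
  on the relative displacements.\<close>

lemma sum_antisymmetric_inner:
  fixes F :: "'n::finite \<Rightarrow> 'n \<Rightarrow> 'a::real_inner"
  assumes "\<And>i j. F i j = - F j i"
  shows "(\<Sum>i\<in>UNIV. (\<Sum>j\<in>UNIV. F i j) \<bullet> u i) = (\<Sum>i\<in>UNIV. \<Sum>j\<in>UNIV. F i j \<bullet> (u i - u j)) / 2"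
proof -
  have "(\<Sum>i\<in>UNIV. \<Sum>j\<in>UNIV. F i j \<bullet> u i) = (\<Sum>i\<in>UNIV. \<Sum>j\<in>UNIV. F j i \<bullet> u j)"
    by (rule sum.swap)
  also have "\<dots> = - (\<Sum>i\<in>UNIV. \<Sum>j\<in>UNIV. F i j \<bullet> u j)"
    by (subst assms) (simp add: sum_negf)
  finally have *: "(\<Sum>i\<in>UNIV. \<Sum>j\<in>UNIV. F i j \<bullet> u i) = - (\<Sum>i\<in>UNIV. \<Sum>j\<in>UNIV. F i j \<bullet> u j)" .
  show ?thesis
    by (simp add: inner_diff_right sum_subtractf inner_sum_left *)
qed

lemma sum_pairs_symmetric:
  fixes f :: "'n::{finite,linorder} \<Rightarrow> 'n \<Rightarrow> real"
  assumes "\<And>i j. f i j = f j i" "\<And>i. f i i = 0"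
  shows "(\<Sum>i\<in>UNIV. \<Sum>j\<in>UNIV. f i j) = 2 * (\<Sum>(i, j)\<in>{(i, j). i < j}. f i j)"
proof -
  let ?L = "{(i, j). i < (j::'n)}" and ?G = "{(i, j). j < (i::'n)}"
  have "(\<Sum>i\<in>UNIV. \<Sum>j\<in>UNIV. f i j) = (\<Sum>(i, j)\<in>UNIV. f i j)"
    by (simp add: sum.cartesian_product)
  also have "\<dots> = (\<Sum>(i, j)\<in>?L \<union> ?G. f i j)"
    by (rule sum.mono_neutral_right) (use assms(2) in \<open>auto, metis linorder_less_linear\<close>)
  also have "\<dots> = (\<Sum>(i, j)\<in>?L. f i j) + (\<Sum>(i, j)\<in>?G. f i j)"
    by (rule sum.union_disjoint) auto
  also have "(\<Sum>(i, j)\<in>?G. f i j) = (\<Sum>(i, j)\<in>?L. f i j)"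
    by (rule sum.reindex_bij_witness[of _ "\<lambda>(i,j). (j,i)" "\<lambda>(i,j). (j,i)"]) (use assms(1) in auto)
  finally show ?thesis by simp
qed

lemma mass_inner_force:
  "mass_inner m (force m q) u =
    (\<Sum>(i, j)\<in>{(i, j). i < j}. m i * m j * (newton_kernel (q $ j - q $ i) \<bullet> (u $ i - u $ j)))"
proof -
  let ?F = "\<lambda>i j. (m i * m j) *\<^sub>R newton_kernel (q $ j - q $ i)"
  have "mass_inner m (force m q) u = (\<Sum>i\<in>UNIV. (\<Sum>j\<in>UNIV. ?F i j) \<bullet> u $ i)"
    by (simp add: mass_inner_def force_nth inner_sum_left sum_distrib_left mult.assoc)
  also have "\<dots> = (\<Sum>i\<in>UNIV. \<Sum>j\<in>UNIV. ?F i j \<bullet> (u $ i - u $ j)) / 2"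
    by (rule sum_antisymmetric_inner)
      (subst newton_kernel_commute, simp add: mult.commute)
  also have "(\<Sum>i\<in>UNIV. \<Sum>j\<in>UNIV. ?F i j \<bullet> (u $ i - u $ j)) =
      2 * (\<Sum>(i, j)\<in>{(i, j). i < j}. ?F i j \<bullet> (u $ i - u $ j))"
    by (rule sum_pairs_symmetric)
      (subst newton_kernel_commute, simp_all add: algebra_simps)
  finally show ?thesis
    by (simp add: mult.assoc)
qed

lemma centeredI_mass_inner:
  fixes q :: "('d::finite, 'n::{finite,linorder}) config"
  assumes "\<And>e. mass_inner m q (\<chi> i. e) = 0"
  shows "q \<in> centered m"
proof -
  have "(\<Sum>i\<in>UNIV. m i *\<^sub>R q $ i) \<bullet> e = 0" for e
    using assms [of e] by (simp add: mass_inner_def inner_sum_left)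
  then show ?thesis
    unfolding centered_def by (simp, metis inner_eq_zero_iff)
qed

lemma force_centered: "force m q \<in> centered m"
  by (rule centeredI_mass_inner) (simp add: mass_inner_force)

section \<open>The mass inner product\<close>

lemma mass_inner_linear_simps:
  "mass_inner m (x + y) z = mass_inner m x z + mass_inner m y z"
  "mass_inner m z (x + y) = mass_inner m z x + mass_inner m z y"
  "mass_inner m (x - y) z = mass_inner m x z - mass_inner m y z"
  "mass_inner m z (x - y) = mass_inner m z x - mass_inner m z y"
  "mass_inner m (c *\<^sub>R x) z = c * mass_inner m x z"
  "mass_inner m z (c *\<^sub>R x) = c * mass_inner m z x"
  "mass_inner m (- x) z = - mass_inner m x z"
  "mass_inner m z (- x) = - mass_inner m z x"
  "mass_inner m 0 z = 0" "mass_inner m z 0 = 0"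
  by (simp_all add: mass_inner_def inner_add_left inner_add_right inner_diff_left inner_diff_right
    algebra_simps sum.distrib sum_subtractf sum_distrib_left sum_negf)

lemma mass_inner_commute: "mass_inner m x y = mass_inner m y x"
  by (simp add: mass_inner_def inner_commute)

lemma bounded_bilinear_mass_inner:
  fixes m :: "'n::{finite,linorder} \<Rightarrow> real"
  shows "bounded_bilinear (mass_inner m :: ('d::finite, 'n) config \<Rightarrow> _)"
proof
  show "\<exists>K. \<forall>a b :: ('d, 'n) config. norm (mass_inner m a b) \<le> norm a * norm b * K"
  proof (intro exI allI)
    fix a b :: "('d, 'n) config"
    have "norm (mass_inner m a b) \<le> (\<Sum>i\<in>UNIV. norm (m i * (a $ i \<bullet> b $ i)))"
      unfolding mass_inner_def by (rule norm_sum)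
    also have "\<dots> \<le> (\<Sum>i\<in>UNIV. \<bar>m i\<bar> * (norm a * norm b))"
    proof (rule sum_mono)
      fix i
      have "\<bar>a $ i \<bullet> b $ i\<bar> \<le> norm (a $ i) * norm (b $ i)"
        by (rule Cauchy_Schwarz_ineq2)
      also have "\<dots> \<le> norm a * norm b"
        by (intro mult_mono Finite_Cartesian_Product.norm_nth_le) auto
      finally show "norm (m i * (a $ i \<bullet> b $ i)) \<le> \<bar>m i\<bar> * (norm a * norm b)"
        by (simp add: abs_mult mult_left_mono)
    qed
    finally show "norm (mass_inner m a b) \<le> norm a * norm b * (\<Sum>i\<in>UNIV. \<bar>m i\<bar>)"
      by (simp add: sum_distrib_left mult.commute)
  qed
qed (simp_all add: mass_inner_linear_simps)

lemmas tendsto_mass_inner = bounded_bilinear.tendsto [OF bounded_bilinear_mass_inner]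
lemmas continuous_on_mass_inner = bounded_bilinear.continuous_on [OF bounded_bilinear_mass_inner]
lemmas has_vector_derivative_mass_inner =
  bounded_bilinear.has_vector_derivative [OF bounded_bilinear_mass_inner]

lemma subspace_centered:
  fixes m :: "'n::{finite,linorder} \<Rightarrow> real"
  shows "subspace (centered m :: ('d::finite, 'n) config set)"
proof -
  have "(\<Sum>i\<in>UNIV. m i *\<^sub>R c *\<^sub>R x $ i) = c *\<^sub>R (\<Sum>i\<in>UNIV. m i *\<^sub>R x $ i)"
    for c and x :: "('d, 'n) config"
    by (simp add: scaleR_sum_right mult.commute)
  then show ?thesis
    by (auto simp: subspace_def centered_def scaleR_add_right sum.distrib)
qed

lemmas centered_linear_simps =
  subspace_add [OF subspace_centered] subspace_diff [OF subspace_centered]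
  subspace_scale [OF subspace_centered] subspace_neg [OF subspace_centered]

lemma closed_centered: "closed (centered m)"
  by (rule closed_subspace [OF subspace_centered])

context
  fixes m :: "'n::{finite,linorder} \<Rightarrow> real"
  assumes mass_pos: "\<And>i. m i > 0"
begin

lemma mass_inner_nonneg: "mass_inner m x x \<ge> 0"
  unfolding mass_inner_def by (intro sum_nonneg mult_nonneg_nonneg) (auto intro: less_imp_le mass_pos)

lemma mass_inner_eq_0_iff: "mass_inner m x x = 0 \<longleftrightarrow> x = 0"
proof -
  have "mass_inner m x x = 0 \<longleftrightarrow> (\<forall>i. m i * (x $ i \<bullet> x $ i) = 0)"
    unfolding mass_inner_def
    by (subst sum_nonneg_eq_0_iff) (auto intro!: mult_nonneg_nonneg less_imp_le [OF mass_pos])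
  then show ?thesis
    using mass_pos by (auto simp: vec_eq_iff less_le)
qed

lemma mass_norm_power2: "(mass_norm m x)\<^sup>2 = mass_inner m x x"
  by (simp add: mass_norm_def mass_inner_nonneg)

lemma mass_norm_nonneg [simp]: "mass_norm m x \<ge> 0"
  by (simp add: mass_norm_def mass_inner_nonneg)

lemma mass_norm_eq_0_iff [simp]: "mass_norm m x = 0 \<longleftrightarrow> x = 0"
  by (simp add: mass_norm_def mass_inner_eq_0_iff)

lemma mass_norm_pos_iff [simp]: "mass_norm m x > 0 \<longleftrightarrow> x \<noteq> 0"
  by (metis less_le mass_norm_nonneg mass_norm_eq_0_iff)

lemma mass_norm_scaleR: "mass_norm m (c *\<^sub>R x) = \<bar>c\<bar> * mass_norm m x"
  by (simp add: mass_norm_def mass_inner_linear_simps real_sqrt_mult mult.assoc [symmetric])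

end

lemma mass_norm_minus [simp]: "mass_norm m (- x) = mass_norm m x"
  by (simp add: mass_norm_def mass_inner_linear_simps)

lemma tendsto_mass_norm: "(f \<longlongrightarrow> x) F \<Longrightarrow> ((\<lambda>t. mass_norm m (f t)) \<longlongrightarrow> mass_norm m x) F"
  unfolding mass_norm_def by (intro tendsto_real_sqrt tendsto_mass_inner)

section \<open>The potential and its gradient\<close>

lemma has_derivative_inverse_norm:
  fixes x :: "'a::real_inner"
  assumes "x \<noteq> 0"
  shows "((\<lambda>x. 1 / norm x) has_derivative (\<lambda>u. - (newton_kernel x \<bullet> u))) (at x)"
proof -
  have "((\<lambda>x. 1 / norm x) has_derivative (\<lambda>u. - (1 * (sgn x \<bullet> u) / (norm x)\<^sup>2))) (at x)"
    by (rule has_derivative_eq_rhs)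
      (use assms in \<open>auto intro!: derivative_eq_intros has_derivative_norm simp: power2_eq_square inner_commute divide_simps\<close>)
  then show ?thesis
    by (rule has_derivative_eq_rhs)
      (simp add: newton_kernel_def sgn_div_norm fun_eq_iff power2_eq_square power3_eq_cube divide_simps)
qed

lemma potential_has_derivative:
  assumes "q \<notin> collisions"
  shows "(potential m has_derivative (\<lambda>u. mass_inner m (force m q) u)) (at q)"
proof -
  have D: "((\<lambda>q. m i * m j / norm (q $ i - q $ j)) has_derivative
      (\<lambda>u. m i * m j * (newton_kernel (q $ j - q $ i) \<bullet> (u $ i - u $ j)))) (at q)"
    if "i < j" for i j
  proof -
    have ne: "q $ i - q $ j \<noteq> 0"
      using assms that unfolding collisions_def by force
    have B: "bounded_linear (\<lambda>q :: ('a, 'b) config. q $ i - q $ j)"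
      by (intro bounded_linear_sub bounded_linear_vec_nth)
    have "((\<lambda>q. 1 / norm (q $ i - q $ j)) has_derivative
      (\<lambda>u. - (newton_kernel (q $ i - q $ j) \<bullet> (u $ i - u $ j)))) (at q)"
      using has_derivative_compose [OF bounded_linear_imp_has_derivative [OF B] has_derivative_inverse_norm [OF ne]] .
    then have "((\<lambda>q. m i * m j * (1 / norm (q $ i - q $ j))) has_derivative
      (\<lambda>u. m i * m j * - (newton_kernel (q $ i - q $ j) \<bullet> (u $ i - u $ j)))) (at q)"
      by (rule has_derivative_mult_right)
    then show ?thesis
      by (simp add: newton_kernel_commute [of "q $ i"])
  qed
  show ?thesis
    unfolding potential_def mass_inner_force case_prod_unfold
    by (intro has_derivative_sum D) auto
qed

text \<open>The derivative within the centered configurations determines the gradient, because that space contains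
  the difference of any two candidates.\<close>

lemma grad_potential_eq_force:
  assumes "\<And>i. m i > 0" "q \<in> centered m" "q \<notin> collisions"
  shows "grad_potential m q = force m q"
  unfolding grad_potential_def
proof (rule the_equality)
  show F: "force m q \<in> centered m \<and>
      (potential m has_derivative mass_inner m (force m q)) (at q within centered m)"
    using potential_has_derivative [OF assms(3)] force_centered has_derivative_at_withinI by blast
  fix g assume g: "g \<in> centered m \<and>
      (potential m has_derivative mass_inner m g) (at q within centered m)"
  define h where "h = g - force m q"
  have h: "h \<in> centered m"
    unfolding h_def using g force_centered by (auto intro: centered_linear_simps)
  have line: "((\<lambda>t. q + t *\<^sub>R h) has_derivative (\<lambda>t. t *\<^sub>R h)) (at (0::real))"
    by (auto intro!: derivative_eq_intros)
  have inc: "(\<lambda>t. q + t *\<^sub>R h) ` UNIV \<subseteq> centered m"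
    using h assms by (auto intro: centered_linear_simps)
  have "((\<lambda>t. potential m (q + t *\<^sub>R h)) has_derivative (\<lambda>t. mass_inner m g (t *\<^sub>R h))) (at (0::real))"
    using has_derivative_in_compose2 [of "centered m" "potential m" "\<lambda>x. mass_inner m (if x = q then g else 0)"]
      has_derivative_in_compose [OF line, of "potential m" "mass_inner m g"]
      has_derivative_subset [OF conjunct2 [OF g] inc] by (auto simp: o_def)
  moreover have "((\<lambda>t. potential m (q + t *\<^sub>R h)) has_derivative (\<lambda>t. mass_inner m (force m q) (t *\<^sub>R h))) (at (0::real))"
    using has_derivative_in_compose [OF line, of "potential m" "mass_inner m (force m q)"]
      has_derivative_subset [OF conjunct2 [OF F] inc] by (auto simp: o_def)
  ultimately have "(\<lambda>t. mass_inner m g (t *\<^sub>R h)) = (\<lambda>t. mass_inner m (force m q) (t *\<^sub>R h))"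
    by (rule has_derivative_unique)
  from fun_cong [OF this, of 1] have "mass_inner m h h = 0"
    by (simp add: h_def mass_inner_linear_simps)
  then show "g = force m q"
    using mass_inner_eq_0_iff [of m h] assms(1) by (simp add: h_def)
qed

lemma potential_scaleR: "c > 0 \<Longrightarrow> potential m (c *\<^sub>R q) = potential m q / c"
  unfolding potential_def sum_divide_distrib
  by (intro sum.cong)
    (auto simp: scaleR_right_diff_distrib [symmetric] divide_simps simp del: scaleR_right_diff_distrib)

text \<open>Euler's identity for the potential, which is homogeneous of degree \<open>- 1\<close>.\<close>

lemma mass_inner_force_self:
  fixes q :: "('d::finite, 'n::{finite,linorder}) config"
  shows "mass_inner m (force m q) q = - potential m q"
proof -
  have "newton_kernel x \<bullet> - x = - 1 / norm x" for x :: "real ^ 'd"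
    by (cases "x = 0")
      (simp_all add: newton_kernel_def power3_eq_cube divide_simps power2_norm_eq_inner [symmetric] power2_eq_square)
  from this [of "q $ j - q $ i" for i j] show ?thesis
    by (simp add: mass_inner_force potential_def sum_negf [symmetric] case_prod_unfold norm_minus_commute)
qed

section \<open>From Newtonian trajectories to heteroclinic orbits\<close>

lemma tendsto_quotient_at_top:
  fixes q :: "real \<Rightarrow> 'a::euclidean_space"
  assumes "\<And>t. (q has_vector_derivative p t) (at t)" "(p \<longlongrightarrow> A) at_top"
  shows "((\<lambda>t. q t /\<^sub>R t) \<longlongrightarrow> A) at_top"
proof -
  have "((\<lambda>t. (q t \<bullet> b) / t) \<longlongrightarrow> A \<bullet> b) at_top" for b
  proof (rule lhospital_at_top_at_top [where f' = "\<lambda>t. p t \<bullet> b" and g' = "\<lambda>_. 1"])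
    show "\<forall>\<^sub>F t in at_top. ((\<lambda>t. q t \<bullet> b) has_real_derivative p t \<bullet> b) (at t)"
      using assms(1) bounded_linear.has_vector_derivative [OF bounded_linear_inner_left, OF assms(1), of b]
      by (simp add: has_real_derivative_iff_has_vector_derivative)
    show "((\<lambda>t. (p t \<bullet> b) / 1) \<longlongrightarrow> A \<bullet> b) at_top"
      using assms(2) by (auto intro: tendsto_intros)
  qed (auto simp: filterlim_ident)
  then show ?thesis
    by (subst tendsto_componentwise_iff) (simp add: divide_inverse mult.commute)
qed

lemma tendsto_quotient_at_bot:
  fixes q :: "real \<Rightarrow> 'a::euclidean_space"
  assumes "\<And>t. (q has_vector_derivative p t) (at t)" "(p \<longlongrightarrow> A) at_bot"
  shows "((\<lambda>t. q t /\<^sub>R t) \<longlongrightarrow> A) at_bot"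
proof -
  have "((\<lambda>t. q (- t)) has_vector_derivative - p (- t)) (at t)" for t
  proof -
    have "(uminus has_vector_derivative - 1) (at t)"
      by (auto intro!: derivative_eq_intros)
    from vector_diff_chain_at [OF this assms(1)] show ?thesis
      by (simp add: o_def)
  qed
  moreover have "((\<lambda>t. - p (- t)) \<longlongrightarrow> - A) at_top"
    using assms(2) by (intro tendsto_minus) (simp add: filterlim_at_bot_mirror)
  ultimately have "((\<lambda>t. q (- t) /\<^sub>R t) \<longlongrightarrow> - A) at_top"
    by (rule tendsto_quotient_at_top)
  from tendsto_minus [OF this] show ?thesis
    by (subst filterlim_at_bot_mirror) simp
qed

text \<open>The new time is \<open>\<theta>\<close> with \<open>\<theta>' = \<rho>\<close>; along a trajectory of linear growth it runs over
  the whole line, so it has a globally defined inverse.\<close>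

lemma time_change:
  fixes \<rho> :: "real \<Rightarrow> real"
  assumes cont: "\<And>t. isCont \<rho> t" and pos: "\<And>t. \<rho> t > 0"
    and top: "((\<lambda>t. \<rho> t * t) \<longlongrightarrow> a) at_top" "a > 0"
    and bot: "((\<lambda>t. \<rho> t * - t) \<longlongrightarrow> b) at_bot" "b > 0"
  obtains \<sigma> :: "real \<Rightarrow> real" where "\<And>\<tau>. (\<sigma> has_real_derivative 1 / \<rho> (\<sigma> \<tau>)) (at \<tau>)"
    "filterlim \<sigma> at_top at_top" "filterlim \<sigma> at_bot at_bot"
proof -
  obtain \<theta> where \<theta>: "\<And>t. (\<theta> has_real_derivative \<rho> t) (at t)"
    using einterval_antiderivative [of "-\<infinity>" "\<infinity>" \<rho>] cont
    by (auto simp: has_real_derivative_iff_has_vector_derivative)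
  have mono: "strict_mono \<theta>"
    unfolding strict_mono_def using DERIV_pos_imp_increasing \<theta> pos by meson
  have cont\<theta>: "isCont \<theta> t" for t
    using \<theta> DERIV_isCont by blast
  have top\<theta>: "filterlim \<theta> at_top at_top"
  proof -
    (* \<theta>' behaves like a / t, hence \<theta> like a * ln t. *)
    have "((\<lambda>t. \<theta> t / ln t) \<longlongrightarrow> a) at_top"
    proof (rule lhospital_at_top_at_top [where f' = \<rho> and g' = "\<lambda>t. 1 / t"])
      show "\<forall>\<^sub>F t in at_top. (ln has_real_derivative 1 / t) (at t)"
        using eventually_gt_at_top [of 0] by eventually_elim (auto intro!: derivative_eq_intros)
    qed (use \<theta> top in \<open>auto simp: ln_at_top eventually_gt_at_top\<close>)
    from filterlim_tendsto_pos_mult_at_top [OF this top(2) ln_at_top]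
    show ?thesis
      by (rule filterlim_cong [THEN iffD1, OF refl refl, rotated])
        (rule eventually_mono [OF eventually_gt_at_top [of 1]], simp)
  qed
  have bot\<theta>: "filterlim \<theta> at_bot at_bot"
  proof -
    have D: "((\<lambda>t. - \<theta> (- t)) has_real_derivative \<rho> (- t)) (at t)" for t
      using \<theta> [of "- t"] by (auto intro!: derivative_eq_intros DERIV_chain' [of uminus _ _ _ \<theta>])
    have "((\<lambda>t. - \<theta> (- t) / ln t) \<longlongrightarrow> b) at_top"
    proof (rule lhospital_at_top_at_top [where f' = "\<lambda>t. \<rho> (- t)" and g' = "\<lambda>t. 1 / t"])
      show "\<forall>\<^sub>F t in at_top. (ln has_real_derivative 1 / t) (at t)"
        using eventually_gt_at_top [of 0] by eventually_elim (auto intro!: derivative_eq_intros)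
    qed (use D bot in \<open>auto simp: ln_at_top eventually_gt_at_top filterlim_at_bot_mirror\<close>)
    from filterlim_tendsto_pos_mult_at_top [OF this bot(2) ln_at_top]
    have "filterlim (\<lambda>t. - \<theta> (- t)) at_top at_top"
      by (rule filterlim_cong [THEN iffD1, OF refl refl, rotated])
        (rule eventually_mono [OF eventually_gt_at_top [of 1]], simp)
    then show ?thesis
      by (simp add: filterlim_at_bot_mirror filterlim_uminus_at_top)
  qed
  have surj: "\<exists>t. \<theta> t = \<tau>" for \<tau>
  proof -
    obtain t1 where "\<theta> t1 \<ge> \<tau>"
      using top\<theta> by (auto simp: filterlim_at_top eventually_at_top_linorder)
    moreover obtain t0 where "\<theta> t0 \<le> \<tau>"
      using bot\<theta> by (auto simp: filterlim_at_bot eventually_at_bot_linorder)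
    moreover from calculation mono have "t0 \<le> t1"
      by (meson order_trans strict_mono_less_eq)
    ultimately show ?thesis
      using IVT [of \<theta> t0 \<tau> t1] cont\<theta> by blast
  qed
  define \<sigma> where "\<sigma> = inv \<theta>"
  have \<theta>\<sigma>: "\<theta> (\<sigma> \<tau>) = \<tau>" for \<tau>
    unfolding \<sigma>_def using surj by (metis f_inv_into_f rangeI)
  have \<sigma>\<theta>: "\<sigma> (\<theta> t) = t" for t
    unfolding \<sigma>_def by (rule inv_f_f [OF strict_mono_imp_inj_on [OF mono]])
  have cont\<sigma>: "isCont \<sigma> \<tau>" for \<tau>
    using isCont_inverse_function [where d = 1 and x = "\<sigma> \<tau>" and f = \<theta> and g = \<sigma>] \<sigma>\<theta> cont\<theta> \<theta>\<sigma> by simp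
  have le: "x \<le> \<sigma> \<tau> \<longleftrightarrow> \<theta> x \<le> \<tau>" "\<sigma> \<tau> \<le> x \<longleftrightarrow> \<tau> \<le> \<theta> x" for x \<tau>
    by (metis \<theta>\<sigma> mono strict_mono_less_eq)+
  show ?thesis
  proof
    show "(\<sigma> has_real_derivative 1 / \<rho> (\<sigma> \<tau>)) (at \<tau>)" for \<tau>
      using DERIV_inverse_function [where f = \<theta> and g = \<sigma> and x = \<tau> and D = "\<rho> (\<sigma> \<tau>)" and a = "\<tau> - 1" and b = "\<tau> + 1"] \<theta> pos [of "\<sigma> \<tau>"] \<theta>\<sigma> cont\<sigma>
      by (simp add: inverse_eq_divide)
    show "filterlim \<sigma> at_top at_top"
      unfolding filterlim_at_top le by (auto simp: eventually_ge_at_top)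
    show "filterlim \<sigma> at_bot at_bot"
      unfolding filterlim_at_bot le by (auto simp: eventually_le_at_bot)
  qed
qed


lemma centered_free_nonzero:
  fixes A :: "('d::finite, 'n::{finite,linorder}) config"
  assumes "CARD('n) \<ge> 2" "A \<in> centered_free m"
  shows "A \<noteq> 0"
proof
  assume "A = 0"
  obtain i j :: 'n where "i \<noteq> j"
    using assms(1) card_le_Suc0_iff_eq [of "UNIV :: 'n set"] by force
  with \<open>A = 0\<close> assms(2) show False
    by (auto simp: centered_free_def collisions_def)
qed

text \<open>A collision-free Newtonian trajectory with collision-free asymptotic velocities becomes, in the
  coordinates \<open>(\<rho>, s, v, w)\<close> and the new time, an orbit with the required limits. Conservation of
  energy gives the equality of the norms and also the positivity of the energy.\<close>

lemma newtonian_trajectory_scatters: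
  fixes m :: "'n::{finite,linorder} \<Rightarrow> real" and q p :: "real \<Rightarrow> ('d::finite, 'n) config"
  assumes card: "CARD('n) \<ge> 2" and mass_pos: "\<And>i. m i > 0"
    and q_free: "\<And>t. q t \<in> centered_free m"
    and q': "\<And>t. (q has_vector_derivative p t) (at t)"
    and p': "\<And>t. (p has_vector_derivative force m (q t)) (at t)"
    and A: "A \<in> centered_free m" and A': "A' \<in> centered_free m"
    and lim_bot: "(p \<longlongrightarrow> A) at_bot" and lim_top: "(p \<longlongrightarrow> A') at_top"
  shows "mass_norm m A' = mass_norm m A" and "scatters m A A'"
proof -
  let ?mi = "mass_inner m"
  note q_ne = centered_free_nonzero [OF card q_free]
  note A_ne = centered_free_nonzero [OF card A] and A'_ne = centered_free_nonzero [OF card A']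
  note nsq = mass_norm_power2 [of m, OF mass_pos]
  have q_cent: "q t \<in> centered m" and q_coll: "q t \<notin> collisions" for t
    using q_free [of t] by (auto simp: centered_free_def)
  have p_cent: "p t \<in> centered m" for t
  proof -
    let ?M = "\<lambda>x :: ('d, 'n) config. \<Sum>i\<in>UNIV. m i *\<^sub>R x $ i"
    have "bounded_linear ?M"
      by (intro bounded_linear_sum bounded_linear_const_scaleR bounded_linear_vec_nth)
    from bounded_linear.has_vector_derivative [OF this q', of t]
    have "((\<lambda>t. ?M (q t)) has_vector_derivative ?M (p t)) (at t)" .
    moreover have "(\<lambda>t. ?M (q t)) = (\<lambda>t. 0)"
      using q_cent by (simp add: centered_def fun_eq_iff)
    ultimately have "?M (p t) = 0"
      using vector_derivative_unique_at has_vector_derivative_const by metis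
    then show ?thesis by (simp add: centered_def)
  qed

  define \<rho> where "\<rho> = (\<lambda>t. 1 / mass_norm m (q t))"
  define s where "s = (\<lambda>t. \<rho> t *\<^sub>R q t)"
  define v where "v = (\<lambda>t. ?mi (s t) (p t))"
  define w where "w = (\<lambda>t. p t - v t *\<^sub>R s t)"
  have \<rho>_pos: "\<rho> t > 0" for t
    unfolding \<rho>_def using mass_norm_pos_iff [of m "q t", OF mass_pos] q_ne by simp
  have q_eq: "q t = (1 / \<rho> t) *\<^sub>R s t" for t
    unfolding s_def using \<rho>_pos [of t] by simp
  have ss: "?mi (s t) (s t) = 1" for t
    unfolding s_def \<rho>_def using q_ne [of t] mass_norm_eq_0_iff [of m "q t", OF mass_pos]
    by (simp add: mass_inner_linear_simps nsq [symmetric] power2_eq_square)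
  have sw: "?mi (s t) (w t) = 0" and ws: "?mi (w t) (s t) = 0" for t
    unfolding w_def using ss [of t] mass_inner_commute [of m "p t" "s t"]
    by (simp_all add: mass_inner_linear_simps v_def)
  have p_eq: "p t = w t + v t *\<^sub>R s t" for t
    by (simp add: w_def)
  have wp: "?mi (w t) (p t) = ?mi (w t) (w t)" for t
    by (subst p_eq) (simp add: mass_inner_linear_simps ws)
  have pp: "?mi (p t) (p t) = ?mi (w t) (w t) + (v t)\<^sup>2" for t
    by (subst (1 2) p_eq) (simp add: mass_inner_linear_simps ws sw ss power2_eq_square)
  have force_q: "force m (q t) = (\<rho> t)\<^sup>2 *\<^sub>R force m (s t)" for t
    using force_scaleR [of "1 / \<rho> t" m "s t"] \<rho>_pos [of t] q_eq [of t] by (simp add: power_one_over)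
  have potential_q: "potential m (q t) = \<rho> t * potential m (s t)" for t
    using potential_scaleR [of "1 / \<rho> t" m "s t"] \<rho>_pos [of t] q_eq [of t] by simp
  have s_sphere: "s t \<in> unit_sphere_free m" for t
    unfolding unit_sphere_free_def mass_sphere_def
    using q_cent [of t] q_coll [of t] ss [of t] \<rho>_pos [of t]
    by (auto simp: mass_norm_def s_def centered_linear_simps collisions_def)
  have w_cent: "w t \<in> centered m" for t
    unfolding w_def s_def by (intro centered_linear_simps p_cent q_cent)

  define E where "E = (\<lambda>t. ?mi (p t) (p t) / 2 - potential m (q t))"
  have E_const: "E t = E 0" for t
  proof -
    have "(E has_real_derivative 0) (at t)" for t
    proof -
      have "((\<lambda>t. potential m (q t)) has_vector_derivative ?mi (force m (q t)) (p t)) (at t)"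
        using has_derivative_compose [OF q' [of t, unfolded has_vector_derivative_def]
          potential_has_derivative [OF q_coll]]
        by (simp add: has_vector_derivative_def mass_inner_linear_simps)
      moreover have "((\<lambda>t. ?mi (p t) (p t)) has_vector_derivative
          ?mi (p t) (force m (q t)) + ?mi (force m (q t)) (p t)) (at t)"
        by (rule has_vector_derivative_mass_inner [OF p' p'])
      ultimately show ?thesis
        unfolding E_def has_real_derivative_iff_has_vector_derivative [symmetric]
        by (auto intro!: derivative_eq_intros simp: mass_inner_commute [of m "p t" "force m (q t)"])
    qed
    then show ?thesis
      using DERIV_isconst_all by blast
  qed
  have E_eq: "E = (\<lambda>_. E 0)"
    by (rule ext) (rule E_const)
  note q_top = tendsto_quotient_at_top [OF q' lim_top]
    and q_bot = tendsto_quotient_at_bot [OF q' lim_bot]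
  (* The potential is homogeneous of degree - 1, hence tends to 0 along a trajectory of linear growth. *)
  have pot_cont: "isCont (potential m) x" if "x \<notin> collisions" for x :: "('d, 'n) config"
    using potential_has_derivative [OF that] has_derivative_continuous by blast
  have inv_bot: "((\<lambda>t::real. - inverse t) \<longlongrightarrow> 0) at_bot"
    using tendsto_minus [OF filterlim_mono [OF tendsto_inverse_0 order_refl at_bot_le_at_infinity]] by simp
  have pot_top: "((\<lambda>t. potential m (q t)) \<longlongrightarrow> 0) at_top"
  proof -
    have "((\<lambda>t. potential m (q t /\<^sub>R t) * inverse t) \<longlongrightarrow> potential m A' * 0) at_top"
      using A' by (intro tendsto_mult isCont_tendsto_compose [OF pot_cont q_top]
          tendsto_inverse_0_at_top filterlim_ident) (auto simp: centered_free_def)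
    moreover have "\<forall>\<^sub>F t in at_top. potential m (q t /\<^sub>R t) * inverse t = potential m (q t)"
      using eventually_gt_at_top [of 0]
    proof eventually_elim
      case (elim t)
      then show ?case
        using potential_scaleR [of t m "q t /\<^sub>R t"] by (simp add: divide_inverse)
    qed
    ultimately show ?thesis
      by (simp add: tendsto_cong)
  qed
  have pot_bot: "((\<lambda>t. potential m (q t)) \<longlongrightarrow> 0) at_bot"
  proof -
    have "((\<lambda>t. potential m (- (q t /\<^sub>R t)) * - inverse t) \<longlongrightarrow> potential m (- A) * 0) at_bot"
      using A by (intro tendsto_mult isCont_tendsto_compose [OF pot_cont tendsto_minus [OF q_bot]] inv_bot)
        (auto simp: centered_free_def collisions_def)
    moreover have "\<forall>\<^sub>F t in at_bot. potential m (- (q t /\<^sub>R t)) * - inverse t = potential m (q t)"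
      using eventually_gt_at_bot [of 0]
    proof eventually_elim
      case (elim t)
      then show ?case
        using potential_scaleR [of "- t" m "- (q t /\<^sub>R t)"] by (simp add: divide_inverse)
    qed
    ultimately show ?thesis
      by (simp add: tendsto_cong)
  qed
  have "(E \<longlongrightarrow> ?mi A' A' / 2 - 0) at_top"
    unfolding E_def by (intro tendsto_intros tendsto_mass_inner lim_top pot_top) auto
  then have E_top: "E 0 = ?mi A' A' / 2"
    by (subst (asm) E_eq) (simp add: tendsto_const_iff)
  have "(E \<longlongrightarrow> ?mi A A / 2 - 0) at_bot"
    unfolding E_def by (intro tendsto_intros tendsto_mass_inner lim_bot pot_bot) auto
  then have E_bot: "E 0 = ?mi A A / 2"
    by (subst (asm) E_eq) (simp add: tendsto_const_iff)
  show "mass_norm m A' = mass_norm m A"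
    using E_top E_bot by (simp add: mass_norm_def)
  have E_pos: "E t > 0" for t
    using E_const [of t] E_bot mass_inner_nonneg [of m A, OF mass_pos]
      mass_inner_eq_0_iff [of m A, OF mass_pos] A_ne by (simp add: less_le)

  define \<Gamma> where "\<Gamma> = (\<lambda>t. (\<rho> t, s t, v t, w t))"
  have \<Gamma>_phase: "\<Gamma> t \<in> phase_space m" for t
    using E_pos [of t] \<rho>_pos [of t]
    by (simp add: \<Gamma>_def phase_space_def s_sphere w_cent sw E_def pp potential_q nsq add_divide_distrib add.commute)

  (* The derivatives with respect to the physical time are \<open>\<rho>\<close> times the vector field. *)
  have \<rho>': "(\<rho> has_vector_derivative \<rho> t * (- v t * \<rho> t)) (at t)" for t
  proof -
    have "?mi (q t) (q t) > 0"
      using mass_inner_nonneg [of m "q t", OF mass_pos] mass_inner_eq_0_iff [of m "q t", OF mass_pos] q_ne [of t]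
      by (simp add: less_le)
    moreover have "((\<lambda>t. ?mi (q t) (q t)) has_real_derivative 2 * ?mi (q t) (p t)) (at t)"
      using has_vector_derivative_mass_inner [OF q' q', of m t] mass_inner_commute [of m "q t" "p t"]
      by (simp add: has_real_derivative_iff_has_vector_derivative)
    ultimately show ?thesis
      unfolding \<rho>_def mass_norm_def has_real_derivative_iff_has_vector_derivative [symmetric]
      by (auto intro!: derivative_eq_intros
        simp: v_def s_def \<rho>_def mass_norm_def mass_inner_linear_simps field_simps)
  qed
  have s': "(s has_vector_derivative \<rho> t *\<^sub>R w t) (at t)" for t
    unfolding s_def
    by (rule has_vector_derivative_eq_rhs [OF has_vector_derivative_scaleR
          [OF \<rho>' [unfolded has_real_derivative_iff_has_vector_derivative [symmetric]] q']])
      (simp add: w_def s_def algebra_simps)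
  have v': "(v has_vector_derivative \<rho> t * ((mass_norm m (w t))\<^sup>2 - \<rho> t * potential m (s t))) (at t)" for t
    unfolding v_def
    by (rule has_vector_derivative_eq_rhs [OF has_vector_derivative_mass_inner [OF s' p']])
      (simp only: nsq, simp add: mass_inner_linear_simps wp force_q mass_inner_commute [of m "s t" "force m (s t)"]
        mass_inner_force_self algebra_simps power2_eq_square)
  have w': "(w has_vector_derivative \<rho> t *\<^sub>R
      (\<rho> t *\<^sub>R tangential_grad m (s t) - v t *\<^sub>R w t - (mass_norm m (w t))\<^sup>2 *\<^sub>R s t)) (at t)" for t
  proof -
    have "grad_potential m (s t) = force m (s t)"
      using s_sphere [of t] by (intro grad_potential_eq_force mass_pos)
        (auto simp: unit_sphere_free_def mass_sphere_def)
    then have "((\<lambda>t. p t - v t *\<^sub>R s t) has_vector_derivative \<rho> t *\<^sub>R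
        (\<rho> t *\<^sub>R tangential_grad m (s t) - v t *\<^sub>R w t - (mass_norm m (w t))\<^sup>2 *\<^sub>R s t)) (at t)"
      by (intro has_vector_derivative_eq_rhs [OF has_vector_derivative_diff [OF p'
            has_vector_derivative_scaleR [OF v' [unfolded has_real_derivative_iff_has_vector_derivative [symmetric]] s']]])
        (simp add: tangential_grad_def force_q algebra_simps power2_eq_square)
    then show ?thesis
      by (simp add: w_def)
  qed
  have \<Gamma>': "(\<Gamma> has_vector_derivative \<rho> t *\<^sub>R vector_field m (\<Gamma> t)) (at t)" for t
    unfolding \<Gamma>_def
    by (rule has_vector_derivative_eq_rhs [OF has_vector_derivative_Pair [OF \<rho>'
          has_vector_derivative_Pair [OF s' has_vector_derivative_Pair [OF v' w']]]]) simp

  have norm_pos: "mass_norm m A > 0" "mass_norm m A' > 0"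
    using mass_norm_pos_iff [of m A, OF mass_pos] mass_norm_pos_iff [of m A', OF mass_pos] A_ne A'_ne by auto
  have \<rho>_scaled_top: "((\<lambda>t. \<rho> t * t) \<longlongrightarrow> 1 / mass_norm m A') at_top"
  proof -
    have "((\<lambda>t. 1 / mass_norm m (q t /\<^sub>R t)) \<longlongrightarrow> 1 / mass_norm m A') at_top"
      using norm_pos by (intro tendsto_intros tendsto_mass_norm q_top) auto
    moreover have "\<forall>\<^sub>F t in at_top. 1 / mass_norm m (q t /\<^sub>R t) = \<rho> t * t"
      using eventually_gt_at_top [of 0]
      by eventually_elim (simp add: mass_norm_scaleR [of m, OF mass_pos] \<rho>_def divide_simps)
    ultimately show ?thesis by (simp add: tendsto_cong)
  qed
  have \<rho>_scaled_bot: "((\<lambda>t. \<rho> t * - t) \<longlongrightarrow> 1 / mass_norm m A) at_bot"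
  proof -
    have "((\<lambda>t. 1 / mass_norm m (q t /\<^sub>R t)) \<longlongrightarrow> 1 / mass_norm m A) at_bot"
      using norm_pos by (intro tendsto_intros tendsto_mass_norm q_bot) auto
    moreover have "\<forall>\<^sub>F t in at_bot. 1 / mass_norm m (q t /\<^sub>R t) = \<rho> t * - t"
      using eventually_gt_at_bot [of 0]
      by eventually_elim (simp add: mass_norm_scaleR [of m, OF mass_pos] \<rho>_def divide_simps)
    ultimately show ?thesis by (simp add: tendsto_cong)
  qed

  define x_plus where "x_plus = (0::real, A' /\<^sub>R mass_norm m A', mass_norm m A', 0 :: ('d, 'n) config)"
  define x_minus where "x_minus = (0::real, - (A /\<^sub>R mass_norm m A), - mass_norm m A, 0 :: ('d, 'n) config)"
  have \<Gamma>_top: "(\<Gamma> \<longlongrightarrow> x_plus) at_top"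
  proof -
    have \<rho>0: "(\<rho> \<longlongrightarrow> 0) at_top"
    proof -
      have "((\<lambda>t. \<rho> t * t * inverse t) \<longlongrightarrow> 1 / mass_norm m A' * 0) at_top"
        by (intro tendsto_mult \<rho>_scaled_top tendsto_inverse_0_at_top filterlim_ident)
      moreover have "\<forall>\<^sub>F t in at_top. \<rho> t * t * inverse t = \<rho> t"
        using eventually_gt_at_top [of 0] by eventually_elim simp
      ultimately show ?thesis by (simp add: tendsto_cong)
    qed
    have s0: "(s \<longlongrightarrow> A' /\<^sub>R mass_norm m A') at_top"
    proof -
      have "((\<lambda>t. (\<rho> t * t) *\<^sub>R (q t /\<^sub>R t)) \<longlongrightarrow> (1 / mass_norm m A') *\<^sub>R A') at_top"
        by (intro tendsto_scaleR \<rho>_scaled_top q_top)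
      moreover have "\<forall>\<^sub>F t in at_top. (\<rho> t * t) *\<^sub>R (q t /\<^sub>R t) = s t"
        using eventually_gt_at_top [of 0] by eventually_elim (simp add: s_def)
      ultimately show ?thesis by (simp add: tendsto_cong divide_inverse)
    qed
    have v0: "(v \<longlongrightarrow> mass_norm m A') at_top"
    proof -
      have "(v \<longlongrightarrow> ?mi (A' /\<^sub>R mass_norm m A') A') at_top"
        unfolding v_def by (intro tendsto_mass_inner s0 lim_top)
      then show ?thesis
        using norm_pos by (simp add: mass_inner_linear_simps nsq [symmetric] power2_eq_square mult.assoc [symmetric])
    qed
    have "(w \<longlongrightarrow> A' - mass_norm m A' *\<^sub>R (A' /\<^sub>R mass_norm m A')) at_top"
      unfolding w_def by (intro tendsto_intros lim_top v0 s0)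
    then show ?thesis
      unfolding \<Gamma>_def x_plus_def using norm_pos by (intro tendsto_Pair \<rho>0 s0 v0) simp
  qed
  have \<Gamma>_bot: "(\<Gamma> \<longlongrightarrow> x_minus) at_bot"
  proof -
    have \<rho>0: "(\<rho> \<longlongrightarrow> 0) at_bot"
    proof -
      have "((\<lambda>t. \<rho> t * - t * - inverse t) \<longlongrightarrow> 1 / mass_norm m A * 0) at_bot"
        by (intro tendsto_mult \<rho>_scaled_bot inv_bot)
      moreover have "\<forall>\<^sub>F t in at_bot. \<rho> t * - t * - inverse t = \<rho> t"
        using eventually_gt_at_bot [of 0] by eventually_elim simp
      ultimately have "(\<rho> \<longlongrightarrow> 1 / mass_norm m A * 0) at_bot"
        by (rule Lim_transform_eventually)
      then show ?thesis by simp
    qed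
    have s0: "(s \<longlongrightarrow> - (A /\<^sub>R mass_norm m A)) at_bot"
    proof -
      have "((\<lambda>t. (\<rho> t * - t) *\<^sub>R (- (q t /\<^sub>R t))) \<longlongrightarrow> (1 / mass_norm m A) *\<^sub>R - A) at_bot"
        by (intro tendsto_scaleR \<rho>_scaled_bot tendsto_minus [OF q_bot])
      moreover have "\<forall>\<^sub>F t in at_bot. (\<rho> t * - t) *\<^sub>R (- (q t /\<^sub>R t)) = s t"
        using eventually_gt_at_bot [of 0] by eventually_elim (simp add: s_def)
      ultimately have "(s \<longlongrightarrow> (1 / mass_norm m A) *\<^sub>R - A) at_bot"
        by (rule Lim_transform_eventually)
      then show ?thesis by (simp add: divide_inverse)
    qed
    have v0: "(v \<longlongrightarrow> - mass_norm m A) at_bot"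
    proof -
      have "(v \<longlongrightarrow> ?mi (- (A /\<^sub>R mass_norm m A)) A) at_bot"
        unfolding v_def by (intro tendsto_mass_inner s0 lim_bot)
      then show ?thesis
        using norm_pos by (simp add: mass_inner_linear_simps nsq [symmetric] power2_eq_square mult.assoc [symmetric])
    qed
    have "(w \<longlongrightarrow> A - (- mass_norm m A) *\<^sub>R (- (A /\<^sub>R mass_norm m A))) at_bot"
      unfolding w_def by (intro tendsto_intros lim_bot v0 s0)
    then show ?thesis
      unfolding \<Gamma>_def x_minus_def using norm_pos by (intro tendsto_Pair \<rho>0 s0 v0) simp
  qed

  have \<rho>_cont: "isCont \<rho> t" for t
    using has_vector_derivative_continuous \<rho>' by blast
  have inv_norm_pos: "1 / mass_norm m A > 0" "1 / mass_norm m A' > 0"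
    using norm_pos by auto
  obtain \<sigma> where \<sigma>': "\<And>\<tau>. (\<sigma> has_real_derivative 1 / \<rho> (\<sigma> \<tau>)) (at \<tau>)"
    and \<sigma>_top: "filterlim \<sigma> at_top at_top" and \<sigma>_bot: "filterlim \<sigma> at_bot at_bot"
    by (rule time_change [OF \<rho>_cont \<rho>_pos \<rho>_scaled_top inv_norm_pos(2) \<rho>_scaled_bot inv_norm_pos(1)]) blast
  define \<gamma> where "\<gamma> = \<Gamma> \<circ> \<sigma>"
  have "(\<gamma> has_vector_derivative vector_field m (\<gamma> \<tau>)) (at \<tau>)" for \<tau>
    unfolding \<gamma>_def
    using vector_diff_chain_at [OF \<sigma>' [unfolded has_real_derivative_iff_has_vector_derivative] \<Gamma>', of \<tau>] \<rho>_pos [of "\<sigma> \<tau>"]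
    by simp
  then have orbit: "orbit_on m I (\<gamma> 0) \<gamma>" for I
    unfolding orbit_on_def by (auto simp: \<gamma>_def \<Gamma>_phase intro: has_vector_derivative_at_within)
  have \<gamma>_top: "(\<gamma> \<longlongrightarrow> x_plus) at_top" and \<gamma>_bot: "(\<gamma> \<longlongrightarrow> x_minus) at_bot"
    unfolding \<gamma>_def using filterlim_compose [OF \<Gamma>_top \<sigma>_top] filterlim_compose [OF \<Gamma>_bot \<sigma>_bot]
    by (simp_all add: o_def)
  have eq: "x_plus \<in> equilibria_plus m" "x_minus \<in> equilibria_minus m"
    using norm_pos A A'
    by (auto simp: x_plus_def x_minus_def equilibria_plus_def equilibria_minus_def unit_sphere_free_def
      mass_sphere_def centered_free_def collisions_def mass_norm_scaleR [of m, OF mass_pos]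
      scaleR_minus_right [symmetric] simp del: scaleR_minus_right intro!: centered_linear_simps)
  show "scatters m A A'"
    unfolding scatters_def connects_def limit_minus_def limit_plus_def x_plus_def [symmetric] x_minus_def [symmetric]
    using orbit \<gamma>_top \<gamma>_bot eq by blast
qed

section \<open>The logarithmic Hessian of a pair\<close>

text \<open>The squared area of the parallelogram spanned by \<open>a\<close> and \<open>b\<close>. It vanishes if and only if the
  vectors are linearly dependent.\<close>

definition gram :: "'a::real_inner \<Rightarrow> 'a \<Rightarrow> real" where
  "gram a b = (a \<bullet> a) * (b \<bullet> b) - (a \<bullet> b)\<^sup>2"

text \<open>The component of \<open>b\<close> orthogonal to \<open>a\<close>, multiplied by \<open>a \<bullet> a\<close> to avoid a division. For a
  relative motion \<open>r *\<^sub>R a + b\<close> the distance of the line from \<open>0\<close> is \<open>norm (perp a b) / (a \<bullet> a)\<close>.\<close>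

definition perp :: "'a::real_inner \<Rightarrow> 'a \<Rightarrow> 'a" where
  "perp a b = (a \<bullet> a) *\<^sub>R b - (a \<bullet> b) *\<^sub>R a"

text \<open>The second derivative of \<open>\<lambda>b. ln (gram a b) / 2\<close> at \<open>b\<close>, applied to \<open>x\<close> and \<open>y\<close>. Up to an
  additive constant this function is the logarithm of the distance of the line \<open>r *\<^sub>R a + b\<close> from \<open>0\<close>.\<close>

definition log_hessian :: "'a::real_inner \<Rightarrow> 'a \<Rightarrow> 'a \<Rightarrow> 'a \<Rightarrow> real" where
  "log_hessian a b x y =
    (gram a b * (perp a x \<bullet> y) - 2 * (perp a b \<bullet> x) * (perp a b \<bullet> y)) / (gram a b)\<^sup>2"

lemma perp_linear_simps:
  "perp a (x + y) = perp a x + perp a y" "perp a (x - y) = perp a x - perp a y"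
  "perp a (c *\<^sub>R x) = c *\<^sub>R perp a x" "perp a (- x) = - perp a x" "perp a 0 = 0" "perp a a = 0"
  by (simp_all add: perp_def inner_add_right inner_diff_right algebra_simps)

lemma perp_inner_self [simp]: "perp a b \<bullet> a = 0" "a \<bullet> perp a b = 0"
  by (simp_all add: perp_def inner_diff_left inner_diff_right inner_commute)

lemma perp_inner_commute: "perp a x \<bullet> y = perp a y \<bullet> x"
  by (simp add: perp_def inner_diff_left inner_diff_right inner_commute)

lemma perp_inner_right: "perp a b \<bullet> b = gram a b"
  by (simp add: perp_def gram_def inner_diff_left power2_eq_square)

lemma perp_eq_0D:
  assumes "perp a x = 0" "a \<noteq> 0"
  shows "x = ((a \<bullet> x) / (a \<bullet> a)) *\<^sub>R a"
proof -
  have "(a \<bullet> a) *\<^sub>R x = (a \<bullet> x) *\<^sub>R a"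
    using assms(1) by (simp add: perp_def)
  then have "inverse (a \<bullet> a) *\<^sub>R ((a \<bullet> a) *\<^sub>R x) = inverse (a \<bullet> a) *\<^sub>R ((a \<bullet> x) *\<^sub>R a)"
    by (rule arg_cong)
  then show ?thesis
    using assms(2) by (simp add: divide_inverse mult.commute)
qed

lemma gram_scaleR: "gram a (c *\<^sub>R b) = c\<^sup>2 * gram a b"
  by (simp add: gram_def power2_eq_square algebra_simps)

lemma gram_add_self: "gram a (a + b) = gram a b"
  by (simp add: gram_def power2_eq_square inner_add_right inner_add_left inner_commute algebra_simps)

lemma gram_minus [simp]: "gram (- a) b = gram a b" "gram a (- b) = gram a b"
  by (simp_all add: gram_def)

lemma perp_minus_left [simp]: "perp (- a) b = perp a b"
  by (simp add: perp_def)

lemma log_hessian_linear_simps: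
  "log_hessian a b (x + x') y = log_hessian a b x y + log_hessian a b x' y"
  "log_hessian a b (x - x') y = log_hessian a b x y - log_hessian a b x' y"
  "log_hessian a b (c *\<^sub>R x) y = c * log_hessian a b x y"
  "log_hessian a b a y = 0" "log_hessian a b 0 y = 0" "log_hessian a b x 0 = 0"
  by (simp_all add: log_hessian_def perp_linear_simps inner_add_left inner_add_right inner_diff_left
    inner_diff_right algebra_simps add_divide_distrib [symmetric] diff_divide_distrib [symmetric])

lemma log_hessian_commute: "log_hessian a b x y = log_hessian a b y x"
  by (simp add: log_hessian_def perp_inner_commute mult.commute mult.left_commute)

lemma log_hessian_minus [simp]:
  "log_hessian (- a) b x y = log_hessian a b x y" "log_hessian a (- b) x y = log_hessian a b x y"
  "log_hessian a b (- x) (- y) = log_hessian a b x y"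
  by (simp_all add: log_hessian_def perp_linear_simps)

lemma log_hessian_scaleR: "c \<noteq> 0 \<Longrightarrow> log_hessian a (c *\<^sub>R b) x y = log_hessian a b x y / c\<^sup>2"
  by (cases "gram a b = 0")
    (simp_all add: log_hessian_def gram_scaleR perp_linear_simps divide_simps power2_eq_square,
      simp add: algebra_simps)

lemma log_hessian_add_self: "log_hessian a (a + b) x y = log_hessian a b x y"
  by (simp add: log_hessian_def gram_add_self perp_linear_simps)

text \<open>By homogeneity the logarithm has second derivative \<open>- 1\<close> in the radial direction.\<close>

lemma log_hessian_radial: "gram a b \<noteq> 0 \<Longrightarrow> log_hessian a b b b = - 1"
  by (simp add: log_hessian_def perp_inner_right power2_eq_square)

lemma log_hessian_radical:
  assumes "gram a b \<noteq> 0" "\<And>y. log_hessian a b x y = 0"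
  shows "\<exists>l. x = l *\<^sub>R a"
proof -
  have "gram a b * (perp a x \<bullet> b) - 2 * (perp a b \<bullet> x) * gram a b = 0"
    using assms(2) [of b] assms(1) by (simp add: log_hessian_def perp_inner_right)
  then have "perp a b \<bullet> x = 0"
    using assms(1) by (simp add: perp_inner_commute [of a x b] mult.commute)
  then have "perp a x \<bullet> perp a x = 0"
    using assms(2) [of "perp a x"] assms(1) by (simp add: log_hessian_def)
  moreover have "a \<noteq> 0"
    using assms(1) by (auto simp: gram_def)
  ultimately show ?thesis
    using perp_eq_0D [of a x] by auto
qed

lemma linear_log_hessian: "linear (\<lambda>x. log_hessian a b x y)"
  by (rule linearI) (simp_all add: log_hessian_linear_simps)

lemma isCont_gram [continuous_intros]:
  "isCont f z \<Longrightarrow> isCont g z \<Longrightarrow> isCont (\<lambda>z. gram (f z) (g z)) z"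
  unfolding gram_def by (intro continuous_intros)

lemma isCont_log_hessian [continuous_intros]:
  assumes "isCont f z" "isCont g z" "gram a (f z) \<noteq> 0"
  shows "isCont (\<lambda>z. log_hessian a (f z) (g z) y) z"
  unfolding log_hessian_def perp_def by (intro continuous_intros assms) (use assms(3) in auto)

section \<open>Generic nondegeneracy\<close>

text \<open>A form \<open>B + \<delta>\<^sup>2 C\<close> with small \<open>\<delta>\<close> is as nondegenerate as \<open>B\<close> together with the restriction of
  \<open>C\<close> to the radical of \<open>B\<close>.\<close>

lemma radical_perturbation:
  fixes B :: "'a::euclidean_space \<Rightarrow> 'a \<Rightarrow> real" and C :: "real \<Rightarrow> 'a \<Rightarrow> 'a \<Rightarrow> real"
  assumes K: "subspace K"
    and linB: "\<And>v. linear (\<lambda>u. B u v)" and linC: "\<And>\<delta> v. linear (\<lambda>u. C \<delta> u v)"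
    and symB: "\<And>u v. B u v = B v u"
    and contC: "\<And>u v. isCont (\<lambda>z. C (fst z) (snd z) v) (0, u)"
    and radB: "\<And>u v. u \<in> K \<Longrightarrow> B u v = 0" and radC: "\<And>\<delta> u v. u \<in> K \<Longrightarrow> C \<delta> u v = 0"
    and nondeg: "\<And>u. (\<And>v. B u v = 0) \<Longrightarrow> (\<And>v. (\<And>x. B v x = 0) \<Longrightarrow> C 0 u v = 0) \<Longrightarrow> u \<in> K"
  shows "\<forall>\<^sub>F \<delta> in at_right 0. \<forall>u. (\<forall>v. B u v + \<delta>\<^sup>2 * C \<delta> u v = 0) \<longrightarrow> u \<in> K"
proof (rule ccontr)
  (* Otherwise there are unit vectors orthogonal to K in the radicals for a sequence of \<delta> tending to 0.
     By compactness they accumulate at a unit vector, which lies in K by the assumption nondeg. *)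
  assume "\<not> ?thesis"
  then have ex: "\<exists>\<delta> u. 0 < \<delta> \<and> \<delta> < e \<and> (\<forall>v. B u v + \<delta>\<^sup>2 * C \<delta> u v = 0) \<and> u \<notin> K" if "e > 0" for e
    using that unfolding eventually_at_right_field by blast
  have "\<exists>\<delta> u. 0 < \<delta> \<and> \<delta> < e \<and> (\<forall>v. B u v + \<delta>\<^sup>2 * C \<delta> u v = 0) \<and> norm u = 1 \<and>
      (\<forall>k\<in>K. k \<bullet> u = 0)" if e: "e > 0" for e
  proof -
    obtain \<delta> u where u: "0 < \<delta>" "\<delta> < e" "\<And>v. B u v + \<delta>\<^sup>2 * C \<delta> u v = 0" "u \<notin> K"
      using ex [OF e] by blast
    obtain y z where yz: "y \<in> span K" "\<And>w. w \<in> span K \<Longrightarrow> orthogonal z w" "u = y + z"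
      using orthogonal_subspace_decomp_exists [of K u] by metis
    have y: "y \<in> K"
      using yz(1) K by (simp add: span_eq_iff [THEN iffD2])
    with u(4) yz(3) have z: "z \<noteq> 0" by auto
    have rad: "B z v + \<delta>\<^sup>2 * C \<delta> z v = 0" for v
      using u(3) [of v] radB [OF y, of v] radC [OF y, of \<delta> v]
        linear_add [OF linB [of v], of y z] linear_add [OF linC [of \<delta> v], of y z] by (simp add: yz(3))
    have "B (z /\<^sub>R norm z) v + \<delta>\<^sup>2 * C \<delta> (z /\<^sub>R norm z) v = 0" for v
    proof -
      have "B (z /\<^sub>R norm z) v + \<delta>\<^sup>2 * C \<delta> (z /\<^sub>R norm z) v = (B z v + \<delta>\<^sup>2 * C \<delta> z v) / norm z"
        using linear_cmul [OF linB [of v], of "inverse (norm z)" z]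
          linear_cmul [OF linC [of \<delta> v], of "inverse (norm z)" z]
        by (simp add: divide_inverse algebra_simps)
      then show ?thesis by (simp add: rad)
    qed
    moreover have "\<forall>k\<in>K. k \<bullet> (z /\<^sub>R norm z) = 0"
      using yz(2) by (auto simp: orthogonal_def inner_commute span_base)
    ultimately show ?thesis
      using u(1,2) z by (intro exI [of _ \<delta>] exI [of _ "z /\<^sub>R norm z"]) simp
  qed
  then have "\<forall>n. \<exists>\<delta> u. 0 < \<delta> \<and> \<delta> < inverse (real (Suc n)) \<and> (\<forall>v. B u v + \<delta>\<^sup>2 * C \<delta> u v = 0) \<and>
      norm u = 1 \<and> (\<forall>k\<in>K. k \<bullet> u = 0)"
    by simp
  then obtain d u where du: "\<And>n. 0 < d n" "\<And>n. d n < inverse (real (Suc n))"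
      "\<And>n v. B (u n) v + (d n)\<^sup>2 * C (d n) (u n) v = 0"
      "\<And>n. norm (u n) = 1" "\<And>n k. k \<in> K \<Longrightarrow> k \<bullet> u n = 0"
    by metis
  have "\<forall>n. u n \<in> sphere 0 1"
    using du(4) by simp
  then obtain z r where z: "z \<in> sphere 0 1" "strict_mono r" "(u \<circ> r) \<longlonglongrightarrow> z"
    using compact_sphere [of "0::'a" 1] unfolding compact_def by blast
  have "d \<longlonglongrightarrow> 0"
    by (rule tendsto_sandwich [OF _ _ tendsto_const LIMSEQ_inverse_real_of_nat])
      (use du in \<open>auto intro!: always_eventually less_imp_le\<close>)
  then have d: "(d \<circ> r) \<longlonglongrightarrow> 0"
    using z(2) by (rule LIMSEQ_subseq_LIMSEQ)
  have limC: "(\<lambda>n. C (d (r n)) (u (r n)) v) \<longlonglongrightarrow> C 0 z v" for v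
    using isCont_tendsto_compose [OF contC tendsto_Pair [OF d z(3)]] by (simp add: o_def)
  have limB: "(\<lambda>n. B (u (r n)) v) \<longlonglongrightarrow> B z v" for v
    using isCont_tendsto_compose [OF linear_continuous_at [OF linB [THEN linear_conv_bounded_linear [THEN iffD1]]] z(3)]
    by (simp add: o_def)
  have "z \<in> K"
  proof (rule nondeg)
    fix v
    have "(\<lambda>n. - ((d (r n))\<^sup>2 * C (d (r n)) (u (r n)) v)) \<longlonglongrightarrow> - (0\<^sup>2 * C 0 z v)"
      using d limC [of v] by (intro tendsto_intros) (auto simp: o_def)
    moreover have "(\<lambda>n. - ((d (r n))\<^sup>2 * C (d (r n)) (u (r n)) v)) = (\<lambda>n. B (u (r n)) v)"
      using du(3) by (auto simp: fun_eq_iff add_eq_0_iff)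
    ultimately show "B z v = 0"
      using limB [of v] LIMSEQ_unique by fastforce
  next
    fix v assume "\<And>x. B v x = 0"
    then have "C (d (r n)) (u (r n)) v = 0" for n
      using du(3) [of "r n" v] du(1) [of "r n"] symB [of "u (r n)" v] by simp
    then show "C 0 z v = 0"
      using limC [of v] by (simp add: LIMSEQ_const_iff)
  qed
  then have "(\<lambda>n. z \<bullet> u (r n)) = (\<lambda>n. 0)"
    using du(5) by auto
  moreover have "(\<lambda>n. z \<bullet> u (r n)) \<longlonglongrightarrow> z \<bullet> z"
    using z(3) by (intro tendsto_intros) (auto simp: o_def)
  ultimately show False
    using z(1) by (simp add: LIMSEQ_const_iff)
qed

lemma exists_gram_nonzero:
  fixes a :: "'a::euclidean_space"
  assumes "DIM('a) \<ge> 2" "a \<noteq> 0"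
  obtains e where "gram a e \<noteq> 0"
proof -
  obtain e where e: "e \<noteq> 0" "orthogonal a e"
    using orthogonal_to_vector_exists [OF assms(1), of a] by blast
  then have "gram a e \<noteq> 0"
    using assms by (simp add: gram_def orthogonal_def)
  then show ?thesis by (rule that)
qed

text \<open>The Hessian of the weighted sum of the logarithms of the impact parameters over all ordered pairs of
  bodies in \<open>S\<close>, for velocities \<open>A\<close> and impact vectors \<open>c\<close>. Diagonal terms vanish.\<close>

definition pair_form ::
  "('n \<Rightarrow> 'n \<Rightarrow> real) \<Rightarrow> ('d::finite, 'n::{finite,linorder}) config \<Rightarrow> ('d, 'n) config \<Rightarrow> 'n set \<Rightarrow>
    ('d, 'n) config \<Rightarrow> ('d, 'n) config \<Rightarrow> real" where
  "pair_form k A c S u v = (\<Sum>i\<in>S. \<Sum>j\<in>S.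
    k i j * log_hessian (A $ i - A $ j) (c $ i - c $ j) (u $ i - u $ j) (v $ i - v $ j))"

lemma pair_form_insert:
  assumes "p \<notin> F" "\<And>i j. k i j = k j i"
  shows "pair_form k A c (insert p F) u v = pair_form k A c F u v +
    2 * (\<Sum>j\<in>F. k p j * log_hessian (A $ p - A $ j) (c $ p - c $ j) (u $ p - u $ j) (v $ p - v $ j))"
proof -
  let ?h = "\<lambda>i j. k i j * log_hessian (A $ i - A $ j) (c $ i - c $ j) (u $ i - u $ j) (v $ i - v $ j)"
  have fin: "finite F" by simp
  have "?h i j = ?h j i" for i j
    using log_hessian_minus(1) [of "A $ j - A $ i" "c $ i - c $ j" "u $ i - u $ j" "v $ i - v $ j"]
      log_hessian_minus(2) [of "A $ j - A $ i" "c $ j - c $ i" "u $ i - u $ j" "v $ i - v $ j"]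
      log_hessian_minus(3) [of "A $ j - A $ i" "c $ j - c $ i" "u $ j - u $ i" "v $ j - v $ i"]
      assms(2) [of i j]
    by simp
  then have "(\<Sum>i\<in>F. ?h i p) = (\<Sum>i\<in>F. ?h p i)" by simp
  then show ?thesis
    unfolding pair_form_def using assms(1) fin
    by (simp add: sum.distrib log_hessian_linear_simps)
qed

text \<open>The radical always contains the translations and the multiples of \<open>A\<close>; for suitable impact vectors it
  contains nothing else. In the induction a body \<open>p\<close> is added to the bodies in \<open>F\<close> in two steps, both
  of which use \<open>radical_perturbation\<close>. First, its impact vector relative to a cluster at \<open>0\<close> is chosen as
  \<open>b = A $ p - A $ q + \<sigma> *\<^sub>R e\<close> for a fixed \<open>q\<close> in \<open>F\<close>. For small \<open>\<sigma>\<close> the pair \<open>(p, q)\<close> dominates, and its only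
  degenerate direction is \<open>A $ p - A $ q\<close>; in this nearly radial direction all other pairs contribute negative
  terms. Second, the impact vectors in \<open>F\<close> are multiplied by a small \<open>\<delta>\<close>, so that they form
  such a cluster.\<close>

lemma exists_nondegenerate_impacts:
  fixes A :: "('d::finite, 'n::{finite,linorder}) config" and k :: "'n \<Rightarrow> 'n \<Rightarrow> real"
  assumes d2: "CARD('d) \<ge> 2"
    and k_sym: "\<And>i j. k i j = k j i" and k_pos: "\<And>i j. i \<noteq> j \<Longrightarrow> k i j > 0"
    and A_free: "\<And>i j. i \<noteq> j \<Longrightarrow> A $ i \<noteq> A $ j"
    and A_gen: "\<And>i j l. i \<noteq> j \<Longrightarrow> i \<noteq> l \<Longrightarrow> j \<noteq> l \<Longrightarrow> gram (A $ i - A $ j) (A $ i - A $ l) \<noteq> 0"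
    and S: "S \<noteq> {}"
  shows "\<exists>c. (\<forall>i\<in>S. \<forall>j\<in>S. i \<noteq> j \<longrightarrow> gram (A $ i - A $ j) (c $ i - c $ j) \<noteq> 0) \<and>
    (\<forall>u. (\<forall>v. pair_form k A c S u v = 0) \<longrightarrow> (\<exists>t l. \<forall>i\<in>S. u $ i = t + l *\<^sub>R A $ i))"
proof -
  have "finite S" by simp
  then show ?thesis
    using S
  proof (induction S rule: finite_ne_induct)
    case (singleton i)
    show ?case
      by (rule exI [of _ 0]) (auto intro!: exI [of _ "u $ i" for u] exI [of _ "0::real"])
  next
    case (insert p F)
    let ?a = "\<lambda>j. A $ p - A $ j"
    obtain c' where c'_gram: "\<And>i j. i \<in> F \<Longrightarrow> j \<in> F \<Longrightarrow> i \<noteq> j \<Longrightarrow> gram (A $ i - A $ j) (c' $ i - c' $ j) \<noteq> 0"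
      and c'_rad: "\<And>u. (\<And>v. pair_form k A c' F u v = 0) \<Longrightarrow> \<exists>t l. \<forall>i\<in>F. u $ i = t + l *\<^sub>R A $ i"
      using insert.IH by metis
    obtain q where q: "q \<in> F" using insert.hyps by blast
    have p_ne: "j \<noteq> p" if "j \<in> F" for j using that insert.hyps by auto
    have kp: "k p j > 0" if "j \<in> F" for j using k_pos p_ne [OF that] by metis
    obtain e where e: "gram (?a q) e \<noteq> 0"
      using exists_gram_nonzero [of "?a q"] A_free [OF p_ne [OF q]] d2 by (metis DIM_cart DIM_real mult.right_neutral right_minus_eq)

    (* For a single body q the direction A $ p - A $ q stays degenerate: it is the direction of A. *)
    define K1 where "K1 = (if F = {q} then span {?a q} else {0})"
    define B1 where "B1 = (\<lambda>x y. k p q * log_hessian (?a q) e x y)"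
    define C1 where "C1 = (\<lambda>\<sigma> x y. \<Sum>j\<in>F-{q}. k p j * log_hessian (?a j) (?a q + \<sigma> *\<^sub>R e) x y)"
    have gram1: "gram (?a j) (?a q + 0 *\<^sub>R e) \<noteq> 0" if "j \<in> F - {q}" for j
      using that A_gen [of p j q] p_ne [of j] p_ne [OF q] by auto
    have ev1: "\<forall>\<^sub>F \<sigma> in at_right 0. \<forall>x. (\<forall>y. B1 x y + \<sigma>\<^sup>2 * C1 \<sigma> x y = 0) \<longrightarrow> x \<in> K1"
    proof (rule radical_perturbation)
      show "subspace K1" by (simp add: K1_def)
      show "linear (\<lambda>u. B1 u v)" for v
        unfolding B1_def by (intro linear_compose_scale_right [where 'b = real, simplified] linear_log_hessian)
      show "linear (\<lambda>u. C1 \<sigma> u v)" for \<sigma> v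
        unfolding C1_def by (intro linear_compose_sum ballI linear_compose_scale_right [where 'b = real, simplified] linear_log_hessian)
      show "B1 u v = B1 v u" for u v
        by (simp add: B1_def log_hessian_commute)
      show "isCont (\<lambda>z. C1 (fst z) (snd z) v) (0, u)" for u v
        unfolding C1_def using gram1 by (intro continuous_intros) auto
      show "B1 u v = 0" if "u \<in> K1" for u v
        using that unfolding K1_def B1_def
        by (auto simp: span_singleton log_hessian_linear_simps split: if_splits)
      show "C1 \<sigma> u v = 0" if "u \<in> K1" for \<sigma> u v
        using that unfolding K1_def C1_def by (auto simp: log_hessian_linear_simps split: if_splits)
      fix x assume x: "\<And>y. B1 x y = 0" and xr: "\<And>y. (\<And>z. B1 y z = 0) \<Longrightarrow> C1 0 x y = 0"
      obtain l where l: "x = l *\<^sub>R ?a q"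
        using log_hessian_radical [OF e, of x] x kp [OF q] by (auto simp: B1_def)
      show "x \<in> K1"
      proof (cases "F = {q}")
        case True
        then show ?thesis by (auto simp: K1_def l span_base span_scale)
      next
        case False
        have "C1 0 x (?a q) = 0"
          by (rule xr) (simp add: B1_def log_hessian_linear_simps)
        moreover have "C1 0 x (?a q) = l * (\<Sum>j\<in>F-{q}. k p j * log_hessian (?a j) (?a q) (?a q) (?a q))"
          unfolding C1_def l sum_distrib_left by (intro sum.cong) (simp_all add: log_hessian_linear_simps)
        moreover have "(\<Sum>j\<in>F-{q}. k p j * log_hessian (?a j) (?a q) (?a q) (?a q)) = - (\<Sum>j\<in>F-{q}. k p j)"
          unfolding sum_negf [symmetric] using gram1 by (intro sum.cong) (auto simp: log_hessian_radial)
        moreover have "(\<Sum>j\<in>F-{q}. k p j) > 0"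
          using False q kp by (intro sum_pos) auto
        ultimately show ?thesis by (simp add: K1_def l span_zero)
      qed
    qed
    have "\<forall>\<^sub>F \<sigma> in at_right 0. gram (?a j) (?a q + \<sigma> *\<^sub>R e) \<noteq> 0" if "j \<in> F" for j
    proof (cases "j = q")
      case True
      show ?thesis
        using eventually_at_right_less [of 0]
        by eventually_elim (use e in \<open>auto simp: True gram_add_self gram_scaleR\<close>)
    next
      case False
      have "isCont (\<lambda>\<sigma>. gram (?a j) (?a q + \<sigma> *\<^sub>R e)) 0"
        by (intro continuous_intros)
      then have "((\<lambda>\<sigma>. gram (?a j) (?a q + \<sigma> *\<^sub>R e)) \<longlongrightarrow> gram (?a j) (?a q + 0 *\<^sub>R e)) (at_right 0)"
        unfolding isCont_def by (rule filterlim_mono) (auto intro: at_le)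
      then show ?thesis
        using tendsto_imp_eventually_ne gram1 False that by blast
    qed
    then have "\<forall>\<^sub>F \<sigma> in at_right 0. \<forall>j\<in>F. gram (?a j) (?a q + \<sigma> *\<^sub>R e) \<noteq> 0"
      by (simp add: eventually_ball_finite)
    from eventually_happens [OF eventually_conj [OF eventually_at_right_less [of 0] eventually_conj [OF this ev1]]]
    obtain \<sigma> where \<sigma>: "\<sigma> > 0" "\<And>j. j \<in> F \<Longrightarrow> gram (?a j) (?a q + \<sigma> *\<^sub>R e) \<noteq> 0"
        "\<And>x. (\<And>y. B1 x y + \<sigma>\<^sup>2 * C1 \<sigma> x y = 0) \<Longrightarrow> x \<in> K1"
      by auto
    define b where "b = ?a q + \<sigma> *\<^sub>R e"
    have b_gram: "gram (?a j) b \<noteq> 0" if "j \<in> F" for j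
      using \<sigma>(2) [OF that] by (simp add: b_def)
    have b_rad: "x \<in> K1" if "\<And>y. (\<Sum>j\<in>F. k p j * log_hessian (?a j) b x y) = 0" for x
    proof (rule \<sigma>(3))
      fix y
      have "(\<Sum>j\<in>F. k p j * log_hessian (?a j) b x y) = B1 x y / \<sigma>\<^sup>2 + C1 \<sigma> x y"
        using q \<sigma>(1) unfolding B1_def C1_def b_def
        by (subst sum.remove [of F q]) (simp_all add: log_hessian_add_self log_hessian_scaleR)
      then show "B1 x y + \<sigma>\<^sup>2 * C1 \<sigma> x y = 0"
        using that [of y] \<sigma>(1) by (simp add: field_simps)
    qed

    (* Second step: the form of the shrunken cluster, multiplied by \<delta>\<^sup>2, is the previous form. *)
    define K2 where "K2 = {u :: ('d, 'n) config. \<exists>t l. \<forall>i\<in>insert p F. u $ i = t + l *\<^sub>R A $ i}"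
    define C2 where "C2 = (\<lambda>\<delta> u v :: ('d, 'n) config.
      2 * (\<Sum>j\<in>F. k p j * log_hessian (?a j) (b - \<delta> *\<^sub>R c' $ j) (u $ p - u $ j) (v $ p - v $ j)))"
    have lin: "linear (\<lambda>u :: ('d, 'n) config. log_hessian a b (u $ i - u $ j) y)" for a b i j y
      by (rule linearI) (simp_all add: log_hessian_linear_simps algebra_simps flip: scaleR_diff_right)
    have K2_diff: "log_hessian (A $ i - A $ j) b' (u $ i - u $ j) y = 0"
      if u: "u \<in> K2" and ij: "i \<in> insert p F" "j \<in> insert p F" for u i j b' y
    proof -
      obtain t l where tl: "\<And>i. i \<in> insert p F \<Longrightarrow> u $ i = t + l *\<^sub>R A $ i"
        using u unfolding K2_def by blast
      then have "u $ i - u $ j = l *\<^sub>R (A $ i - A $ j)"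
        by (simp add: scaleR_diff_right tl [OF ij(1)] tl [OF ij(2)])
      then show ?thesis by (simp add: log_hessian_linear_simps)
    qed
    have ev2: "\<forall>\<^sub>F \<delta> in at_right 0. \<forall>u. (\<forall>v. pair_form k A c' F u v + \<delta>\<^sup>2 * C2 \<delta> u v = 0) \<longrightarrow> u \<in> K2"
    proof (rule radical_perturbation)
      show "subspace K2"
      proof (rule subspaceI)
        show "0 \<in> K2"
          unfolding K2_def by (intro CollectI exI [of _ 0]) simp
        fix x y assume "x \<in> K2" "y \<in> K2"
        then obtain t l t' l' where "\<forall>i\<in>insert p F. x $ i = t + l *\<^sub>R A $ i" "\<forall>i\<in>insert p F. y $ i = t' + l' *\<^sub>R A $ i"
          unfolding K2_def by blast
        then have "\<forall>i\<in>insert p F. (x + y) $ i = (t + t') + (l + l') *\<^sub>R A $ i"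
          by (simp add: algebra_simps)
        then show "x + y \<in> K2" unfolding K2_def by blast
      next
        fix c :: real and x assume "x \<in> K2"
        then obtain t l where "\<forall>i\<in>insert p F. x $ i = t + l *\<^sub>R A $ i"
          unfolding K2_def by blast
        then have "\<forall>i\<in>insert p F. (c *\<^sub>R x) $ i = c *\<^sub>R t + (c * l) *\<^sub>R A $ i"
          by (simp add: algebra_simps)
        then show "c *\<^sub>R x \<in> K2" unfolding K2_def by blast
      qed
      show "linear (\<lambda>u. pair_form k A c' F u v)" for v
        unfolding pair_form_def
        by (intro linear_compose_sum ballI linear_compose_scale_right [where 'b = real, simplified] lin)
      show "linear (\<lambda>u. C2 \<delta> u v)" for \<delta> v
        unfolding C2_def
        by (intro linear_compose_sum ballI linear_compose_scale_right [where 'b = real, simplified] lin)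
      show "pair_form k A c' F u v = pair_form k A c' F v u" for u v
        unfolding pair_form_def by (subst log_hessian_commute) (rule refl)
      show "isCont (\<lambda>z. C2 (fst z) (snd z) v) (0, u)" for u v
        unfolding C2_def using b_gram by (intro continuous_intros) auto
      show "pair_form k A c' F u v = 0" if "u \<in> K2" for u v
        unfolding pair_form_def by (intro sum.neutral ballI) (simp add: K2_diff [OF that])
      show "C2 \<delta> u v = 0" if "u \<in> K2" for \<delta> u v
        unfolding C2_def by (simp add: K2_diff [OF that])
      fix u assume u: "\<And>v. pair_form k A c' F u v = 0"
        and ur: "\<And>v. (\<And>x. pair_form k A c' F v x = 0) \<Longrightarrow> C2 0 u v = 0"
      obtain t l where tl: "\<And>i. i \<in> F \<Longrightarrow> u $ i = t + l *\<^sub>R A $ i"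
        using c'_rad [OF u] by blast
      define x where "x = u $ p - t - l *\<^sub>R A $ p"
      have "x \<in> K1"
      proof (rule b_rad)
        fix y :: "real^'d"
        (* A displacement of the body p alone is in the radical of the cluster. *)
        define v :: "('d, 'n) config" where "v = (\<chi> i. if i = p then y else 0)"
        have v: "v $ i = 0" if "i \<in> F" for i
          using p_ne [OF that] by (simp add: v_def)
        have "C2 0 u v = 0"
          by (rule ur) (simp add: pair_form_def v log_hessian_linear_simps)
        moreover have "C2 0 u v = 2 * (\<Sum>j\<in>F. k p j * log_hessian (?a j) b x y)"
        proof -
          have "log_hessian (?a j) b (u $ p - u $ j) (v $ p - v $ j) = log_hessian (?a j) b x y" if "j \<in> F" for j
          proof -
            have "u $ p - u $ j = x + l *\<^sub>R ?a j"
              by (simp add: x_def tl [OF that] algebra_simps)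
            then show ?thesis
              by (simp add: log_hessian_linear_simps v [OF that]) (simp add: v_def)
          qed
          then show ?thesis by (simp add: C2_def)
        qed
        ultimately show "(\<Sum>j\<in>F. k p j * log_hessian (?a j) b x y) = 0" by simp
      qed
      show "u \<in> K2"
      proof (cases "F = {q}")
        case False
        then have "u $ p = t + l *\<^sub>R A $ p"
          using \<open>x \<in> K1\<close> by (simp add: K1_def x_def algebra_simps)
        then show ?thesis
          unfolding K2_def using tl by blast
      next
        case True
        then obtain l' where "x = l' *\<^sub>R ?a q"
          using \<open>x \<in> K1\<close> by (auto simp: K1_def span_singleton)
        then have "\<forall>i\<in>insert p F. u $ i = (t - l' *\<^sub>R A $ q) + (l + l') *\<^sub>R A $ i"
          using tl [OF q] True by (auto simp: x_def algebra_simps)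
        then show ?thesis
          unfolding K2_def by blast
      qed
    qed
    have "\<forall>\<^sub>F \<delta> in at_right 0. gram (?a j) (b - \<delta> *\<^sub>R c' $ j) \<noteq> 0" if "j \<in> F" for j
    proof -
      have "isCont (\<lambda>\<delta>. gram (?a j) (b - \<delta> *\<^sub>R c' $ j)) 0"
        by (intro continuous_intros)
      then have "((\<lambda>\<delta>. gram (?a j) (b - \<delta> *\<^sub>R c' $ j)) \<longlongrightarrow> gram (?a j) (b - 0 *\<^sub>R c' $ j)) (at_right 0)"
        unfolding isCont_def by (rule filterlim_mono) (auto intro: at_le)
      then show ?thesis
        using tendsto_imp_eventually_ne b_gram [OF that] by fastforce
    qed
    then have "\<forall>\<^sub>F \<delta> in at_right 0. \<forall>j\<in>F. gram (?a j) (b - \<delta> *\<^sub>R c' $ j) \<noteq> 0"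
      by (simp add: eventually_ball_finite)
    from eventually_happens [OF eventually_conj [OF eventually_at_right_less [of 0] eventually_conj [OF this ev2]]]
    obtain \<delta> where \<delta>: "\<delta> > 0" "\<And>j. j \<in> F \<Longrightarrow> gram (?a j) (b - \<delta> *\<^sub>R c' $ j) \<noteq> 0"
        "\<And>u. (\<And>v. pair_form k A c' F u v + \<delta>\<^sup>2 * C2 \<delta> u v = 0) \<Longrightarrow> u \<in> K2"
      by auto
    define c where "c = (\<chi> i. if i = p then b else \<delta> *\<^sub>R c' $ i)"
    have cF: "c $ i = \<delta> *\<^sub>R c' $ i" if "i \<in> F" for i
      using p_ne [OF that] by (simp add: c_def)
    have cp: "c $ p = b" by (simp add: c_def)
    have "pair_form k A c F u v = pair_form k A c' F u v / \<delta>\<^sup>2" for u v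
      unfolding pair_form_def sum_divide_distrib using \<delta>(1)
      by (intro sum.cong refl)
        (simp add: cF log_hessian_scaleR flip: scaleR_diff_right)
    then have form: "\<delta>\<^sup>2 * pair_form k A c (insert p F) u v = pair_form k A c' F u v + \<delta>\<^sup>2 * C2 \<delta> u v" for u v
      using \<delta>(1) insert.hyps by (simp add: pair_form_insert [OF _ k_sym] C2_def cF cp field_simps)
    show ?case
    proof (intro exI [of _ c] conjI ballI allI impI)
      fix i j assume ij: "i \<in> insert p F" "j \<in> insert p F" "i \<noteq> j"
      consider "i = p" "j \<in> F" | "j = p" "i \<in> F" | "i \<in> F" "j \<in> F"
        using ij by auto
      then show "gram (A $ i - A $ j) (c $ i - c $ j) \<noteq> 0"
      proof cases
        case 1
        then show ?thesis using \<delta>(2) by (simp add: cF cp)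
      next
        case 2
        then show ?thesis
          using \<delta>(2) gram_minus(1) [of "?a i" "c $ i - c $ j"] gram_minus(2) [of "?a i" "c $ p - c $ i"] by (simp add: cF cp)
      next
        case 3
        then show ?thesis
          using c'_gram ij(3) \<delta>(1) by (simp add: cF gram_scaleR flip: scaleR_diff_right)
      qed
    next
      fix u assume "\<forall>v. pair_form k A c (insert p F) u v = 0"
      then have "u \<in> K2"
        using form [of u] by (intro \<delta>(3)) simp
      then show "\<exists>t l. \<forall>i\<in>insert p F. u $ i = t + l *\<^sub>R A $ i"
        by (simp add: K2_def)
    qed
  qed
qed

section \<open>Scattering to first order\<close>

text \<open>The total force of a fixed attracting centre on a particle moving along the straight line
  \<open>- (r *\<^sub>R a + b)\<close> relative to it, integrated over all \<open>r\<close> (see \<open>newton_kernel_line_integral\<close>).\<close>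

definition kick :: "'a::real_inner \<Rightarrow> 'a \<Rightarrow> 'a" where
  "kick a b = (2 / (norm a * gram a b)) *\<^sub>R perp a b"

lemma kick_minus: "kick (- a) (- b) = - kick a b"
  by (simp add: kick_def perp_linear_simps)

lemma gram_line: "gram a b = (a \<bullet> a) * (norm (r *\<^sub>R a + b))\<^sup>2 - ((r *\<^sub>R a + b) \<bullet> a)\<^sup>2"
proof -
  have "gram a b = (a \<bullet> a) * ((r *\<^sub>R a + b) \<bullet> (r *\<^sub>R a + b)) - ((r *\<^sub>R a + b) \<bullet> a)\<^sup>2"
    by (simp add: gram_def inner_add_left inner_add_right inner_commute power2_eq_square algebra_simps)
  then show ?thesis by (simp add: power2_norm_eq_inner)
qed

lemma gram_le_line: "gram a b \<le> (a \<bullet> a) * (norm (r *\<^sub>R a + b))\<^sup>2"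
  using gram_line [of a b r] by simp

lemma gram_nonneg: "gram a b \<ge> 0"
  using Cauchy_Schwarz_ineq [of a b] by (simp add: gram_def power2_eq_square)

lemma gram_pos_iff: "gram a b > 0 \<longleftrightarrow> gram a b \<noteq> 0"
  using gram_nonneg [of a b] by linarith

lemma line_nonzero: "gram a b \<noteq> 0 \<Longrightarrow> r *\<^sub>R a + b \<noteq> 0"
  using gram_le_line [of a b r] gram_nonneg [of a b] by auto

text \<open>With \<open>x\<close> split into its constant part orthogonal to \<open>a\<close> and its part parallel to \<open>a\<close>, the kernel is
  integrated by means of the derivatives of \<open>(x \<bullet> a) / norm x\<close> and \<open>1 / norm x\<close>.\<close>

lemma newton_kernel_line_primitive:
  fixes a b :: "'a::real_inner"
  assumes "gram a b \<noteq> 0"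
  defines "x \<equiv> \<lambda>r. r *\<^sub>R a + b"
  defines "K \<equiv> \<lambda>r. ((x r \<bullet> a) / norm (x r)) *\<^sub>R ((1 / (gram a b * (a \<bullet> a))) *\<^sub>R perp a b) -
    ((1 / norm (x r))) *\<^sub>R ((1 / (a \<bullet> a)) *\<^sub>R a)"
  shows "(K has_vector_derivative newton_kernel (x r)) (at r)"
proof -
  have x_ne: "x r \<noteq> 0" unfolding x_def by (rule line_nonzero [OF assms(1)])
  have a_ne: "a \<noteq> 0" using assms(1) by (auto simp: gram_def)
  have x': "(x has_vector_derivative a) (at r)"
    unfolding x_def by (auto intro!: derivative_eq_intros)
  have inv: "((\<lambda>r. 1 / norm (x r)) has_real_derivative - (newton_kernel (x r) \<bullet> a)) (at r)"
    unfolding has_field_derivative_def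
    by (rule has_derivative_eq_rhs [OF has_derivative_compose
          [OF x' [unfolded has_vector_derivative_def] has_derivative_inverse_norm [OF x_ne]]])
      (simp add: fun_eq_iff)
  have num: "((\<lambda>r. x r \<bullet> a) has_real_derivative a \<bullet> a) (at r)"
    unfolding x_def by (auto intro!: derivative_eq_intros simp: inner_add_left)
  have coeff: "((\<lambda>r. (x r \<bullet> a) / norm (x r)) has_real_derivative gram a b / norm (x r) ^ 3) (at r)"
  proof -
    have g: "gram a b = (a \<bullet> a) * (norm (x r))\<^sup>2 - (x r \<bullet> a)\<^sup>2"
      unfolding x_def by (rule gram_line)
    have "((\<lambda>r. (x r \<bullet> a) * (1 / norm (x r))) has_real_derivative
        (a \<bullet> a) * (1 / norm (x r)) + - (newton_kernel (x r) \<bullet> a) * (x r \<bullet> a)) (at r)"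
      by (rule DERIV_mult [OF num inv])
    moreover have "(a \<bullet> a) * (1 / norm (x r)) + - (newton_kernel (x r) \<bullet> a) * (x r \<bullet> a) = gram a b / norm (x r) ^ 3"
      unfolding g using x_ne by (simp add: newton_kernel_def power2_eq_square power3_eq_cube field_simps)
    ultimately show ?thesis by simp
  qed
  have decomp: "x r = (1 / (a \<bullet> a)) *\<^sub>R perp a b + ((x r \<bullet> a) / (a \<bullet> a)) *\<^sub>R a"
    using a_ne by (simp add: perp_def x_def scaleR_diff_right scaleR_add_left inner_add_left inner_add_right inner_commute add_divide_distrib scaleR_add_left)
  have "(K has_vector_derivative
      ((x r \<bullet> a) / norm (x r)) *\<^sub>R 0 + (gram a b / norm (x r) ^ 3) *\<^sub>R ((1 / (gram a b * (a \<bullet> a))) *\<^sub>R perp a b) -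
      ((1 / norm (x r)) *\<^sub>R 0 + (- (newton_kernel (x r) \<bullet> a)) *\<^sub>R ((1 / (a \<bullet> a)) *\<^sub>R a))) (at r)"
    unfolding K_def
    by (intro has_vector_derivative_diff has_vector_derivative_scaleR coeff inv has_vector_derivative_const)
  moreover have "(gram a b / norm (x r) ^ 3) *\<^sub>R ((1 / (gram a b * (a \<bullet> a))) *\<^sub>R perp a b) +
      (newton_kernel (x r) \<bullet> a) *\<^sub>R ((1 / (a \<bullet> a)) *\<^sub>R a) = newton_kernel (x r)"
  proof -
    have ka: "newton_kernel (x r) \<bullet> a = (1 / norm (x r) ^ 3) * (x r \<bullet> a)"
      by (simp add: newton_kernel_def divide_inverse)
    have "newton_kernel (x r) = (1 / norm (x r) ^ 3) *\<^sub>R x r"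
      by (simp add: newton_kernel_def divide_inverse)
    also have "\<dots> = (1 / norm (x r) ^ 3) *\<^sub>R ((1 / (a \<bullet> a)) *\<^sub>R perp a b + ((x r \<bullet> a) / (a \<bullet> a)) *\<^sub>R a)"
      using decomp by simp
    also have "\<dots> = (gram a b / norm (x r) ^ 3) *\<^sub>R ((1 / (gram a b * (a \<bullet> a))) *\<^sub>R perp a b) +
        (newton_kernel (x r) \<bullet> a) *\<^sub>R ((1 / (a \<bullet> a)) *\<^sub>R a)"
      unfolding ka using assms(1) by (simp add: scaleR_add_right)
    finally show ?thesis by simp
  qed
  ultimately show ?thesis by simp
qed

lemma newton_kernel_line_integral:
  fixes a b :: "'a::euclidean_space"
  assumes g: "gram a b \<noteq> 0"
    and F': "\<And>r. (F has_vector_derivative newton_kernel (r *\<^sub>R a + b)) (at r)"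
    and F_bot: "(F \<longlongrightarrow> 0) at_bot"
  shows "(F \<longlongrightarrow> kick a b) at_top"
proof -
  define x where "x = (\<lambda>r. r *\<^sub>R a + b)"
  define P where "P = (1 / (gram a b * (a \<bullet> a))) *\<^sub>R perp a b"
  define Q where "Q = (1 / (a \<bullet> a)) *\<^sub>R a"
  define K where "K = (\<lambda>r. ((x r \<bullet> a) / norm (x r)) *\<^sub>R P - (1 / norm (x r)) *\<^sub>R Q)"
  have K': "(K has_vector_derivative newton_kernel (x r)) (at r)" for r
    unfolding K_def P_def Q_def x_def by (rule newton_kernel_line_primitive [OF g])
  have a_ne: "a \<noteq> 0" using g by (auto simp: gram_def)
  have x': "(x has_vector_derivative a) (at r)" for r
    unfolding x_def by (auto intro!: derivative_eq_intros)
  note x_top = tendsto_quotient_at_top [OF x' tendsto_const]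
    and x_bot = tendsto_quotient_at_bot [OF x' tendsto_const]
  have K_top: "(K \<longlongrightarrow> (norm a) *\<^sub>R P) at_top"
  proof -
    have "((\<lambda>r. (((x r /\<^sub>R r) \<bullet> a) / norm (x r /\<^sub>R r)) *\<^sub>R P - (inverse r * (1 / norm (x r /\<^sub>R r))) *\<^sub>R Q)
        \<longlongrightarrow> ((a \<bullet> a) / norm a) *\<^sub>R P - (0 * (1 / norm a)) *\<^sub>R Q) at_top"
      using a_ne by (intro tendsto_intros x_top tendsto_inverse_0_at_top filterlim_ident) auto
    moreover have "\<forall>\<^sub>F r in at_top. (((x r /\<^sub>R r) \<bullet> a) / norm (x r /\<^sub>R r)) *\<^sub>R P - (inverse r * (1 / norm (x r /\<^sub>R r))) *\<^sub>R Q = K r"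
      using eventually_gt_at_top [of 0]
      by eventually_elim (simp add: K_def field_simps)
    ultimately have "(K \<longlongrightarrow> ((a \<bullet> a) / norm a) *\<^sub>R P - (0 * (1 / norm a)) *\<^sub>R Q) at_top"
      by (rule Lim_transform_eventually)
    then show ?thesis
      by (simp add: norm_eq_sqrt_inner real_div_sqrt)
  qed
  have K_bot: "(K \<longlongrightarrow> - (norm a) *\<^sub>R P) at_bot"
  proof -
    have "((\<lambda>r. (- (((x r /\<^sub>R r) \<bullet> a) / norm (x r /\<^sub>R r))) *\<^sub>R P - (- inverse r * (1 / norm (x r /\<^sub>R r))) *\<^sub>R Q)
        \<longlongrightarrow> (- ((a \<bullet> a) / norm a)) *\<^sub>R P - (- 0 * (1 / norm a)) *\<^sub>R Q) at_bot"
      using a_ne by (intro tendsto_intros x_bot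
        filterlim_mono [OF tendsto_inverse_0 order_refl at_bot_le_at_infinity]) auto
    moreover have "\<forall>\<^sub>F r in at_bot. (- (((x r /\<^sub>R r) \<bullet> a) / norm (x r /\<^sub>R r))) *\<^sub>R P - (- inverse r * (1 / norm (x r /\<^sub>R r))) *\<^sub>R Q = K r"
      using eventually_gt_at_bot [of 0]
    proof eventually_elim
      case (elim r)
      have "- (((x r /\<^sub>R r) \<bullet> a) / norm (x r /\<^sub>R r)) = (x r \<bullet> a) / norm (x r)"
        "- inverse r * (1 / norm (x r /\<^sub>R r)) = 1 / norm (x r)"
        using elim by (simp_all add: field_simps)
      then show ?case by (simp only: K_def)
    qed
    ultimately have "(K \<longlongrightarrow> (- ((a \<bullet> a) / norm a)) *\<^sub>R P - (- 0 * (1 / norm a)) *\<^sub>R Q) at_bot"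
      by (rule Lim_transform_eventually)
    then show ?thesis
      by (simp add: norm_eq_sqrt_inner real_div_sqrt)
  qed
  have "((\<lambda>r. F r - K r) has_vector_derivative 0) (at r within UNIV)" for r
    using has_vector_derivative_diff [OF F' K', of r] by (simp add: x_def)
  then obtain C where C: "\<And>r. F r - K r = C"
    using has_vector_derivative_zero_constant [of UNIV "\<lambda>r. F r - K r"] by auto
  have "((\<lambda>r. F r - K r) \<longlongrightarrow> 0 - (- (norm a) *\<^sub>R P)) at_bot"
    by (intro tendsto_diff F_bot K_bot)
  then have "C = norm a *\<^sub>R P"
    by (simp add: C tendsto_const_iff)
  then have "F = (\<lambda>r. K r + norm a *\<^sub>R P)"
    using C by (auto simp: fun_eq_iff algebra_simps)
  then have "(F \<longlongrightarrow> norm a *\<^sub>R P + norm a *\<^sub>R P) at_top"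
    using tendsto_add [OF K_top tendsto_const] by simp
  moreover have "norm a *\<^sub>R P + norm a *\<^sub>R P = kick a b"
    using a_ne by (simp add: P_def kick_def power2_norm_eq_inner [symmetric] power2_eq_square divide_simps flip: scaleR_left_distrib)
  ultimately show ?thesis by simp
qed

text \<open>The integral of the force along the straight motion \<open>r *\<^sub>R A + c\<close>: the first-order change of the
  velocities. The kick with \<open>j = i\<close> is \<open>0\<close>.\<close>

definition total_kick ::
  "('n::{finite,linorder} \<Rightarrow> real) \<Rightarrow> ('d::finite, 'n) config \<Rightarrow> ('d, 'n) config \<Rightarrow> ('d, 'n) config" where
  "total_kick m A c = (\<chi> i. \<Sum>j\<in>UNIV. m j *\<^sub>R kick (A $ j - A $ i) (c $ j - c $ i))"

lemma has_derivative_vec_lambda: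
  fixes f :: "'n::finite \<Rightarrow> 'a::real_normed_vector \<Rightarrow> 'b::euclidean_space"
  assumes "\<And>i. (f i has_derivative f' i) (at x)"
  shows "((\<lambda>x. \<chi> i. f i x) has_derivative (\<lambda>u. \<chi> i. f' i u)) (at x)"
  by (subst has_derivative_componentwise_within)
    (auto simp: Basis_vec_def inner_axis intro!: has_derivative_inner_left assms)

lemma kick_has_derivative:
  fixes a b :: "'a::real_inner"
  assumes "gram a b \<noteq> 0"
  shows "(kick a has_derivative (\<lambda>u. (2 / norm a) *\<^sub>R ((1 / gram a b) *\<^sub>R perp a u -
    (2 * (perp a b \<bullet> u) / (gram a b)\<^sup>2) *\<^sub>R perp a b))) (at b)"
proof -
  have g': "(gram a has_derivative (\<lambda>u. 2 * (perp a b \<bullet> u))) (at b)"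
    unfolding gram_def
    by (rule has_derivative_eq_rhs)
      (auto intro!: derivative_eq_intros simp: perp_def inner_diff_left inner_commute power2_eq_square algebra_simps)
  have p': "(perp a has_derivative perp a) (at b)"
    unfolding perp_def by (auto intro!: derivative_eq_intros)
  have a_ne: "a \<noteq> 0" using assms by (auto simp: gram_def)
  have "((\<lambda>b. (2 / norm a) *\<^sub>R ((1 / gram a b) *\<^sub>R perp a b)) has_derivative
      (\<lambda>u. (2 / norm a) *\<^sub>R ((1 / gram a b) *\<^sub>R perp a u -
    (2 * (perp a b \<bullet> u) / (gram a b)\<^sup>2) *\<^sub>R perp a b))) (at b)"
    by (rule has_derivative_eq_rhs [OF has_derivative_scaleR_right [OF has_derivative_scaleR [OF has_derivative_divide [OF has_derivative_const g' assms] p']]])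
      (use assms in \<open>simp add: fun_eq_iff power2_eq_square divide_simps\<close>)
  then show ?thesis
    by (simp add: kick_def [abs_def] fun_eq_iff)
qed

lemma inner_kick_derivative:
  "((1 / gram a b) *\<^sub>R perp a x - (2 * (perp a b \<bullet> x) / (gram a b)\<^sup>2) *\<^sub>R perp a b) \<bullet> y = log_hessian a b x y"
  by (cases "gram a b = 0") (simp_all add: log_hessian_def inner_diff_left power2_eq_square field_simps)

lemma total_kick_derivative:
  fixes A c :: "('d::finite, 'n::{finite,linorder}) config"
  assumes gram: "\<And>i j. i \<noteq> j \<Longrightarrow> gram (A $ i - A $ j) (c $ i - c $ j) \<noteq> 0"
  obtains L where "(total_kick m A has_derivative L) (at c)"
    "\<And>u v. mass_inner m (L u) v = - pair_form (\<lambda>i j. m i * m j / norm (A $ i - A $ j)) A c UNIV u v"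
proof -
  define D where "D = (\<lambda>i j u. if i = j then 0 else
      (2 / norm (A $ j - A $ i)) *\<^sub>R
        ((1 / gram (A $ j - A $ i) (c $ j - c $ i)) *\<^sub>R perp (A $ j - A $ i) u -
         (2 * (perp (A $ j - A $ i) (c $ j - c $ i) \<bullet> u) / (gram (A $ j - A $ i) (c $ j - c $ i))\<^sup>2)
           *\<^sub>R perp (A $ j - A $ i) (c $ j - c $ i)))"
  define L where "L = (\<lambda>u. \<chi> i. \<Sum>j\<in>UNIV. m j *\<^sub>R D i j (u $ j - u $ i))"
  have kick': "((\<lambda>c. kick (A $ j - A $ i) (c $ j - c $ i)) has_derivative (\<lambda>u. D i j (u $ j - u $ i))) (at c)" for i j
  proof (cases "i = j")
    case True
    then show ?thesis by (simp add: D_def kick_def)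
  next
    case False
    have B: "bounded_linear (\<lambda>q :: ('d, 'n) config. q $ j - q $ i)"
      by (intro bounded_linear_sub bounded_linear_vec_nth)
    show ?thesis
      using has_derivative_compose [OF bounded_linear_imp_has_derivative [OF B] kick_has_derivative [OF gram [of j i]]] False
      by (simp add: D_def)
  qed
  have "(total_kick m A has_derivative L) (at c)"
    unfolding total_kick_def [abs_def] L_def
    by (intro has_derivative_vec_lambda has_derivative_sum has_derivative_scaleR_right kick')
  moreover have "mass_inner m (L u) v = - pair_form (\<lambda>i j. m i * m j / norm (A $ i - A $ j)) A c UNIV u v" for u v
  proof -
    let ?F = "\<lambda>i j. (m i * m j) *\<^sub>R D i j (u $ j - u $ i)"
    have anti: "?F i j = - ?F j i" for i j
    proof -
      have "D i j (u $ j - u $ i) = - D j i (u $ i - u $ j)"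
        using gram_minus [of "A $ i - A $ j" "c $ i - c $ j"] gram_minus [of "A $ j - A $ i" "c $ i - c $ j"]
          perp_minus_left [of "A $ i - A $ j" "c $ i - c $ j"] perp_linear_simps(4) [of "A $ j - A $ i" "c $ i - c $ j"]
          perp_minus_left [of "A $ i - A $ j" "u $ i - u $ j"] perp_linear_simps(4) [of "A $ j - A $ i" "u $ i - u $ j"]
        by (auto simp: D_def norm_minus_commute inner_diff_right algebra_simps)
      then show ?thesis by (simp add: mult.commute)
    qed
    have "mass_inner m (L u) v = (\<Sum>i\<in>UNIV. (\<Sum>j\<in>UNIV. ?F i j) \<bullet> v $ i)"
      by (simp add: mass_inner_def L_def inner_sum_left sum_distrib_left mult.assoc)
    also have "\<dots> = (\<Sum>i\<in>UNIV. \<Sum>j\<in>UNIV. ?F i j \<bullet> (v $ i - v $ j)) / 2"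
      by (rule sum_antisymmetric_inner [OF anti])
    also have "\<dots> = - pair_form (\<lambda>i j. m i * m j / norm (A $ i - A $ j)) A c UNIV u v"
    proof -
      have "?F i j \<bullet> (v $ i - v $ j) / 2 = - (m i * m j / norm (A $ i - A $ j) *
          log_hessian (A $ i - A $ j) (c $ i - c $ j) (u $ i - u $ j) (v $ i - v $ j))" for i j
      proof (cases "i = j")
        case False
        let ?a = "A $ j - A $ i" and ?b = "c $ j - c $ i" and ?x = "u $ j - u $ i" and ?y = "v $ j - v $ i"
        have "?F i j \<bullet> (v $ i - v $ j) = - (?F i j \<bullet> ?y)"
          by (simp add: inner_diff_right)
        also have "?F i j \<bullet> ?y = m i * m j * (2 / norm ?a * log_hessian ?a ?b ?x ?y)"
          using False by (simp add: D_def inner_kick_derivative)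
        also have "log_hessian ?a ?b ?x ?y = log_hessian (- ?a) (- ?b) (- ?x) (- ?y)"
          by (simp del: minus_diff_eq)
        finally show ?thesis
          by (simp add: norm_minus_commute)
      qed (simp add: D_def)
      then show ?thesis
        unfolding pair_form_def sum_negf [symmetric] sum_divide_distrib by (intro sum.cong refl)
    qed
    finally show ?thesis .
  qed
  ultimately show ?thesis by (rule that)
qed

text \<open>The collision-free velocities \<open>A\<close> such that no three of the points \<open>A $ i\<close> lie on a line.\<close>

definition generic_velocities :: "('n::{finite,linorder} \<Rightarrow> real) \<Rightarrow> ('d::finite, 'n) config set" where
  "generic_velocities m = {A \<in> centered_free m. \<forall>i j l. i \<noteq> j \<and> i \<noteq> l \<and> j \<noteq> l \<longrightarrow>
    gram (A $ i - A $ j) (A $ i - A $ l) \<noteq> 0}"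

text \<open>The terms added to \<open>L u\<close> only remove the kernel which the derivative of the total kick has for
  trivial reasons: the direction \<open>A\<close>, which amounts to a time shift, and the translations.\<close>

lemma nondegenerate_total_kick:
  fixes A :: "('d::finite, 'n::{finite,linorder}) config"
  assumes d2: "CARD('d) \<ge> 2" and mass_pos: "\<And>i. m i > 0"
    and A: "A \<in> generic_velocities m" and A_ne: "A \<noteq> 0"
  obtains c L where "c \<in> centered m"
    "\<And>i j. i \<noteq> j \<Longrightarrow> gram (A $ i - A $ j) (c $ i - c $ j) \<noteq> 0"
    "(total_kick m A has_derivative L) (at c)"
    "\<And>u. L u + mass_inner m A u *\<^sub>R A + (\<chi> i. \<Sum>j\<in>UNIV. m j *\<^sub>R u $ j) = 0 \<Longrightarrow> u = 0"
proof -
  define k where "k = (\<lambda>i j. m i * m j / norm (A $ i - A $ j))"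
  have A_free: "A $ i \<noteq> A $ j" if "i \<noteq> j" for i j
    using A that by (auto simp: generic_velocities_def centered_free_def collisions_def)
  have A_cent: "A \<in> centered m"
    using A by (auto simp: generic_velocities_def centered_free_def)
  define M where "M = (\<Sum>i\<in>UNIV. m i)"
  have M_pos: "M > 0"
    unfolding M_def using mass_pos by (intro sum_pos) auto
  have "\<exists>c. (\<forall>i\<in>UNIV. \<forall>j\<in>UNIV. i \<noteq> j \<longrightarrow> gram (A $ i - A $ j) (c $ i - c $ j) \<noteq> 0) \<and>
    (\<forall>u. (\<forall>v. pair_form k A c UNIV u v = 0) \<longrightarrow> (\<exists>t l. \<forall>i\<in>UNIV. u $ i = t + l *\<^sub>R A $ i))"
  proof (rule exists_nondegenerate_impacts [OF d2])
    show "k i j = k j i" for i j by (simp add: k_def norm_minus_commute mult.commute)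
    show "k i j > 0" if "i \<noteq> j" for i j
      using that A_free mass_pos by (simp add: k_def)
  qed (use A A_free in \<open>auto simp: generic_velocities_def\<close>)
  then obtain c' where c'_gram: "\<And>i j. i \<noteq> j \<Longrightarrow> gram (A $ i - A $ j) (c' $ i - c' $ j) \<noteq> 0"
    and c'_rad: "\<And>u. (\<And>v. pair_form k A c' UNIV u v = 0) \<Longrightarrow> \<exists>t l. \<forall>i. u $ i = t + l *\<^sub>R A $ i"
    by auto
  define c where "c = (\<chi> i. c' $ i - (\<Sum>j\<in>UNIV. m j *\<^sub>R c' $ j) /\<^sub>R M)"
  have c_diff: "c $ i - c $ j = c' $ i - c' $ j" for i j
    by (simp add: c_def)
  have sum_const: "(\<Sum>i\<in>UNIV. m i *\<^sub>R w) = M *\<^sub>R w" for w :: "real^'d"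
    by (simp add: M_def scaleR_sum_left)
  have c: "c \<in> centered m"
    using M_pos by (simp add: centered_def c_def scaleR_diff_right sum_subtractf sum_const del: scaleR_scaleR) simp
  have gram_c: "gram (A $ i - A $ j) (c $ i - c $ j) \<noteq> 0" if "i \<noteq> j" for i j
    unfolding c_diff by (rule c'_gram [OF that])
  obtain L where L: "(total_kick m A has_derivative L) (at c)"
    and L_form: "\<And>u v. mass_inner m (L u) v = - pair_form k A c UNIV u v"
    using total_kick_derivative [OF gram_c, where m = m] unfolding k_def by blast
  have form_c: "pair_form k A c UNIV = pair_form k A c' UNIV"
    by (simp add: pair_form_def c_diff fun_eq_iff)
  have "u = 0" if zero: "L u + mass_inner m A u *\<^sub>R A + (\<chi> i. \<Sum>j\<in>UNIV. m j *\<^sub>R u $ j) = 0" for u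
  proof -
    define p where "p = (\<Sum>j\<in>UNIV. m j *\<^sub>R u $ j)"
    have const: "mass_inner m (\<chi> i. p) v = p \<bullet> (\<Sum>j\<in>UNIV. m j *\<^sub>R v $ j)" for v
      by (simp add: mass_inner_def inner_sum_right)
    have eq: "- pair_form k A c UNIV u v + mass_inner m A u * mass_inner m A v + p \<bullet> (\<Sum>j\<in>UNIV. m j *\<^sub>R v $ j) = 0" for v
    proof -
      have "mass_inner m (L u + mass_inner m A u *\<^sub>R A + (\<chi> i. p)) v = 0"
        using zero by (simp add: p_def mass_inner_linear_simps)
      then show ?thesis
        by (simp only: mass_inner_linear_simps const L_form)
    qed
    (* Testing with A and with translations, which the form does not see, kills both added terms. *)
    have "pair_form k A c UNIV u A = 0"
      unfolding pair_form_def
      by (intro sum.neutral ballI) (subst log_hessian_commute, simp add: log_hessian_linear_simps)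
    then have "mass_inner m A u * mass_inner m A A = 0"
      using eq [of A] A_cent by (simp add: centered_def)
    then have Au: "mass_inner m A u = 0"
      using A_ne mass_inner_eq_0_iff [of m A, OF mass_pos] by simp
    have "pair_form k A c UNIV u (\<chi> i. p) = 0"
      by (simp add: pair_form_def log_hessian_linear_simps)
    then have "p \<bullet> (M *\<^sub>R p) = 0"
      using eq [of "\<chi> i. p"] Au by (simp add: sum_const)
    then have p0: "p = 0"
      using M_pos by simp
    then have "pair_form k A c' UNIV u v = 0" for v
      using eq [of v] Au by (simp add: form_c)
    then obtain t l where tl: "\<And>i. u $ i = t + l *\<^sub>R A $ i"
      using c'_rad by blast
    have "p = M *\<^sub>R t + l *\<^sub>R (\<Sum>j\<in>UNIV. m j *\<^sub>R A $ j)"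
      by (simp add: p_def tl scaleR_add_right sum.distrib sum_const scaleR_sum_right mult.commute)
    then have "t = 0"
      using p0 A_cent M_pos by (simp add: centered_def)
    then have "u = l *\<^sub>R A"
      using tl by (simp add: vec_eq_iff)
    then show "u = 0"
      using Au A_ne mass_inner_eq_0_iff [of m A, OF mass_pos] by (simp add: mass_inner_linear_simps)
  qed
  then show ?thesis
    using that [OF c gram_c L] by blast
qed

section \<open>Primitives on the whole line\<close>

text \<open>All integrals that occur have integrands bounded by a multiple of the derivative of the arctangent,
  so that improper integrals can be treated as differences of limits of primitives.\<close>

lemma primitive_increment_le:
  fixes F :: "real \<Rightarrow> 'a::real_normed_vector"
  assumes F': "\<And>t. (F has_vector_derivative f t) (at t)"
    and bound: "\<And>t. norm (f t) \<le> K / (1 + t\<^sup>2)" and "s \<le> t"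
  shows "norm (F t - F s) \<le> K * (arctan t - arctan s)"
proof (cases "s = t")
  case False
  have "norm (F t - F s) \<le> K * arctan t - K * arctan s"
  proof (rule differentiable_bound_general)
    show "continuous_on {s..t} F"
      using F' has_vector_derivative_continuous continuous_at_imp_continuous_on by blast
    show "((\<lambda>t. K * arctan t) has_vector_derivative K / (1 + x\<^sup>2)) (at x)" for x
      unfolding has_real_derivative_iff_has_vector_derivative [symmetric]
      by (auto intro!: derivative_eq_intros simp: divide_inverse)
  qed (use False assms in \<open>auto intro!: continuous_intros\<close>)
  then show ?thesis by (simp add: algebra_simps)
qed simp

lemma primitive_tendsto_at_top:
  fixes F :: "real \<Rightarrow> 'a::banach"
  assumes F': "\<And>t. (F has_vector_derivative f t) (at t)"
    and bound: "\<And>t. norm (f t) \<le> K / (1 + t\<^sup>2)"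
  obtains L where "(F \<longlongrightarrow> L) at_top"
proof -
  have K: "K \<ge> 0" using order_trans [OF norm_ge_zero bound [of 0]] by simp
  have "((\<lambda>t. K * (pi / 2 - arctan t)) \<longlongrightarrow> K * (pi / 2 - pi / 2)) at_top"
    by (intro tendsto_intros tendsto_arctan_at_top)
  then have arctan_top: "((\<lambda>t. K * (pi / 2 - arctan t)) \<longlongrightarrow> 0) at_top"
    by simp
  note arctan_seq = filterlim_compose [OF arctan_top filterlim_real_sequentially]
  have "Cauchy (\<lambda>n. F (real n))"
  proof (rule metric_CauchyI)
    fix e :: real assume "e > 0"
    then obtain N where N: "\<And>n. n \<ge> N \<Longrightarrow> K * (pi / 2 - arctan (real n)) < e"
      using order_tendstoD(2) [OF arctan_seq] by (auto simp: eventually_sequentially)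
    have le: "dist (F (real i)) (F (real j)) < e" if "i \<ge> N" "j \<ge> i" for i j
    proof -
      have "dist (F (real i)) (F (real j)) \<le> K * (arctan (real j) - arctan (real i))"
        using primitive_increment_le [OF F' bound, of "real i" "real j"] that by (simp add: dist_norm norm_minus_commute)
      also have "\<dots> \<le> K * (pi / 2 - arctan (real i))"
        using arctan_ubound [of "real j"] K by (intro mult_left_mono) auto
      finally show ?thesis using N [OF that(1)] by simp
    qed
    have "dist (F (real i)) (F (real j)) < e" if "i \<ge> N" "j \<ge> N" for i j
      using le [of i j] le [of j i] that by (metis dist_commute linorder_le_cases)
    then show "\<exists>M. \<forall>i\<ge>M. \<forall>j\<ge>M. dist (F (real i)) (F (real j)) < e" by blast
  qed
  then obtain L where L: "(\<lambda>n. F (real n)) \<longlonglongrightarrow> L"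
    using Cauchy_convergent_iff convergent_def by blast
  have "norm (F t - L) \<le> K * (pi / 2 - arctan t)" for t
  proof (rule tendsto_upperbound)
    show "((\<lambda>n. norm (F t - F (real n))) \<longlongrightarrow> norm (F t - L)) sequentially"
      by (intro tendsto_intros L)
    show "\<forall>\<^sub>F n in sequentially. norm (F t - F (real n)) \<le> K * (pi / 2 - arctan t)"
      using filterlim_real_sequentially [unfolded filterlim_at_top, rule_format, of t]
    proof eventually_elim
      case (elim n)
      have "norm (F t - F (real n)) \<le> K * (arctan (real n) - arctan t)"
        using primitive_increment_le [OF F' bound, of t "real n"] elim by (simp add: norm_minus_commute)
      also have "\<dots> \<le> K * (pi / 2 - arctan t)"
        using arctan_ubound [of "real n"] K by (intro mult_left_mono) auto
      finally show ?case .
    qed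
  qed simp
  then have "\<forall>\<^sub>F t in at_top. norm (F t - L) \<le> K * (pi / 2 - arctan t)"
    by simp
  then have "((\<lambda>t. F t - L) \<longlongrightarrow> 0) at_top"
    using arctan_top by (rule Lim_null_comparison)
  then show ?thesis
    using that LIM_zero_iff by blast
qed

lemma primitive_norm_le:
  fixes F :: "real \<Rightarrow> 'a::real_normed_vector"
  assumes F': "\<And>t. (F has_vector_derivative f t) (at t)"
    and bound: "\<And>t. norm (f t) \<le> K / (1 + t\<^sup>2)" and bot: "(F \<longlongrightarrow> 0) at_bot"
  shows "norm (F t) \<le> K * pi"
proof (rule tendsto_upperbound)
  have K: "K \<ge> 0" using order_trans [OF norm_ge_zero bound [of 0]] by simp
  show "((\<lambda>s. norm (F t - F s)) \<longlongrightarrow> norm (F t)) at_bot"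
    by (rule tendsto_eq_intros bot refl | simp)+
  show "\<forall>\<^sub>F s in at_bot. norm (F t - F s) \<le> K * pi"
    using eventually_le_at_bot [of t]
  proof eventually_elim
    case (elim s)
    have "norm (F t - F s) \<le> K * (arctan t - arctan s)"
      by (rule primitive_increment_le [OF F' bound elim])
    also have "\<dots> \<le> K * pi"
      using arctan_ubound [of t] arctan_lbound [of s] K by (intro mult_left_mono) auto
    finally show ?case .
  qed
qed simp

lemma primitive_exists:
  fixes f :: "real \<Rightarrow> 'a::euclidean_space"
  assumes cont: "\<And>t. isCont f t" and bound: "\<And>t. norm (f t) \<le> K / (1 + t\<^sup>2)"
  obtains F L where "\<And>t. (F has_vector_derivative f t) (at t)" "(F \<longlongrightarrow> 0) at_bot" "(F \<longlongrightarrow> L) at_top"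
proof -
  obtain F where F': "\<And>t. (F has_vector_derivative f t) (at t)"
    using einterval_antiderivative [of "-\<infinity>" "\<infinity>" f] cont by auto
  have "((\<lambda>t. - F (- t)) has_vector_derivative f (- t)) (at t)" for t
  proof -
    have "(uminus has_vector_derivative - 1) (at t)"
      by (auto intro!: derivative_eq_intros)
    from has_vector_derivative_minus [OF vector_diff_chain_at [OF this F']] show ?thesis
      by (simp add: o_def)
  qed
  moreover have "norm (f (- t)) \<le> K / (1 + t\<^sup>2)" for t
    using bound [of "- t"] by simp
  ultimately obtain L0 where "((\<lambda>t. - F (- t)) \<longlongrightarrow> L0) at_top"
    by (rule primitive_tendsto_at_top)
  from tendsto_minus [OF this] have bot: "(F \<longlongrightarrow> - L0) at_bot"
    by (simp add: filterlim_at_bot_mirror)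
  have F1': "((\<lambda>t. F t + L0) has_vector_derivative f t) (at t)" for t
    using F' by (auto intro!: derivative_eq_intros)
  obtain L where "((\<lambda>t. F t + L0) \<longlongrightarrow> L) at_top"
    by (rule primitive_tendsto_at_top [OF F1' bound])
  moreover have "((\<lambda>t. F t + L0) \<longlongrightarrow> 0) at_bot"
    using tendsto_add [OF bot tendsto_const [of L0]] by simp
  ultimately show ?thesis
    using that F1' by blast
qed

section \<open>Bounds for the force along almost straight motions\<close>

text \<open>At time \<open>r\<close> the bodies are at mutual distances at least \<open>\<kappa> * sqrt (1 + r\<^sup>2)\<close>.\<close>

definition separated :: "real \<Rightarrow> real \<Rightarrow> ('d::finite, 'n::{finite,linorder}) config \<Rightarrow> bool" where
  "separated \<kappa> r q \<longleftrightarrow> (\<forall>i j. i \<noteq> j \<longrightarrow> \<kappa> * sqrt (1 + r\<^sup>2) \<le> norm (q $ i - q $ j))"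

lemma sqrt_1_plus_square: "1 \<le> sqrt (1 + r\<^sup>2)" "\<bar>r\<bar> \<le> sqrt (1 + r\<^sup>2)"
  by (simp_all add: real_le_rsqrt)

lemma separated_imp_collision_free:
  assumes "\<kappa> > 0" "separated \<kappa> r q"
  shows "q \<notin> collisions"
proof
  assume "q \<in> collisions"
  then obtain i j where "i \<noteq> j" "q $ i = q $ j" by (auto simp: collisions_def)
  with assms(2) have "\<kappa> * sqrt (1 + r\<^sup>2) \<le> 0"
    by (force simp: separated_def)
  moreover have "\<kappa> * sqrt (1 + r\<^sup>2) > 0"
    using assms(1) sqrt_1_plus_square(1) [of r] by (intro mult_pos_pos) linarith+
  ultimately show False by simp
qed

lemma norm_diff_nth_le:
  fixes x y :: "'a::real_normed_vector ^ 'n"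
  shows "norm ((x $ i - x $ j) - (y $ i - y $ j)) \<le> 2 * norm (x - y)"
proof -
  have "norm ((x $ i - x $ j) - (y $ i - y $ j)) = norm ((x - y) $ i - (x - y) $ j)"
    by (simp add: algebra_simps)
  also have "\<dots> \<le> norm ((x - y) $ i) + norm ((x - y) $ j)"
    by (rule norm_triangle_ineq4)
  also have "\<dots> \<le> norm (x - y) + norm (x - y)"
    by (intro add_mono Finite_Cartesian_Product.norm_nth_le)
  finally show ?thesis by simp
qed

lemma separated_perturb:
  assumes "separated (2 * \<kappa>) r q" "norm (q' - q) \<le> \<kappa> / 2 * sqrt (1 + r\<^sup>2)"
  shows "separated \<kappa> r q'"
  unfolding separated_def
proof (intro allI impI)
  fix i j :: 'b assume "i \<noteq> j"
  then have "2 * \<kappa> * sqrt (1 + r\<^sup>2) \<le> norm (q $ i - q $ j)"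
    using assms(1) by (simp add: separated_def)
  also have "\<dots> \<le> norm (q' $ i - q' $ j) + norm ((q $ i - q $ j) - (q' $ i - q' $ j))"
    by (rule norm_triangle_sub)
  also have "norm ((q $ i - q $ j) - (q' $ i - q' $ j)) \<le> \<kappa> * sqrt (1 + r\<^sup>2)"
    using norm_diff_nth_le [of q i j q'] assms(2) by (simp add: norm_minus_commute)
  finally show "\<kappa> * sqrt (1 + r\<^sup>2) \<le> norm (q' $ i - q' $ j)" by simp
qed

text \<open>The smallest eigenvalue of a positive \<open>2 \<times> 2\<close> Gram matrix is at least its determinant divided
  by its trace.\<close>

lemma line_norm_ge:
  fixes a b :: "'a::real_inner"
  assumes "gram a b \<noteq> 0"
  obtains \<kappa> where "\<kappa> > 0" "\<And>r. \<kappa> * sqrt (1 + r\<^sup>2) \<le> norm (r *\<^sub>R a + b)"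
proof -
  define T where "T = a \<bullet> a + b \<bullet> b"
  have a_ne: "a \<noteq> 0" using assms by (auto simp: gram_def)
  then have T: "T > 0"
    by (simp add: T_def add_pos_nonneg)
  have g: "gram a b > 0" using assms by (simp add: gram_pos_iff)
  have "sqrt (gram a b / T) * sqrt (1 + r\<^sup>2) \<le> norm (r *\<^sub>R a + b)" for r
  proof -
    have "T * (norm (r *\<^sub>R a + b))\<^sup>2 - gram a b * (1 + r\<^sup>2) = (r * (a \<bullet> a) + a \<bullet> b)\<^sup>2 + (b \<bullet> b + r * (a \<bullet> b))\<^sup>2"
      unfolding T_def gram_def power2_norm_eq_inner
      by (simp add: inner_add_left inner_add_right inner_commute power2_eq_square algebra_simps)
    then have "gram a b * (1 + r\<^sup>2) \<le> T * (norm (r *\<^sub>R a + b))\<^sup>2"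
      by (smt (verit) zero_le_power2)
    then have "gram a b / T * (1 + r\<^sup>2) \<le> (norm (r *\<^sub>R a + b))\<^sup>2"
      using T by (simp add: field_simps)
    then have "sqrt (gram a b / T * (1 + r\<^sup>2)) \<le> norm (r *\<^sub>R a + b)"
      by (simp add: real_le_lsqrt)
    then show ?thesis by (simp only: real_sqrt_mult)
  qed
  then show ?thesis
    using g T by (intro that [of "sqrt (gram a b / T)"]) auto
qed

lemma gram_nonzero_if_line_nonzero:
  assumes "a \<noteq> 0" "\<And>r. r *\<^sub>R a + b \<noteq> 0"
  shows "gram a b \<noteq> 0"
proof
  assume "gram a b = 0"
  moreover have "perp a b \<bullet> perp a b = (a \<bullet> a) * gram a b"
    by (simp add: perp_def gram_def inner_diff_left inner_diff_right inner_commute power2_eq_square algebra_simps)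
  ultimately have "perp a b = 0" by simp
  then have "b = ((a \<bullet> b) / (a \<bullet> a)) *\<^sub>R a"
    using assms(1) by (rule perp_eq_0D)
  with assms(2) [of "- ((a \<bullet> b) / (a \<bullet> a))"] show False by simp
qed

lemma lines_separated:
  fixes A c :: "('d::finite, 'n::{finite,linorder}) config"
  assumes gram: "\<And>i j. i \<noteq> j \<Longrightarrow> gram (A $ i - A $ j) (c $ i - c $ j) \<noteq> 0"
  obtains \<kappa> where "\<kappa> > 0" "\<And>r. separated \<kappa> r (r *\<^sub>R A + c)"
proof -
  have "\<forall>\<^sub>F \<kappa> in at_right 0. \<forall>r. i \<noteq> j \<longrightarrow> \<kappa> * sqrt (1 + r\<^sup>2) \<le> norm ((r *\<^sub>R A + c) $ i - (r *\<^sub>R A + c) $ j)" for i j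
  proof (cases "i = j")
    case False
    obtain \<kappa>0 where \<kappa>0: "\<kappa>0 > 0" "\<And>r. \<kappa>0 * sqrt (1 + r\<^sup>2) \<le> norm (r *\<^sub>R (A $ i - A $ j) + (c $ i - c $ j))"
      using line_norm_ge [OF gram [OF False]] by blast
    have "\<forall>\<^sub>F \<kappa> in at_right 0. \<kappa> < \<kappa>0"
      using \<kappa>0(1) eventually_at_right_field by blast
    then show ?thesis
    proof eventually_elim
      case (elim \<kappa>)
      show ?case
      proof (intro allI impI)
        fix r
        have "\<kappa> * sqrt (1 + r\<^sup>2) \<le> \<kappa>0 * sqrt (1 + r\<^sup>2)"
          using elim by (intro mult_right_mono) auto
        also have "\<dots> \<le> norm (r *\<^sub>R (A $ i - A $ j) + (c $ i - c $ j))"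
          by (rule \<kappa>0(2))
        finally show "\<kappa> * sqrt (1 + r\<^sup>2) \<le> norm ((r *\<^sub>R A + c) $ i - (r *\<^sub>R A + c) $ j)"
          by (simp add: algebra_simps)
      qed
    qed
  qed simp
  then have "\<forall>\<^sub>F \<kappa> in at_right 0. \<forall>i j r. i \<noteq> j \<longrightarrow> \<kappa> * sqrt (1 + r\<^sup>2) \<le> norm ((r *\<^sub>R A + c) $ i - (r *\<^sub>R A + c) $ j)"
    by (simp add: eventually_all_finite)
  from eventually_happens [OF eventually_conj [OF eventually_at_right_less [of 0] this]]
  show ?thesis
    using that unfolding separated_def by force
qed

lemma newton_kernel_lipschitz:
  fixes x y :: "'a::real_inner"
  assumes \<mu>: "\<mu> > 0" and x: "norm x \<ge> \<mu>" and y: "norm y \<ge> \<mu>"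
  shows "norm (newton_kernel x - newton_kernel y) \<le> 4 / \<mu> ^ 3 * norm (x - y)"
proof -
  let ?p = "norm x" and ?q = "norm y"
  have pos: "?p > 0" "?q > 0" using assms by linarith+
  have "newton_kernel x - newton_kernel y = (1 / ?p ^ 3) *\<^sub>R (x - y) + (1 / ?p ^ 3 - 1 / ?q ^ 3) *\<^sub>R y"
    by (simp add: newton_kernel_def divide_inverse algebra_simps)
  then have "norm (newton_kernel x - newton_kernel y) \<le>
      1 / ?p ^ 3 * norm (x - y) + \<bar>1 / ?p ^ 3 - 1 / ?q ^ 3\<bar> * ?q"
    using norm_triangle_ineq [of "(1 / ?p ^ 3) *\<^sub>R (x - y)" "(1 / ?p ^ 3 - 1 / ?q ^ 3) *\<^sub>R y"] by simp
  also have "\<bar>1 / ?p ^ 3 - 1 / ?q ^ 3\<bar> * ?q = \<bar>?q - ?p\<bar> * (1 / ?p ^ 3 + 1 / (?p ^ 2 * ?q) + 1 / (?p * ?q ^ 2))"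
  proof -
    have "(1 / ?p ^ 3 - 1 / ?q ^ 3) * ?q = (?q - ?p) * (1 / ?p ^ 3 + 1 / (?p ^ 2 * ?q) + 1 / (?p * ?q ^ 2))"
      using pos unfolding power2_eq_square power3_eq_cube by (simp add: field_simps)
    then have "\<bar>(1 / ?p ^ 3 - 1 / ?q ^ 3) * ?q\<bar> = \<bar>(?q - ?p) * (1 / ?p ^ 3 + 1 / (?p ^ 2 * ?q) + 1 / (?p * ?q ^ 2))\<bar>"
      by simp
    then show ?thesis
      using pos by (simp add: abs_mult)
  qed
  also have "\<dots> \<le> norm (x - y) * (1 / \<mu> ^ 3 + 1 / \<mu> ^ 3 + 1 / \<mu> ^ 3)"
  proof (intro mult_mono add_mono)
    show "\<bar>?q - ?p\<bar> \<le> norm (x - y)"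
      by (metis norm_minus_commute norm_triangle_ineq3)
    show "1 / ?p ^ 3 \<le> 1 / \<mu> ^ 3"
      using \<mu> x by (intro divide_left_mono power_mono mult_pos_pos) auto
    have "\<mu> ^ 3 \<le> ?p ^ 2 * ?q" "\<mu> ^ 3 \<le> ?p * ?q ^ 2"
      unfolding power3_eq_cube power2_eq_square using \<mu> x y by (auto intro!: mult_mono simp: mult.assoc)
    then show "1 / (?p ^ 2 * ?q) \<le> 1 / \<mu> ^ 3" "1 / (?p * ?q ^ 2) \<le> 1 / \<mu> ^ 3"
      using \<mu> pos by (intro divide_left_mono mult_pos_pos; simp)+
  qed (use pos in auto)
  also have "1 / ?p ^ 3 * norm (x - y) \<le> 1 / \<mu> ^ 3 * norm (x - y)"
    using \<mu> x by (intro mult_right_mono divide_left_mono power_mono mult_pos_pos) auto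
  finally show ?thesis by (simp add: algebra_simps)
qed

lemma norm_vec_le_sum: "norm (x :: 'a::real_normed_vector ^ 'n) \<le> (\<Sum>i\<in>UNIV. norm (x $ i))"
  unfolding norm_vec_def by (rule L2_set_le_sum) simp

lemma force_bounds:
  fixes m :: "'n::{finite,linorder} \<Rightarrow> real"
  assumes mass_pos: "\<And>i. m i > 0" and \<kappa>: "\<kappa> > 0"
  obtains C where "C \<ge> 1"
    "\<And>r (q :: ('d::finite, 'n) config). separated \<kappa> r q \<Longrightarrow> norm (force m q) \<le> C / (1 + r\<^sup>2)"
    "\<And>r (q :: ('d, 'n) config) q'. separated \<kappa> r q \<Longrightarrow> separated \<kappa> r q' \<Longrightarrow>
      norm (force m q - force m q') \<le> C * norm (q - q') / sqrt (1 + r\<^sup>2) ^ 3"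
proof -
  define M where "M = (\<Sum>i\<in>(UNIV :: 'n set). \<Sum>j\<in>(UNIV :: 'n set). m j)"
  have M: "M \<ge> 0"
    unfolding M_def by (intro sum_nonneg) (simp add: less_imp_le mass_pos)
  have sum_le: "(\<Sum>i\<in>(UNIV :: 'n set). \<Sum>j\<in>(UNIV :: 'n set). m j * B) = M * B" for B
    by (simp add: M_def sum_distrib_right)
  have bound1: "norm (force m q) \<le> M / \<kappa>\<^sup>2 / (1 + r\<^sup>2)"
    if q: "separated \<kappa> r q" for r and q :: "('d, 'n) config"
  proof -
    have nk: "norm (newton_kernel (q $ j - q $ i)) \<le> 1 / (\<kappa>\<^sup>2 * (1 + r\<^sup>2))" for i j
    proof (cases "i = j")
      case True
      then show ?thesis by simp
    next
      case False
      have "\<kappa> * sqrt (1 + r\<^sup>2) \<le> norm (q $ j - q $ i)"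
        using q False by (auto simp: separated_def)
      then have "(\<kappa> * sqrt (1 + r\<^sup>2))\<^sup>2 \<le> (norm (q $ j - q $ i))\<^sup>2"
        using \<kappa> by (intro power_mono) auto
      moreover have "(\<kappa> * sqrt (1 + r\<^sup>2))\<^sup>2 > 0"
        using \<kappa> sqrt_1_plus_square(1) [of r] by (intro zero_less_power mult_pos_pos) linarith+
      ultimately have "1 / (norm (q $ j - q $ i))\<^sup>2 \<le> 1 / (\<kappa> * sqrt (1 + r\<^sup>2))\<^sup>2"
        by (intro divide_left_mono mult_pos_pos) linarith+
      then show ?thesis
        by (simp add: norm_newton_kernel power_mult_distrib)
    qed
    have "norm (m j *\<^sub>R newton_kernel (q $ j - q $ i)) \<le> m j * (1 / (\<kappa>\<^sup>2 * (1 + r\<^sup>2)))" for i j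
      unfolding norm_scaleR abs_of_pos [OF mass_pos]
      by (intro mult_left_mono nk less_imp_le [OF mass_pos])
    then have comp: "norm (force m q $ i) \<le> (\<Sum>j\<in>UNIV. m j * (1 / (\<kappa>\<^sup>2 * (1 + r\<^sup>2))))" for i
      unfolding force_nth by (intro sum_norm_le)
    have "norm (force m q) \<le> M * (1 / (\<kappa>\<^sup>2 * (1 + r\<^sup>2)))"
      unfolding sum_le [symmetric] by (rule order_trans [OF norm_vec_le_sum sum_mono [OF comp]])
    then show ?thesis by simp
  qed
  have bound2: "norm (force m q - force m q') \<le> 8 * M / \<kappa> ^ 3 * norm (q - q') / sqrt (1 + r\<^sup>2) ^ 3"
    if q: "separated \<kappa> r q" "separated \<kappa> r q'" for r and q q' :: "('d, 'n) config"
  proof -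
    define B where "B = 4 / (\<kappa> * sqrt (1 + r\<^sup>2)) ^ 3 * (2 * norm (q - q'))"
    have nk: "norm (newton_kernel (q $ j - q $ i) - newton_kernel (q' $ j - q' $ i)) \<le> B" for i j
    proof (cases "i = j")
      case True
      then show ?thesis using \<kappa> by (simp add: B_def)
    next
      case False
      have "norm (newton_kernel (q $ j - q $ i) - newton_kernel (q' $ j - q' $ i)) \<le>
          4 / (\<kappa> * sqrt (1 + r\<^sup>2)) ^ 3 * norm ((q $ j - q $ i) - (q' $ j - q' $ i))"
        using q False \<kappa> by (intro newton_kernel_lipschitz) (auto simp: separated_def add_pos_nonneg)
      also have "\<dots> \<le> B"
        unfolding B_def using \<kappa> by (intro mult_left_mono norm_diff_nth_le) auto
      finally show ?thesis .
    qed
    have "norm (m j *\<^sub>R newton_kernel (q $ j - q $ i) - m j *\<^sub>R newton_kernel (q' $ j - q' $ i)) \<le> m j * B" for i j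
      unfolding scaleR_diff_right [symmetric] norm_scaleR abs_of_pos [OF mass_pos]
      by (intro mult_left_mono nk less_imp_le [OF mass_pos])
    then have comp: "norm ((force m q - force m q') $ i) \<le> (\<Sum>j\<in>UNIV. m j * B)" for i
      unfolding vector_minus_component force_nth sum_subtractf [symmetric] by (intro sum_norm_le)
    have "norm (force m q - force m q') \<le> M * B"
      unfolding sum_le [symmetric] by (rule order_trans [OF norm_vec_le_sum sum_mono [OF comp]])
    then show ?thesis
      by (simp add: B_def power_mult_distrib mult.commute mult.left_commute)
  qed
  define C where "C = max 1 (max (M / \<kappa>\<^sup>2) (8 * M / \<kappa> ^ 3))"
  have C: "C \<ge> 1" "M / \<kappa>\<^sup>2 \<le> C" "8 * M / \<kappa> ^ 3 \<le> C"
    by (auto simp: C_def)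
  show ?thesis
  proof (rule that [OF C(1)])
    fix r and q :: "('d, 'n) config" assume "separated \<kappa> r q"
    from bound1 [OF this] show "norm (force m q) \<le> C / (1 + r\<^sup>2)"
      by (rule order_trans) (intro divide_right_mono C, simp)
  next
    fix r and q q' :: "('d, 'n) config" assume "separated \<kappa> r q" "separated \<kappa> r q'"
    from bound2 [OF this] show "norm (force m q - force m q') \<le> C * norm (q - q') / sqrt (1 + r\<^sup>2) ^ 3"
      by (rule order_trans) (intro divide_right_mono mult_right_mono C, auto)
  qed
qed

section \<open>Scattering solutions with prescribed incoming velocity\<close>

text \<open>The primitive, vanishing at \<open>0\<close>, of a bounded continuous velocity deviation.\<close>

definition displacement :: "(real \<Rightarrow>\<^sub>C 'a::euclidean_space) \<Rightarrow> real \<Rightarrow> 'a" where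
  "displacement \<zeta> = (SOME \<eta>. \<eta> 0 = 0 \<and> (\<forall>r. (\<eta> has_vector_derivative apply_bcontfun \<zeta> r) (at r)))"

lemma displacement:
  "displacement \<zeta> 0 = 0" "(displacement \<zeta> has_vector_derivative apply_bcontfun \<zeta> r) (at r)"
proof -
  have "isCont (apply_bcontfun \<zeta>) r" for r
    using continuous_on_apply_bcontfun [of UNIV \<zeta>] continuous_on_eq_continuous_at open_UNIV by blast
  then obtain F where "\<And>r. (F has_vector_derivative apply_bcontfun \<zeta> r) (at r)"
    using einterval_antiderivative [of "-\<infinity>" "\<infinity>" "apply_bcontfun \<zeta>"] by auto
  then have "\<exists>\<eta>. \<eta> 0 = 0 \<and> (\<forall>r. (\<eta> has_vector_derivative apply_bcontfun \<zeta> r) (at r))"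
    by (intro exI [of _ "\<lambda>r. F r - F 0"]) (auto intro!: derivative_eq_intros)
  then have "displacement \<zeta> 0 = 0 \<and> (\<forall>r. (displacement \<zeta> has_vector_derivative apply_bcontfun \<zeta> r) (at r))"
    unfolding displacement_def by (rule someI_ex)
  then show "displacement \<zeta> 0 = 0" "(displacement \<zeta> has_vector_derivative apply_bcontfun \<zeta> r) (at r)"
    by auto
qed

lemma norm_primitive_le:
  fixes F :: "real \<Rightarrow> 'a::real_normed_vector"
  assumes "F 0 = 0" "\<And>r. (F has_vector_derivative f r) (at r)" "\<And>r. norm (f r) \<le> B"
  shows "norm (F r) \<le> B * \<bar>r\<bar>"
proof -
  have "norm (F r - F 0) \<le> B * norm (r - 0)"
  proof (rule differentiable_bound [of UNIV F "\<lambda>r h. h *\<^sub>R f r"])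
    show "onorm (\<lambda>h. h *\<^sub>R f x) \<le> B" for x
      using assms(3) [of x] order_trans [OF norm_ge_zero assms(3) [of x]]
      by (intro onorm_bound) (auto simp: mult.commute [of B] intro: mult_left_mono)
  qed (use assms(2) in \<open>auto simp: has_vector_derivative_def\<close>)
  then show ?thesis by (simp add: assms(1))
qed

lemma norm_displacement_le: "norm (displacement \<zeta> r) \<le> norm \<zeta> * \<bar>r\<bar>"
  by (rule norm_primitive_le [OF displacement]) (rule norm_bounded)

lemma norm_displacement_diff_le: "norm (displacement \<zeta> r - displacement \<zeta>' r) \<le> dist \<zeta> \<zeta>' * \<bar>r\<bar>"
proof (rule norm_primitive_le [of "\<lambda>r. displacement \<zeta> r - displacement \<zeta>' r"])
  show "((\<lambda>r. displacement \<zeta> r - displacement \<zeta>' r) has_vector_derivative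
      apply_bcontfun \<zeta> r - apply_bcontfun \<zeta>' r) (at r)" for r
    by (intro has_vector_derivative_diff displacement)
  show "norm (apply_bcontfun \<zeta> r - apply_bcontfun \<zeta>' r) \<le> dist \<zeta> \<zeta>'" for r
    using dist_bounded [of \<zeta> r \<zeta>'] by (simp add: dist_norm)
qed (simp add: displacement)

lemma displacement_zero: "displacement 0 r = 0"
  using norm_displacement_le [of 0 r] by simp

lemma isCont_force:
  fixes q :: "('d::finite, 'n::{finite,linorder}) config"
  assumes "q \<notin> collisions"
  shows "isCont (force m) q"
proof -
  have "isCont (\<lambda>q :: ('d, 'n) config. newton_kernel (q $ j - q $ i)) q" for i j
  proof (cases "i = j")
    case False
    then have "q $ j - q $ i \<noteq> 0"
      using assms unfolding collisions_def by force
    then show ?thesis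
      unfolding newton_kernel_def by (intro continuous_intros) auto
  qed simp
  then show ?thesis
    unfolding force_def continuous_at by (intro tendsto_vec_lambda tendsto_intros)
qed

text \<open>For all impact vectors \<open>c\<close> near \<open>c0\<close> and all small \<open>\<epsilon>\<close> there is a solution of \<open>y'' = \<epsilon> \<nabla>U(y)\<close> with
  \<open>y 0 = c\<close> and incoming velocity \<open>A\<close>. Its velocity is \<open>A + \<zeta>\<close>, where \<open>\<zeta>\<close> is the fixed point of the
  contraction that maps \<open>\<zeta>\<close> to \<open>\<epsilon>\<close> times the impulse along the path with velocity \<open>A + \<zeta>\<close>. The
  constants do not depend on \<open>\<epsilon>\<close> and \<open>c\<close>.\<close>

lemma scattering_solutions:
  fixes m :: "'n::{finite,linorder} \<Rightarrow> real" and A c0 :: "('d::finite, 'n) config"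
  assumes mass_pos: "\<And>i. m i > 0"
    and gram: "\<And>i j. i \<noteq> j \<Longrightarrow> gram (A $ i - A $ j) (c0 $ i - c0 $ j) \<noteq> 0"
  obtains \<kappa> r0 C where "\<kappa> > 0" "r0 > 0" "C > 0"
    "\<And>\<epsilon>. \<epsilon> > 0 \<Longrightarrow> \<epsilon> * C \<le> r0 \<Longrightarrow> \<epsilon> * C \<le> 1 / 2 \<Longrightarrow>
      \<exists>y p E. continuous_on (cball c0 r0) E \<and> (\<forall>c\<in>cball c0 r0. y c 0 = c \<and>
        (\<forall>r. (y c has_vector_derivative p c r) (at r) \<and>
          (p c has_vector_derivative \<epsilon> *\<^sub>R force m (y c r)) (at r) \<and> separated \<kappa> r (y c r)) \<and>
        (p c \<longlongrightarrow> A) at_bot \<and> (p c \<longlongrightarrow> A + \<epsilon> *\<^sub>R E c) at_top \<and>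
        norm (E c) \<le> C \<and> norm (E c - total_kick m A c) \<le> \<epsilon> * C)"
proof -
  obtain \<kappa>2 where \<kappa>2: "\<kappa>2 > 0" "\<And>r. separated \<kappa>2 r (r *\<^sub>R A + c0)"
    using lines_separated [OF gram] by blast
  (* Half of the separation of the straight motion for c0 is left for the deviations, of which
     the position at time 0 and the velocity contribute a quarter of \<kappa> each. *)
  define \<kappa> where "\<kappa> = \<kappa>2 / 2"
  define r0 where "r0 = \<kappa> / 4"
  have \<kappa>: "\<kappa> > 0" and r0: "r0 > 0"
    using \<kappa>2(1) by (simp_all add: \<kappa>_def r0_def)
  obtain C0 where C0: "C0 \<ge> 1"
    and force_le: "\<And>r (q :: ('d, 'n) config). separated \<kappa> r q \<Longrightarrow> norm (force m q) \<le> C0 / (1 + r\<^sup>2)"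
    and force_diff_le: "\<And>r (q :: ('d, 'n) config) q'. separated \<kappa> r q \<Longrightarrow> separated \<kappa> r q' \<Longrightarrow>
      norm (force m q - force m q') \<le> C0 * norm (q - q') / sqrt (1 + r\<^sup>2) ^ 3"
    by (rule force_bounds [where 'd = 'd, OF mass_pos \<kappa>]) (rule that)

  define path where "path = (\<lambda>c \<zeta> r. r *\<^sub>R A + c + displacement \<zeta> r)"
  have path': "(path c \<zeta> has_vector_derivative A + apply_bcontfun \<zeta> r) (at r)" for c \<zeta> r
    unfolding path_def by (auto intro!: derivative_eq_intros displacement)
  have sep: "separated \<kappa> r (path c \<zeta> r)" if "c \<in> cball c0 r0" "norm \<zeta> \<le> r0" for c \<zeta> r
  proof (rule separated_perturb)
    show "separated (2 * \<kappa>) r (r *\<^sub>R A + c0)"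
      using \<kappa>2(2) by (simp add: \<kappa>_def)
    have "norm (path c \<zeta> r - (r *\<^sub>R A + c0)) = norm ((c - c0) + displacement \<zeta> r)"
      by (simp add: path_def algebra_simps)
    also have "\<dots> \<le> norm (c - c0) + norm (displacement \<zeta> r)"
      by (rule norm_triangle_ineq)
    also have "\<dots> \<le> r0 + r0 * \<bar>r\<bar>"
      using that norm_displacement_le [of \<zeta> r] mult_right_mono [of "norm \<zeta>" r0 "\<bar>r\<bar>"]
      by (intro add_mono) (auto simp: dist_norm norm_minus_commute)
    also have "\<dots> \<le> r0 * sqrt (1 + r\<^sup>2) + r0 * sqrt (1 + r\<^sup>2)"
      using r0 sqrt_1_plus_square [of r] by (intro add_mono mult_left_mono) auto
    also have "\<dots> = \<kappa> / 2 * sqrt (1 + r\<^sup>2)"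
      by (simp add: r0_def)
    finally show "norm (path c \<zeta> r - (r *\<^sub>R A + c0)) \<le> \<kappa> / 2 * sqrt (1 + r\<^sup>2)" .
  qed
  note free = separated_imp_collision_free [OF \<kappa>]

  define C1 where "C1 = C0 * pi"
  have C1: "C1 \<ge> 1"
    unfolding C1_def using mult_mono [of 1 C0 1 pi] C0 pi_gt3 by simp
  (* The impulse is the primitive of the force along a path; it depends on the path in a
    Lipschitz continuous way. *)
  have "\<exists>(F :: real \<Rightarrow>\<^sub>C ('d, 'n) config) L. (\<forall>t. (apply_bcontfun F has_vector_derivative force m (path c \<zeta> t)) (at t)) \<and>
      (apply_bcontfun F \<longlongrightarrow> 0) at_bot \<and> (apply_bcontfun F \<longlongrightarrow> L) at_top"
    if c: "c \<in> cball c0 r0" and \<zeta>: "norm \<zeta> \<le> r0" for c \<zeta>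
  proof -
    have "isCont (\<lambda>r. force m (path c \<zeta> r)) r" for r
      using isCont_o2 [OF has_vector_derivative_continuous [OF path'] isCont_force [OF free [OF sep [OF c \<zeta>]]]] .
    then obtain F L where F: "\<And>t. (F has_vector_derivative force m (path c \<zeta> t)) (at t)"
      "(F \<longlongrightarrow> 0) at_bot" "(F \<longlongrightarrow> L) at_top"
      using primitive_exists force_le [OF sep [OF c \<zeta>]] by metis
    have "continuous_on UNIV F"
      using F(1) has_vector_derivative_continuous continuous_at_imp_continuous_on by blast
    moreover have "norm (F t) \<le> C1" for t
      unfolding C1_def by (rule primitive_norm_le [OF F(1) force_le [OF sep [OF c \<zeta>]] F(2)])
    ultimately have "F \<in> bcontfun"
      by (rule bcontfun_normI)
    then show ?thesis
      using F by (metis bcontfunE)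
  qed
  then obtain imp :: "('d, 'n) config \<Rightarrow> (real \<Rightarrow>\<^sub>C ('d, 'n) config) \<Rightarrow> (real \<Rightarrow>\<^sub>C ('d, 'n) config)" and tot where
      imp': "\<And>c \<zeta> t. c \<in> cball c0 r0 \<Longrightarrow> norm \<zeta> \<le> r0 \<Longrightarrow>
        (apply_bcontfun (imp c \<zeta>) has_vector_derivative force m (path c \<zeta> t)) (at t)"
    and imp_bot: "\<And>c \<zeta>. c \<in> cball c0 r0 \<Longrightarrow> norm \<zeta> \<le> r0 \<Longrightarrow> (apply_bcontfun (imp c \<zeta>) \<longlongrightarrow> 0) at_bot"
    and imp_top: "\<And>c \<zeta>. c \<in> cball c0 r0 \<Longrightarrow> norm \<zeta> \<le> r0 \<Longrightarrow> (apply_bcontfun (imp c \<zeta>) \<longlongrightarrow> tot c \<zeta>) at_top"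
    by metis
  have imp_le: "norm (imp c \<zeta>) \<le> C1" if c: "c \<in> cball c0 r0" and \<zeta>: "norm \<zeta> \<le> r0" for c \<zeta>
    unfolding C1_def
    by (rule norm_bound, rule primitive_norm_le [OF imp' [OF c \<zeta>] force_le [OF sep [OF c \<zeta>]] imp_bot [OF c \<zeta>]])
  have imp_dist: "dist (imp c \<zeta>) (imp c' \<zeta>') \<le> C1 * (norm (c - c') + dist \<zeta> \<zeta>')"
    if c: "c \<in> cball c0 r0" "norm \<zeta> \<le> r0" and c': "c' \<in> cball c0 r0" "norm \<zeta>' \<le> r0" for c c' \<zeta> \<zeta>'
  proof (rule dist_bound)
    fix t
    have "norm (force m (path c \<zeta> r) - force m (path c' \<zeta>' r)) \<le> C0 * (norm (c - c') + dist \<zeta> \<zeta>') / (1 + r\<^sup>2)" for r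
    proof -
      have "norm (path c \<zeta> r - path c' \<zeta>' r) \<le> norm (c - c') + norm (displacement \<zeta> r - displacement \<zeta>' r)"
        using norm_triangle_ineq [of "c - c'" "displacement \<zeta> r - displacement \<zeta>' r"]
        by (simp add: path_def algebra_simps)
      also have "\<dots> \<le> norm (c - c') * 1 + dist \<zeta> \<zeta>' * \<bar>r\<bar>"
        using norm_displacement_diff_le [of \<zeta> r \<zeta>'] by simp
      also have "\<dots> \<le> norm (c - c') * sqrt (1 + r\<^sup>2) + dist \<zeta> \<zeta>' * sqrt (1 + r\<^sup>2)"
        using sqrt_1_plus_square [of r] by (intro add_mono mult_left_mono) auto
      also have "\<dots> = (norm (c - c') + dist \<zeta> \<zeta>') * sqrt (1 + r\<^sup>2)"
        by (simp add: algebra_simps)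
      finally have le: "norm (path c \<zeta> r - path c' \<zeta>' r) \<le> (norm (c - c') + dist \<zeta> \<zeta>') * sqrt (1 + r\<^sup>2)" .
      have "norm (force m (path c \<zeta> r) - force m (path c' \<zeta>' r)) \<le>
          C0 * norm (path c \<zeta> r - path c' \<zeta>' r) / sqrt (1 + r\<^sup>2) ^ 3"
        by (intro force_diff_le sep c c')
      also have "\<dots> \<le> C0 * ((norm (c - c') + dist \<zeta> \<zeta>') * sqrt (1 + r\<^sup>2)) / sqrt (1 + r\<^sup>2) ^ 3"
        using C0 by (intro divide_right_mono mult_left_mono le) auto
      also have "\<dots> = C0 * (norm (c - c') + dist \<zeta> \<zeta>') / (sqrt (1 + r\<^sup>2) * sqrt (1 + r\<^sup>2))"
        using sqrt_1_plus_square(1) [of r] by (simp add: power3_eq_cube)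
      finally show ?thesis by simp
    qed
    from primitive_norm_le [OF has_vector_derivative_diff [OF imp' [OF c] imp' [OF c']] this]
    have "norm (apply_bcontfun (imp c \<zeta>) t - apply_bcontfun (imp c' \<zeta>') t) \<le> C0 * (norm (c - c') + dist \<zeta> \<zeta>') * pi"
      using tendsto_diff [OF imp_bot [OF c] imp_bot [OF c']] by simp
    then show "dist (apply_bcontfun (imp c \<zeta>) t) (apply_bcontfun (imp c' \<zeta>') t) \<le> C1 * (norm (c - c') + dist \<zeta> \<zeta>')"
      by (simp add: dist_norm C1_def mult.commute mult.left_commute)
  qed
  have tot_le: "norm (tot c \<zeta>) \<le> C1" if c: "c \<in> cball c0 r0" and \<zeta>: "norm \<zeta> \<le> r0" for c \<zeta>
  proof (rule tendsto_upperbound [OF tendsto_norm [OF imp_top [OF c \<zeta>]]])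
    have "norm (apply_bcontfun (imp c \<zeta>) t) \<le> C1" for t
      using order_trans [OF norm_bounded imp_le [OF c \<zeta>]] .
    then show "\<forall>\<^sub>F t in at_top. norm (apply_bcontfun (imp c \<zeta>) t) \<le> C1"
      by simp
  qed simp
  have tot_dist: "norm (tot c \<zeta> - tot c' \<zeta>') \<le> C1 * (norm (c - c') + dist \<zeta> \<zeta>')"
    if c: "c \<in> cball c0 r0" "norm \<zeta> \<le> r0" and c': "c' \<in> cball c0 r0" "norm \<zeta>' \<le> r0" for c c' \<zeta> \<zeta>'
  proof (rule tendsto_upperbound [OF tendsto_norm [OF tendsto_diff [OF imp_top [OF c] imp_top [OF c']]]])
    have "norm (apply_bcontfun (imp c \<zeta>) t - apply_bcontfun (imp c' \<zeta>') t) \<le> C1 * (norm (c - c') + dist \<zeta> \<zeta>')" for t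
      unfolding dist_norm [symmetric]
      using order_trans [OF dist_bounded imp_dist [OF c c']] by (simp add: dist_norm)
    then show "\<forall>\<^sub>F t in at_top. norm (apply_bcontfun (imp c \<zeta>) t - apply_bcontfun (imp c' \<zeta>') t) \<le>
        C1 * (norm (c - c') + dist \<zeta> \<zeta>')"
      by simp
  qed simp

  (* Along straight lines the total impulse is known explicitly. *)
  have tot_zero: "tot c 0 = total_kick m A c" if c: "c \<in> cball c0 r0" for c
  proof -
    have c0: "norm (0 :: real \<Rightarrow>\<^sub>C ('d, 'n) config) \<le> r0" using r0 by simp
    have path0: "path c 0 r = r *\<^sub>R A + c" for r
      by (simp add: path_def displacement_zero)
    have prim: "\<exists>F. (\<forall>r. (F has_vector_derivative newton_kernel (path c 0 r $ j - path c 0 r $ i)) (at r)) \<and>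
      (F \<longlongrightarrow> 0) at_bot \<and> (F \<longlongrightarrow> kick (A $ j - A $ i) (c $ j - c $ i)) at_top" for i j
    proof (cases "i = j")
      case True
      then show ?thesis
        by (intro exI [of _ "\<lambda>_. 0"]) (simp add: kick_def perp_linear_simps)
    next
      case False
      let ?a = "A $ j - A $ i" and ?b = "c $ j - c $ i"
      have line: "path c 0 r $ j - path c 0 r $ i = r *\<^sub>R ?a + ?b" for r
        by (simp add: path0 algebra_simps)
      have ne: "r *\<^sub>R ?a + ?b \<noteq> 0" for r
        unfolding line [symmetric] using free [OF sep [OF c c0, of r]] False unfolding collisions_def by force
      have a_ne: "?a \<noteq> 0"
        using gram [OF False] by (auto simp: gram_def)
      have g: "gram ?a ?b \<noteq> 0"
        by (rule gram_nonzero_if_line_nonzero [OF a_ne ne])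
      have cont: "isCont (\<lambda>r. newton_kernel (r *\<^sub>R ?a + ?b)) t" for t
        unfolding newton_kernel_def using ne [of t] by (intro continuous_intros) auto
      have "norm (newton_kernel (r *\<^sub>R ?a + ?b)) \<le> (1 / \<kappa>\<^sup>2) / (1 + r\<^sup>2)" for r
      proof -
        have "\<kappa> * sqrt (1 + r\<^sup>2) \<le> norm (r *\<^sub>R ?a + ?b)"
          unfolding line [symmetric] using sep [OF c c0, of r] False by (auto simp: separated_def)
        then have "(\<kappa> * sqrt (1 + r\<^sup>2))\<^sup>2 \<le> (norm (r *\<^sub>R ?a + ?b))\<^sup>2"
          using \<kappa> by (intro power_mono) auto
        moreover have "(\<kappa> * sqrt (1 + r\<^sup>2))\<^sup>2 > 0"
          using \<kappa> sqrt_1_plus_square(1) [of r] by (intro zero_less_power mult_pos_pos) linarith+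
        ultimately have "1 / (norm (r *\<^sub>R ?a + ?b))\<^sup>2 \<le> 1 / (\<kappa> * sqrt (1 + r\<^sup>2))\<^sup>2"
          by (intro divide_left_mono mult_pos_pos) linarith+
        then show ?thesis
          by (simp add: norm_newton_kernel power_mult_distrib)
      qed
      with cont obtain F L where F: "\<And>t. (F has_vector_derivative newton_kernel (t *\<^sub>R ?a + ?b)) (at t)" "(F \<longlongrightarrow> 0) at_bot"
        using primitive_exists by metis
      then show ?thesis
        unfolding line using newton_kernel_line_integral [OF g F] by blast
    qed
    have "\<exists>F. \<forall>i j. (\<forall>r. (F i j has_vector_derivative newton_kernel (path c 0 r $ j - path c 0 r $ i)) (at r)) \<and>
      (F i j \<longlongrightarrow> 0) at_bot \<and> (F i j \<longlongrightarrow> kick (A $ j - A $ i) (c $ j - c $ i)) at_top"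
      by (rule choice, rule allI, rule choice, rule allI, rule prim)
    then obtain F where F: "\<And>i j r. (F i j has_vector_derivative newton_kernel (path c 0 r $ j - path c 0 r $ i)) (at r)"
      "\<And>i j. (F i j \<longlongrightarrow> 0) at_bot" "\<And>i j. (F i j \<longlongrightarrow> kick (A $ j - A $ i) (c $ j - c $ i)) at_top"
      by blast
    define G where "G = (\<lambda>r. \<chi> i. \<Sum>j\<in>UNIV. m j *\<^sub>R F i j r)"
    have G': "(G has_vector_derivative force m (path c 0 r)) (at r)" for r
    proof -
      have "((\<lambda>r. \<Sum>j\<in>UNIV. m j *\<^sub>R F i j r) has_derivative
          (\<lambda>h. \<Sum>j\<in>UNIV. m j *\<^sub>R (h *\<^sub>R newton_kernel (path c 0 r $ j - path c 0 r $ i)))) (at r)" for i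
        by (intro has_derivative_sum has_derivative_scaleR_right F(1) [unfolded has_vector_derivative_def])
      from has_derivative_vec_lambda [OF this]
      show ?thesis
        unfolding has_vector_derivative_def G_def
        by (rule has_derivative_eq_rhs)
          (simp add: fun_eq_iff vec_eq_iff force_nth scaleR_sum_right mult.commute)
    qed
    have "(G \<longlongrightarrow> (\<chi> i. \<Sum>j\<in>UNIV. m j *\<^sub>R 0)) at_bot"
      unfolding G_def by (intro tendsto_vec_lambda tendsto_intros F)
    moreover have "(\<chi> i. \<Sum>j\<in>UNIV. m j *\<^sub>R 0) = (0 :: ('d, 'n) config)"
      by (simp add: vec_eq_iff)
    ultimately have G_bot: "(G \<longlongrightarrow> 0) at_bot" by simp
    have G_top: "(G \<longlongrightarrow> total_kick m A c) at_top"
      unfolding G_def total_kick_def by (intro tendsto_vec_lambda tendsto_intros F)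
    have "norm (apply_bcontfun (imp c 0) t - G t) \<le> 0 * pi" for t
    proof (rule primitive_norm_le [of "\<lambda>t. apply_bcontfun (imp c 0) t - G t" "\<lambda>_. 0"])
      show "((\<lambda>t. apply_bcontfun (imp c 0) t - G t) has_vector_derivative 0) (at t)" for t
        using has_vector_derivative_diff [OF imp' [OF c c0] G'] by simp
      show "((\<lambda>t. apply_bcontfun (imp c 0) t - G t) \<longlongrightarrow> 0) at_bot"
        using tendsto_diff [OF imp_bot [OF c c0] G_bot] by simp
    qed simp
    then have "apply_bcontfun (imp c 0) = G"
      by (simp add: fun_eq_iff)
    then show ?thesis
      using tendsto_unique [OF _ imp_top [OF c c0]] G_top by simp
  qed

  define C where "C = C1 * C1"
  have C: "C > 0" "C1 \<le> C"
    using C1 mult_mono [of 1 C1 C1 C1] by (simp_all add: C_def)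
  show ?thesis
  proof (rule that [OF \<kappa> r0 C(1)])
    fix \<epsilon> :: real assume \<epsilon>: "\<epsilon> > 0" "\<epsilon> * C \<le> r0" "\<epsilon> * C \<le> 1 / 2"
    have \<epsilon>1: "\<epsilon> * C1 \<le> r0" "\<epsilon> * C1 \<le> 1 / 2"
      using mult_left_mono [OF C(2), of \<epsilon>] \<epsilon> by linarith+
    have dist_eps: "dist (\<epsilon> *\<^sub>R \<zeta>) (\<epsilon> *\<^sub>R \<zeta>') = \<epsilon> * dist \<zeta> \<zeta>'" for \<zeta> \<zeta>' :: "real \<Rightarrow>\<^sub>C ('d, 'n) config"
      using \<epsilon>(1) by (simp add: dist_norm flip: scaleR_diff_right)
    have "\<exists>\<zeta>\<in>cball 0 r0. \<epsilon> *\<^sub>R imp c \<zeta> = \<zeta>" if c: "c \<in> cball c0 r0" for c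
    proof -
      have "\<exists>!\<zeta>\<in>cball 0 r0. \<epsilon> *\<^sub>R imp c \<zeta> = \<zeta>"
      proof (rule Banach_fix)
        show "complete (cball (0 :: real \<Rightarrow>\<^sub>C ('d, 'n) config) r0)"
          by (simp add: complete_eq_closed)
        show "cball (0 :: real \<Rightarrow>\<^sub>C ('d, 'n) config) r0 \<noteq> {}"
          using r0 by simp
        show "(\<lambda>\<zeta>. \<epsilon> *\<^sub>R imp c \<zeta>) ` cball 0 r0 \<subseteq> cball 0 r0"
        proof clarsimp
          fix \<zeta> :: "real \<Rightarrow>\<^sub>C ('d, 'n) config" assume "norm \<zeta> \<le> r0"
          from imp_le [OF c this] have "\<epsilon> * norm (imp c \<zeta>) \<le> \<epsilon> * C1"
            using \<epsilon>(1) by simp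
          then show "\<bar>\<epsilon>\<bar> * norm (imp c \<zeta>) \<le> r0"
            unfolding abs_of_pos [OF \<epsilon>(1)] using \<epsilon>1(1) by linarith
        qed
        fix \<zeta> \<zeta>' :: "real \<Rightarrow>\<^sub>C ('d, 'n) config" assume "\<zeta> \<in> cball 0 r0" "\<zeta>' \<in> cball 0 r0"
        then have "dist (imp c \<zeta>) (imp c \<zeta>') \<le> C1 * dist \<zeta> \<zeta>'"
          using imp_dist [OF c _ c, of \<zeta> \<zeta>'] by simp
        then have "\<epsilon> * dist (imp c \<zeta>) (imp c \<zeta>') \<le> \<epsilon> * (C1 * dist \<zeta> \<zeta>')"
          using \<epsilon>(1) by simp
        also have "\<dots> = (\<epsilon> * C1) * dist \<zeta> \<zeta>'" by simp
        also have "\<dots> \<le> 1 / 2 * dist \<zeta> \<zeta>'"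
          by (intro mult_right_mono \<epsilon>1) simp
        finally show "dist (\<epsilon> *\<^sub>R imp c \<zeta>) (\<epsilon> *\<^sub>R imp c \<zeta>') \<le> 1 / 2 * dist \<zeta> \<zeta>'"
          unfolding dist_eps .
      qed auto
      then show ?thesis by blast
    qed
    then obtain z where z_le: "\<And>c. c \<in> cball c0 r0 \<Longrightarrow> norm (z c) \<le> r0"
      and z_fix: "\<And>c. c \<in> cball c0 r0 \<Longrightarrow> \<epsilon> *\<^sub>R imp c (z c) = z c"
      by (metis mem_cball_0)
    have z_nth: "apply_bcontfun (z c) r = \<epsilon> *\<^sub>R apply_bcontfun (imp c (z c)) r" if "c \<in> cball c0 r0" for c r
      using z_fix [OF that] scaleR_bcontfun.rep_eq [of \<epsilon> "imp c (z c)"] by (metis)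
    have z_dist: "dist (z c) (z c') \<le> norm (c - c')" if c: "c \<in> cball c0 r0" and c': "c' \<in> cball c0 r0" for c c'
    proof -
      have "dist (z c) (z c') = \<epsilon> * dist (imp c (z c)) (imp c' (z c'))"
        unfolding dist_eps [symmetric] z_fix [OF c] z_fix [OF c'] ..
      also have "\<dots> \<le> \<epsilon> * (C1 * (norm (c - c') + dist (z c) (z c')))"
        using \<epsilon>(1) imp_dist [OF c z_le [OF c] c' z_le [OF c']] by simp
      also have "\<dots> = (\<epsilon> * C1) * (norm (c - c') + dist (z c) (z c'))" by simp
      also have "\<dots> \<le> 1 / 2 * (norm (c - c') + dist (z c) (z c'))"
        by (intro mult_right_mono \<epsilon>1) simp
      finally show ?thesis by simp
    qed
    define E where "E = (\<lambda>c. tot c (z c))"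
    have "norm (E c - E c') \<le> (2 * C1) * norm (c - c')" if c: "c \<in> cball c0 r0" and c': "c' \<in> cball c0 r0" for c c'
    proof -
      have "norm (E c - E c') \<le> C1 * (norm (c - c') + dist (z c) (z c'))"
        unfolding E_def by (rule tot_dist [OF c z_le [OF c] c' z_le [OF c']])
      also have "\<dots> \<le> C1 * (norm (c - c') + norm (c - c'))"
        using C1 z_dist [OF c c'] by (intro mult_left_mono) auto
      finally show ?thesis by simp
    qed
    then have "(2 * C1)-lipschitz_on (cball c0 r0) E"
      using C1 by (intro lipschitz_onI) (auto simp: dist_norm)
    then have cont: "continuous_on (cball c0 r0) E"
      by (rule lipschitz_on_continuous_on)
    define y where "y = (\<lambda>c. path c (z c))"
    define p where "p = (\<lambda>c r. A + apply_bcontfun (z c) r)"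
    have sol: "y c 0 = c \<and>
        (\<forall>r. (y c has_vector_derivative p c r) (at r) \<and>
          (p c has_vector_derivative \<epsilon> *\<^sub>R force m (y c r)) (at r) \<and> separated \<kappa> r (y c r)) \<and>
        (p c \<longlongrightarrow> A) at_bot \<and> (p c \<longlongrightarrow> A + \<epsilon> *\<^sub>R E c) at_top \<and>
        norm (E c) \<le> C \<and> norm (E c - total_kick m A c) \<le> \<epsilon> * C" if c: "c \<in> cball c0 r0" for c
    proof (intro conjI allI)
      note cz = c z_le [OF c]
      have c0: "norm (0 :: real \<Rightarrow>\<^sub>C ('d, 'n) config) \<le> r0" using r0 by simp
      show "y c 0 = c"
        by (simp add: y_def path_def displacement)
      show "(y c has_vector_derivative p c r) (at r)" for r
        unfolding y_def p_def by (rule path')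
      show "(p c has_vector_derivative \<epsilon> *\<^sub>R force m (y c r)) (at r)" for r
        unfolding p_def y_def z_nth [OF c]
        by (auto intro!: derivative_eq_intros imp' cz)
      show "separated \<kappa> r (y c r)" for r
        unfolding y_def by (rule sep [OF cz])
      have "(p c \<longlongrightarrow> A + \<epsilon> *\<^sub>R 0) at_bot"
        unfolding p_def z_nth [OF c] by (intro tendsto_intros imp_bot cz)
      then show "(p c \<longlongrightarrow> A) at_bot" by simp
      show "(p c \<longlongrightarrow> A + \<epsilon> *\<^sub>R E c) at_top"
        unfolding p_def z_nth [OF c] E_def by (intro tendsto_intros imp_top cz)
      show "norm (E c) \<le> C"
        unfolding E_def using tot_le [OF cz] C(2) by linarith
      have "norm (z c) \<le> \<epsilon> * C1"
        using z_fix [OF c] imp_le [OF cz] \<epsilon>(1) by (metis abs_of_pos mult_left_mono norm_scaleR less_imp_le)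
      have "norm (E c - total_kick m A c) \<le> C1 * (norm (c - c) + dist (z c) 0)"
        unfolding E_def tot_zero [OF c, symmetric] by (rule tot_dist [OF cz c c0])
      also have "\<dots> \<le> C1 * (\<epsilon> * C1)"
        using C1 \<open>norm (z c) \<le> \<epsilon> * C1\<close> by (intro mult_left_mono) auto
      finally show "norm (E c - total_kick m A c) \<le> \<epsilon> * C"
        by (simp add: C_def mult.commute mult.left_commute)
    qed
    show "\<exists>y p E. continuous_on (cball c0 r0) E \<and> (\<forall>c\<in>cball c0 r0. y c 0 = c \<and>
        (\<forall>r. (y c has_vector_derivative p c r) (at r) \<and>
          (p c has_vector_derivative \<epsilon> *\<^sub>R force m (y c r)) (at r) \<and> separated \<kappa> r (y c r)) \<and>
        (p c \<longlongrightarrow> A) at_bot \<and> (p c \<longlongrightarrow> A + \<epsilon> *\<^sub>R E c) at_top \<and>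
        norm (E c) \<le> C \<and> norm (E c - total_kick m A c) \<le> \<epsilon> * C)"
      by (intro exI [of _ y] exI [of _ p] exI [of _ E] conjI cont ballI sol)
  qed
qed

section \<open>Generic velocities form an open dense set\<close>

lemma continuous_on_gram [continuous_intros]:
  "continuous_on S f \<Longrightarrow> continuous_on S g \<Longrightarrow> continuous_on S (\<lambda>z. gram (f z) (g z))"
  unfolding gram_def by (intro continuous_intros)

lemma open_collision_free: "open (- collisions :: ('d::finite, 'n::{finite,linorder}) config set)"
proof -
  have "- collisions = (\<Inter>i\<in>UNIV. \<Inter>j\<in>-{i}. {q :: ('d, 'n) config. q $ i \<noteq> q $ j})"
    unfolding collisions_def by force
  also have "open \<dots>"
    by (intro open_INT ballI open_Collect_neq continuous_intros) auto
  finally show ?thesis .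
qed

lemma openin_generic_velocities:
  "openin (top_of_set (centered_free m)) (generic_velocities m :: ('d::finite, 'n::{finite,linorder}) config set)"
proof -
  let ?P = "\<lambda>i j l (A :: ('d, 'n) config). i \<noteq> j \<and> i \<noteq> l \<and> j \<noteq> l \<longrightarrow>
    gram (A $ i - A $ j) (A $ i - A $ l) \<noteq> 0"
  have "open {A. ?P i j l A}" for i j l
  proof (cases "i \<noteq> j \<and> i \<noteq> l \<and> j \<noteq> l")
    case True
    have "open {A :: ('d, 'n) config. gram (A $ i - A $ j) (A $ i - A $ l) \<noteq> 0}"
      by (intro open_Collect_neq continuous_intros)
    then show ?thesis
      using True by simp
  next
    case False
    then have "{A. ?P i j l A} = UNIV" by blast
    then show ?thesis by simp
  qed
  then have "open (\<Inter>i. \<Inter>j. \<Inter>l. {A. ?P i j l A})"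
    by (intro open_INT ballI) auto
  moreover have "generic_velocities m = centered_free m \<inter> (\<Inter>i. \<Inter>j. \<Inter>l. {A. ?P i j l A})"
    unfolding generic_velocities_def by (simp only: Collect_conj_eq Collect_mem_eq Collect_all_eq)
  ultimately show ?thesis
    by (simp only: openin_open_Int)
qed

lemma gram_orthonormal:
  assumes "e \<bullet> e = 1" "f \<bullet> f = 1" "e \<bullet> f = 0"
  shows "gram (a *\<^sub>R e + b *\<^sub>R f) (c *\<^sub>R e + d *\<^sub>R f) = (a * d - b * c)\<^sup>2"
  using assms inner_commute [of e f]
  by (simp add: gram_def inner_add_left inner_add_right power2_eq_square algebra_simps)

text \<open>The bodies are placed on a parabola in a coordinate plane.\<close>

lemma exists_generic_velocities:
  fixes m :: "'n::{finite,linorder} \<Rightarrow> real"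
  assumes "\<And>i. m i > 0" and d2: "CARD('d) \<ge> 2"
  obtains A :: "('d::finite, 'n) config" where "A \<in> centered m"
    "\<And>i j l. i \<noteq> j \<Longrightarrow> i \<noteq> l \<Longrightarrow> j \<noteq> l \<Longrightarrow> gram (A $ i - A $ j) (A $ i - A $ l) \<noteq> 0"
proof -
  obtain x y :: 'd where xy: "x \<noteq> y"
    using d2 card_le_Suc0_iff_eq [of "UNIV :: 'd set"] by force
  define e f :: "real^'d" where "e = axis x 1" and "f = axis y 1"
  have ef: "e \<bullet> e = 1" "f \<bullet> f = 1" "e \<bullet> f = 0"
    using xy by (auto simp: e_def f_def inner_axis_axis)
  obtain t0 :: "'n \<Rightarrow> nat" where t0: "inj t0"
    using finite_imp_inj_to_nat_seg [of "UNIV :: 'n set"] by auto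
  define t where "t = (\<lambda>i. real (t0 i))"
  have t: "t i = t j \<longleftrightarrow> i = j" for i j
    using t0 by (auto simp: t_def inj_def)
  define M where "M = (\<Sum>i\<in>UNIV. m i)"
  have M: "M > 0"
    unfolding M_def using assms by (intro sum_pos) auto
  define Q where "Q = (\<lambda>i. t i *\<^sub>R e + (t i)\<^sup>2 *\<^sub>R f)"
  define A :: "('d, 'n) config" where "A = (\<chi> i. Q i - (\<Sum>j\<in>UNIV. m j *\<^sub>R Q j) /\<^sub>R M)"
  have sum_const: "(\<Sum>i\<in>UNIV. m i *\<^sub>R w) = M *\<^sub>R w" for w :: "real^'d"
    by (simp add: M_def scaleR_sum_left)
  have "A \<in> centered m"
    using M by (simp add: centered_def A_def scaleR_diff_right sum_subtractf sum_const del: scaleR_scaleR) simp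
  moreover have "gram (A $ i - A $ j) (A $ i - A $ l) \<noteq> 0" if "i \<noteq> j" "i \<noteq> l" "j \<noteq> l" for i j l
  proof -
    have diff: "A $ i - A $ j = (t i - t j) *\<^sub>R e + ((t i)\<^sup>2 - (t j)\<^sup>2) *\<^sub>R f" for i j
      by (simp add: A_def Q_def algebra_simps)
    have "(t i - t j) * ((t i)\<^sup>2 - (t l)\<^sup>2) - ((t i)\<^sup>2 - (t j)\<^sup>2) * (t i - t l) = (t i - t j) * (t i - t l) * (t l - t j)"
      by (simp add: power2_eq_square algebra_simps)
    then show ?thesis
      unfolding diff gram_orthonormal [OF ef] using that by (simp add: t)
  qed
  ultimately show ?thesis by (rule that)
qed

text \<open>The expression is a polynomial in \<open>s\<close> whose coefficient of degree \<open>4\<close> is \<open>gram a' b'\<close>.\<close>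

lemma finite_gram_line_zeros:
  fixes a b a' b' :: "'a::real_inner"
  assumes "gram a' b' \<noteq> 0"
  shows "finite {s :: real. gram (a + s *\<^sub>R a') (b + s *\<^sub>R b') = 0}"
proof -
  define pa pb pc where "pa = [:a \<bullet> a, 2 * (a \<bullet> a'), a' \<bullet> a':]"
    and "pb = [:b \<bullet> b, 2 * (b \<bullet> b'), b' \<bullet> b':]" and "pc = [:a \<bullet> b, a \<bullet> b' + a' \<bullet> b, a' \<bullet> b':]"
  define p where "p = pa * pb - pc\<^sup>2"
  have "poly p s = gram (a + s *\<^sub>R a') (b + s *\<^sub>R b')" for s
    unfolding p_def pa_def pb_def pc_def gram_def
    by (simp add: inner_add_left inner_add_right inner_commute power2_eq_square algebra_simps)
  moreover have "coeff p 4 = gram a' b'"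
    by (simp add: p_def pa_def pb_def pc_def gram_def power2_eq_square coeff_pCons numeral_eq_Suc)
  then have "p \<noteq> 0" using assms by auto
  ultimately show ?thesis
    using poly_roots_finite [of p] by simp
qed

lemma generic_velocities_dense:
  fixes m :: "'n::{finite,linorder} \<Rightarrow> real"
  assumes mass_pos: "\<And>i. m i > 0" and d2: "CARD('d::finite) \<ge> 2"
  shows "(centered_free m :: ('d, 'n) config set) \<subseteq> closure (generic_velocities m)"
proof
  fix A :: "('d, 'n) config" assume A: "A \<in> centered_free m"
  obtain A0 :: "('d, 'n) config" where A0: "A0 \<in> centered m"
    and A0_gram: "\<And>i j l. i \<noteq> j \<Longrightarrow> i \<noteq> l \<Longrightarrow> j \<noteq> l \<Longrightarrow> gram (A0 $ i - A0 $ j) (A0 $ i - A0 $ l) \<noteq> 0"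
    by (rule exists_generic_velocities [of m, OF mass_pos d2]) (rule that)
  have lim: "((\<lambda>s. A + s *\<^sub>R A0) \<longlongrightarrow> A) (at (0::real))"
    by (auto intro!: tendsto_eq_intros)
  define Z where "Z = (\<lambda>i j l. {s. gram ((A $ i - A $ j) + s *\<^sub>R (A0 $ i - A0 $ j)) ((A $ i - A $ l) + s *\<^sub>R (A0 $ i - A0 $ l)) = 0})"
  have "\<forall>\<^sub>F s in at (0::real). i \<noteq> j \<and> i \<noteq> l \<and> j \<noteq> l \<longrightarrow> s \<notin> Z i j l" for i j l
  proof (cases "i \<noteq> j \<and> i \<noteq> l \<and> j \<noteq> l")
    case True
    then have "finite (Z i j l)"
      unfolding Z_def by (intro finite_gram_line_zeros A0_gram) auto
    then have "open (- (Z i j l - {0}))"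
      by (intro open_Compl finite_imp_closed finite_Diff)
    then have "\<forall>\<^sub>F s in nhds 0. s \<in> - (Z i j l - {0})"
      by (auto simp: eventually_nhds)
    then show ?thesis
      unfolding eventually_at_filter by eventually_elim auto
  qed auto
  then have "\<forall>\<^sub>F s in at (0::real). \<forall>i j l. i \<noteq> j \<and> i \<noteq> l \<and> j \<noteq> l \<longrightarrow> s \<notin> Z i j l"
    by (simp add: eventually_all_finite)
  moreover have "\<forall>\<^sub>F s in at (0::real). A + s *\<^sub>R A0 \<in> - collisions"
    using topological_tendstoD [OF lim open_collision_free] A by (auto simp: centered_free_def)
  ultimately have "\<forall>\<^sub>F s in at (0::real). A + s *\<^sub>R A0 \<in> closure (generic_velocities m)"
  proof eventually_elim
    case (elim s)
    have diff: "(A + s *\<^sub>R A0) $ i - (A + s *\<^sub>R A0) $ j = (A $ i - A $ j) + s *\<^sub>R (A0 $ i - A0 $ j)" for i j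
      by (simp add: algebra_simps)
    have "A + s *\<^sub>R A0 \<in> centered_free m"
      using elim(2) A A0 by (auto simp: centered_free_def intro!: centered_linear_simps)
    then have "A + s *\<^sub>R A0 \<in> generic_velocities m"
      using elim(1) by (simp only: generic_velocities_def diff Z_def mem_Collect_eq)
    then show ?case
      using closure_subset by blast
  qed
  then show "A \<in> closure (generic_velocities m)"
    by (rule Lim_in_closed_set [OF closed_closure _ _ lim]) simp
qed

section \<open>A stable form of the inverse function theorem\<close>

text \<open>Continuous maps uniformly close to a map with invertible derivative at \<open>c0\<close> still cover a fixed
  neighbourhood of its value at \<open>c0\<close>, by Brouwer's fixed point theorem.\<close>

lemma covering_stable:
  fixes \<Psi> :: "'a::euclidean_space \<Rightarrow> 'a"
  assumes der: "(\<Psi> has_derivative L) (at c0)" and inj: "\<And>u. L u = 0 \<Longrightarrow> u = 0" and r0: "r0 > 0"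
  obtains r \<beta> where "0 < r" "r \<le> r0" "\<beta> > 0"
    "\<And>f z. continuous_on (cball c0 r) f \<Longrightarrow> (\<And>c. c \<in> cball c0 r \<Longrightarrow> norm (f c - \<Psi> c) \<le> \<beta>) \<Longrightarrow>
      norm (z - \<Psi> c0) \<le> \<beta> \<Longrightarrow> \<exists>c\<in>cball c0 r. f c = z"
proof -
  have lin: "linear L"
    using der has_derivative_linear by blast
  have "inj L"
    using inj linear_injective_0 [OF lin] by blast
  then obtain M where M: "linear M" "\<And>x. M (L x) = x" "\<And>x. L (M x) = x"
    using linear_injective_isomorphism [OF lin] by blast
  obtain B where B: "B > 0" "\<And>x. norm (M x) \<le> B * norm x"
    using linear_bounded_pos [OF M(1)] by blast
  obtain d where d: "d > 0" "\<And>c. norm (c - c0) < d \<Longrightarrow> norm (\<Psi> c - \<Psi> c0 - L (c - c0)) \<le> 1 / (2 * B) * norm (c - c0)"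
  proof -
    have "1 / (2 * B) > 0" using B(1) by simp
    then show ?thesis
      using der [unfolded has_derivative_at_alt] that by blast
  qed
  define r where "r = min (d / 2) r0"
  have r: "r > 0" "r \<le> r0" "r < d"
    using d(1) r0 by (auto simp: r_def)
  define \<beta> where "\<beta> = r / (4 * B)"
  show ?thesis
  proof (rule that [OF r(1,2)])
    show "\<beta> > 0"
      using r B by (simp add: \<beta>_def)
    fix f z assume cont: "continuous_on (cball c0 r) f"
      and close: "\<And>c. c \<in> cball c0 r \<Longrightarrow> norm (f c - \<Psi> c) \<le> \<beta>" and z: "norm (z - \<Psi> c0) \<le> \<beta>"
    (* Newton's iteration with the fixed inverse M of L maps the ball into itself. *)
    define h where "h = (\<lambda>c. c - M (f c - z))"
    have "continuous_on (cball c0 r) h"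
      unfolding h_def
      by (intro continuous_intros cont linear_continuous_on_compose [OF _ M(1)])
    moreover have "h \<in> cball c0 r \<rightarrow> cball c0 r"
    proof
      fix c assume c: "c \<in> cball c0 r"
      then have cr: "norm (c - c0) \<le> r"
        by (simp add: dist_norm norm_minus_commute)
      have "h c - c0 = - M ((f c - \<Psi> c) + (\<Psi> c - \<Psi> c0 - L (c - c0)) - (z - \<Psi> c0))"
        using M(2) [of "c - c0"] by (simp add: h_def linear_diff [OF M(1)] linear_add [OF M(1)])
      then have "norm (h c - c0) \<le> B * norm ((f c - \<Psi> c) + (\<Psi> c - \<Psi> c0 - L (c - c0)) - (z - \<Psi> c0))"
        using B(2) by simp
      also have "norm ((f c - \<Psi> c) + (\<Psi> c - \<Psi> c0 - L (c - c0)) - (z - \<Psi> c0)) \<le>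
          norm (f c - \<Psi> c) + norm (\<Psi> c - \<Psi> c0 - L (c - c0)) + norm (z - \<Psi> c0)"
        using norm_triangle_ineq4 [of "(f c - \<Psi> c) + (\<Psi> c - \<Psi> c0 - L (c - c0))" "z - \<Psi> c0"]
          norm_triangle_ineq [of "f c - \<Psi> c" "\<Psi> c - \<Psi> c0 - L (c - c0)"] by linarith
      also have "\<dots> \<le> \<beta> + 1 / (2 * B) * r + \<beta>"
        using close [OF c] z d(2) [of c] cr r(3) mult_left_mono [OF cr, of "1 / (2 * B)"] B(1)
        by (intro add_mono) auto
      also have "\<dots> = r / B"
        using B(1) by (simp add: \<beta>_def field_simps)
      finally have "norm (h c - c0) \<le> B * (r / B)"
        using B(1) by simp
      then show "h c \<in> cball c0 r"
        using B(1) by (simp add: dist_norm norm_minus_commute)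
    qed
    ultimately obtain c where c: "c \<in> cball c0 r" "h c = c"
      using brouwer [of "cball c0 r" h] r(1) by (auto simp: compact_cball)
    then have "M (f c - z) = 0"
      by (simp add: h_def)
    then have "f c - z = 0"
      using M(3) [of "f c - z"] linear_0 [OF lin] by simp
    then show "\<exists>c\<in>cball c0 r. f c = z"
      using c by auto
  qed
qed

section \<open>The scattering image\<close>

lemma mass_inner_total_kick:
  "mass_inner m (total_kick m A c) u =
    (\<Sum>i\<in>UNIV. \<Sum>j\<in>UNIV. m i * m j * (kick (A $ j - A $ i) (c $ j - c $ i) \<bullet> (u $ i - u $ j))) / 2"
proof -
  let ?F = "\<lambda>i j. (m i * m j) *\<^sub>R kick (A $ j - A $ i) (c $ j - c $ i)"
  have "?F i j = - ?F j i" for i j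
    using kick_minus [of "A $ i - A $ j" "c $ i - c $ j"] by (simp add: mult.commute)
  from sum_antisymmetric_inner [where F = ?F and u = "\<lambda>i. u $ i", OF this] show ?thesis
    by (simp add: mass_inner_def total_kick_def inner_sum_left sum_distrib_left mult.assoc)
qed

lemma mass_inner_total_kick_incoming: "mass_inner m (total_kick m A c) A = 0"
proof -
  have "kick (A $ j - A $ i) b \<bullet> (A $ i - A $ j) = 0" for i j b
    using perp_inner_self(1) [of "A $ j - A $ i" b]
    by (simp add: kick_def inner_diff_right)
  then show ?thesis by (simp add: mass_inner_total_kick)
qed

lemma total_kick_centered: "total_kick m A c \<in> centered m"
  by (rule centeredI_mass_inner) (simp add: mass_inner_total_kick)

text \<open>The projection \<open>P\<close> orthogonal to \<open>A\<close> of the velocity change \<open>B - A\<close> takes all values \<open>\<epsilon> *\<^sub>R z\<close> with \<open>z\<close>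
  near \<open>z0\<close>, the total kick for a nondegenerate impact vector.\<close>

proposition scattering_locally_onto:
  fixes m :: "'n::{finite,linorder} \<Rightarrow> real" and A :: "('d::finite, 'n) config"
  assumes n2: "CARD('n) \<ge> 2" and d2: "CARD('d) \<ge> 2" and mass_pos: "\<And>i. m i > 0"
    and A: "A \<in> generic_velocities m" and r1: "r1 > 0"
  defines "P \<equiv> \<lambda>x. x - (mass_inner m A x / mass_inner m A A) *\<^sub>R A"
  obtains \<epsilon> \<beta> z0 where "\<epsilon> > 0" "\<beta> > 0" "z0 \<in> centered m" "mass_inner m A z0 = 0"
    "\<And>z. z \<in> centered m \<Longrightarrow> mass_inner m A z = 0 \<Longrightarrow> norm (z - z0) \<le> \<beta> \<Longrightarrow>
      \<exists>B. B \<in> centered_free m \<and> scatters m A B \<and> mass_norm m B = mass_norm m A \<and>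
        norm (B - A) \<le> r1 \<and> P (B - A) = \<epsilon> *\<^sub>R z"
proof -
  let ?mi = "mass_inner m" and ?M = "\<lambda>x :: ('d, 'n) config. \<Sum>i\<in>UNIV. m i *\<^sub>R x $ i"
  have A_free: "A \<in> centered_free m"
    using A by (simp add: generic_velocities_def)
  then have A_cent: "A \<in> centered m"
    by (simp add: centered_free_def)
  have A_ne: "A \<noteq> 0"
    by (rule centered_free_nonzero [OF n2 A_free])
  have AA: "?mi A A > 0"
    using mass_inner_nonneg [of m A, OF mass_pos] mass_inner_eq_0_iff [of m A, OF mass_pos] A_ne
    by (simp add: less_le)
  have M_lin: "bounded_linear ?M"
    by (intro bounded_linear_sum bounded_linear_const_scaleR bounded_linear_vec_nth)
  have P_lin: "bounded_linear P"
    unfolding P_def using bounded_bilinear.bounded_linear_right [OF bounded_bilinear_mass_inner, of m A]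
    by (intro bounded_linear_sub bounded_linear_ident bounded_linear_scaleR_const)
      (simp add: divide_inverse bounded_linear_mult_const)
  have P_orth: "?mi A (P x) = 0" for x
    using AA by (simp add: P_def mass_inner_linear_simps)
  have P_id: "P x = x" if "?mi A x = 0" for x
    using that by (simp add: P_def)
  define N where "N = (\<lambda>u. ?mi A u *\<^sub>R A + (\<chi> i. ?M u))"
  have "linear N"
    unfolding N_def
    by (rule linearI) (simp_all add: mass_inner_linear_simps vec_eq_iff algebra_simps sum.distrib scaleR_sum_right)
  then have N_lin: "bounded_linear N"
    by (simp add: linear_conv_bounded_linear)

  obtain c0 L where c0: "c0 \<in> centered m"
    and gram: "\<And>i j. i \<noteq> j \<Longrightarrow> gram (A $ i - A $ j) (c0 $ i - c0 $ j) \<noteq> 0"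
    and L: "(total_kick m A has_derivative L) (at c0)"
    and L_inj: "\<And>u. L u + ?mi A u *\<^sub>R A + (\<chi> i. ?M u) = 0 \<Longrightarrow> u = 0"
    by (rule nondegenerate_total_kick [OF d2 mass_pos A A_ne]) (rule that)
  obtain \<kappa> r0 C where \<kappa>: "\<kappa> > 0" and r0: "r0 > 0" and C: "C > 0"
    and sol: "\<And>\<epsilon>. \<epsilon> > 0 \<Longrightarrow> \<epsilon> * C \<le> r0 \<Longrightarrow> \<epsilon> * C \<le> 1 / 2 \<Longrightarrow>
      \<exists>y p E. continuous_on (cball c0 r0) E \<and> (\<forall>c\<in>cball c0 r0. y c 0 = c \<and>
        (\<forall>r. (y c has_vector_derivative p c r) (at r) \<and>
          (p c has_vector_derivative \<epsilon> *\<^sub>R force m (y c r)) (at r) \<and> separated \<kappa> r (y c r)) \<and>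
        (p c \<longlongrightarrow> A) at_bot \<and> (p c \<longlongrightarrow> A + \<epsilon> *\<^sub>R E c) at_top \<and>
        norm (E c) \<le> C \<and> norm (E c - total_kick m A c) \<le> \<epsilon> * C)"
    by (rule scattering_solutions [of m A c0, OF mass_pos gram]) (assumption, rule that)

  define \<Psi> where "\<Psi> = (\<lambda>c. total_kick m A c + N (c - c0))"
  define z0 where "z0 = total_kick m A c0"
  have \<Psi>0: "\<Psi> c0 = z0"
    using linear_0 [OF bounded_linear.linear [OF N_lin]] by (simp add: \<Psi>_def z0_def)
  have \<Psi>': "(\<Psi> has_derivative (\<lambda>u. L u + N u)) (at c0)"
  proof -
    have "((\<lambda>c. c - c0) has_derivative (\<lambda>u. u)) (at c0)"
      by (auto intro!: derivative_eq_intros)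
    from has_derivative_add [OF L bounded_linear.has_derivative [OF N_lin this]] show ?thesis
      by (simp add: \<Psi>_def)
  qed
  have inj: "u = 0" if "L u + N u = 0" for u
    by (rule L_inj) (use that in \<open>simp add: N_def add.assoc\<close>)
  obtain r \<beta> where r: "0 < r" "r \<le> r0" and \<beta>: "\<beta> > 0"
    and cover: "\<And>f z. continuous_on (cball c0 r) f \<Longrightarrow> (\<And>c. c \<in> cball c0 r \<Longrightarrow> norm (f c - \<Psi> c) \<le> \<beta>) \<Longrightarrow>
      norm (z - \<Psi> c0) \<le> \<beta> \<Longrightarrow> \<exists>c\<in>cball c0 r. f c = z"
    using covering_stable [where L = "\<lambda>u. L u + N u", OF \<Psi>' inj r0] by blast
  obtain K where K: "K > 0" "\<And>x. norm (P x) \<le> norm x * K"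
    using bounded_linear.pos_bounded [OF P_lin] by blast

  define \<epsilon> where "\<epsilon> = min (min r0 (1 / 2)) (min r1 (\<beta> / K)) / C"
  have \<epsilon>: "\<epsilon> > 0"
    using r0 r1 \<beta> K(1) C by (simp add: \<epsilon>_def)
  have "\<epsilon> * C = min (min r0 (1 / 2)) (min r1 (\<beta> / K))"
    using C by (simp add: \<epsilon>_def)
  then have \<epsilon>_le: "\<epsilon> * C \<le> r0" "\<epsilon> * C \<le> 1 / 2" "\<epsilon> * C \<le> r1" "\<epsilon> * C \<le> \<beta> / K"
    by linarith+
  obtain y p E where E_cont: "continuous_on (cball c0 r0) E"
    and y0: "\<And>c. c \<in> cball c0 r0 \<Longrightarrow> y c 0 = c"
    and y': "\<And>c t. c \<in> cball c0 r0 \<Longrightarrow> (y c has_vector_derivative p c t) (at t)"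
    and p': "\<And>c t. c \<in> cball c0 r0 \<Longrightarrow> (p c has_vector_derivative \<epsilon> *\<^sub>R force m (y c t)) (at t)"
    and y_sep: "\<And>c t. c \<in> cball c0 r0 \<Longrightarrow> separated \<kappa> t (y c t)"
    and p_bot: "\<And>c. c \<in> cball c0 r0 \<Longrightarrow> (p c \<longlongrightarrow> A) at_bot"
    and p_top: "\<And>c. c \<in> cball c0 r0 \<Longrightarrow> (p c \<longlongrightarrow> A + \<epsilon> *\<^sub>R E c) at_top"
    and E_le: "\<And>c. c \<in> cball c0 r0 \<Longrightarrow> norm (E c) \<le> C"
    and E_close: "\<And>c. c \<in> cball c0 r0 \<Longrightarrow> norm (E c - total_kick m A c) \<le> \<epsilon> * C"
    using sol [OF \<epsilon> \<epsilon>_le(1,2)] by blast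
  (* The summand N makes the derivative at c0 of the limiting map \<Psi> invertible. *)
  define f where "f = (\<lambda>c. P (E c) + N (c - c0))"
  have f_cont: "continuous_on (cball c0 r) f"
    unfolding f_def using r(2)
    by (intro continuous_intros bounded_linear.continuous_on [OF P_lin] bounded_linear.continuous_on [OF N_lin]
        continuous_on_subset [OF E_cont]) auto
  have f_close: "norm (f c - \<Psi> c) \<le> \<beta>" if "c \<in> cball c0 r" for c
  proof -
    have c: "c \<in> cball c0 r0" using that r(2) by auto
    (* The total kick is orthogonal to A, so that the projection does not change it. *)
    have "P (total_kick m A c) = total_kick m A c"
      by (rule P_id) (simp add: mass_inner_commute [of m A] mass_inner_total_kick_incoming)
    then have "f c - \<Psi> c = P (E c - total_kick m A c)"
      by (simp add: f_def \<Psi>_def linear_diff [OF bounded_linear.linear [OF P_lin]])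
    then have "norm (f c - \<Psi> c) \<le> norm (E c - total_kick m A c) * K"
      using K(2) by simp
    also have "\<dots> \<le> (\<beta> / K) * K"
      using E_close [OF c] \<epsilon>_le(4) K(1) by (intro mult_right_mono) auto
    finally show ?thesis using K(1) by simp
  qed

  note sol_free = separated_imp_collision_free [OF \<kappa>]

  (* The total momentum of the solutions vanishes at \<open>- \<infinity>\<close>, hence always. *)
  have p_cent: "p c t \<in> centered m" if c: "c \<in> cball c0 r0" for c t
  proof -
    have "((\<lambda>t. ?M (p c t)) has_vector_derivative 0) (at t within UNIV)" for t
    proof -
      have "?M (\<epsilon> *\<^sub>R force m (y c t)) = 0"
        using centered_linear_simps(3) [OF force_centered, of \<epsilon> m "y c t"] by (simp add: centered_def)
      then show ?thesis
        using bounded_linear.has_vector_derivative [OF M_lin p' [OF c], of t] by simp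
    qed
    then obtain k where k: "\<And>t. ?M (p c t) = k"
      using has_vector_derivative_zero_constant [of UNIV "\<lambda>t. ?M (p c t)"] by auto
    have "((\<lambda>t. ?M (p c t)) \<longlongrightarrow> ?M A) at_bot"
      by (rule bounded_linear.tendsto [OF M_lin p_bot [OF c]])
    then have "k = 0"
      using A_cent by (simp add: k centered_def tendsto_const_iff)
    then show ?thesis using k by (simp add: centered_def)
  qed
  have out_cent: "A + \<epsilon> *\<^sub>R E c \<in> centered m" if c: "c \<in> cball c0 r0" for c
    using Lim_in_closed_set [OF closed_centered _ _ p_top [OF c]] p_cent [OF c] by simp
  have E_cent: "E c \<in> centered m" if c: "c \<in> cball c0 r0" for c
  proof -
    have "(1 / \<epsilon>) *\<^sub>R ((A + \<epsilon> *\<^sub>R E c) - A) \<in> centered m"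
      by (intro centered_linear_simps out_cent c A_cent)
    then show ?thesis using \<epsilon> by simp
  qed

  have attained: "\<exists>B. B \<in> centered_free m \<and> scatters m A B \<and> mass_norm m B = mass_norm m A \<and>
        norm (B - A) \<le> r1 \<and> P (B - A) = \<epsilon> *\<^sub>R z"
    if z_cent: "z \<in> centered m" and z_orth: "?mi A z = 0" and z_near: "norm (z - z0) \<le> \<beta>" for z
  proof -
    obtain c where c_r: "c \<in> cball c0 r" and fc: "f c = z"
      using cover [OF f_cont f_close] z_near \<Psi>0 by blast
    have c: "c \<in> cball c0 r0" using c_r r(2) by auto
    define u where "u = c - c0"
    define Mt where "Mt = (\<Sum>i\<in>UNIV. m i)"
    have Mt: "Mt > 0"
      unfolding Mt_def using mass_pos by (intro sum_pos) auto
    have sum_const: "(\<Sum>i\<in>UNIV. m i *\<^sub>R w) = Mt *\<^sub>R w" for w :: "real^'d"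
      by (simp add: Mt_def scaleR_sum_left)
    (* Both z and P (E c) are centered and orthogonal to A, so N does not contribute. *)
    have z_eq: "z = P (E c) + (?mi A u *\<^sub>R A + (\<chi> i. ?M u))"
      using fc by (simp add: f_def N_def u_def)
    have "(\<chi> i. ?M u) = z - P (E c) - ?mi A u *\<^sub>R A"
      using z_eq by simp
    also have "\<dots> \<in> centered m"
      unfolding P_def by (intro centered_linear_simps z_cent E_cent c A_cent)
    finally have "Mt *\<^sub>R ?M u = 0"
      by (simp add: centered_def sum_const)
    then have Mu: "?M u = 0" using Mt by simp
    then have "u \<in> centered m" by (simp add: centered_def)
    then have c_cent: "c \<in> centered m"
      using subspace_add [OF subspace_centered c0, of u] by (simp add: u_def)
    have z_eq': "z = P (E c) + ?mi A u *\<^sub>R A"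
      using z_eq Mu by (simp add: vec_eq_iff)
    have "?mi A u * ?mi A A = 0"
      using z_orth P_orth [of "E c"] by (subst (asm) z_eq') (simp add: mass_inner_linear_simps)
    then have PE: "P (E c) = z"
      using AA z_eq' by simp

    define B where "B = A + \<epsilon> *\<^sub>R E c"
    have PB: "P (B - A) = \<epsilon> *\<^sub>R z"
      using PE linear_cmul [OF bounded_linear.linear [OF P_lin]] by (simp add: B_def)
    have BA: "norm (B - A) \<le> r1"
    proof -
      have "\<epsilon> * norm (E c) \<le> \<epsilon> * C"
        using \<epsilon> by (intro mult_left_mono E_le c) simp
      then have "\<epsilon> * norm (E c) \<le> r1"
        using \<epsilon>_le(3) by linarith
      then show ?thesis
        using \<epsilon> by (simp add: B_def)
    qed
    have "((\<lambda>t. y c t /\<^sub>R t) \<longlongrightarrow> B) at_top"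
      unfolding B_def by (rule tendsto_quotient_at_top [OF y' [OF c] p_top [OF c]])
    have "B $ i \<noteq> B $ j" if "i \<noteq> j" for i j
    proof -
      have "((\<lambda>t. norm ((y c t /\<^sub>R t) $ i - (y c t /\<^sub>R t) $ j)) \<longlongrightarrow> norm (B $ i - B $ j)) at_top"
        by (intro tendsto_intros \<open>((\<lambda>t. y c t /\<^sub>R t) \<longlongrightarrow> B) at_top\<close>)
      moreover have "\<forall>\<^sub>F t in at_top. \<kappa> \<le> norm ((y c t /\<^sub>R t) $ i - (y c t /\<^sub>R t) $ j)"
        using eventually_gt_at_top [of 0]
      proof eventually_elim
        case (elim t)
        have "\<kappa> * t \<le> \<kappa> * sqrt (1 + t\<^sup>2)"
          using \<kappa> sqrt_1_plus_square(2) [of t] elim by (intro mult_left_mono) auto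
        also have "\<dots> \<le> norm (y c t $ i - y c t $ j)"
          using y_sep [OF c, of t] that by (simp add: separated_def)
        finally have "\<kappa> \<le> norm (y c t $ i - y c t $ j) / t"
          using elim by (simp add: pos_le_divide_eq)
        moreover have "(y c t /\<^sub>R t) $ i - (y c t /\<^sub>R t) $ j = (1 / t) *\<^sub>R (y c t $ i - y c t $ j)"
          by (simp add: scaleR_diff_right divide_inverse)
        ultimately show ?case
          using elim by simp
      qed
      ultimately have "\<kappa> \<le> norm (B $ i - B $ j)"
        by (rule tendsto_lowerbound) simp
      then show ?thesis using \<kappa> by auto
    qed
    then have B_free: "B \<in> centered_free m"
      using out_cent [OF c] by (auto simp: centered_free_def collisions_def B_def)

    have y_cent: "y c t \<in> centered m" for t
    proof -
      have "((\<lambda>t. ?M (y c t)) has_vector_derivative 0) (at t within UNIV)" for t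
        using bounded_linear.has_vector_derivative [OF M_lin y' [OF c], of t] p_cent [OF c, of t]
        by (simp add: centered_def)
      then obtain k where k: "\<And>t. ?M (y c t) = k"
        using has_vector_derivative_zero_constant [of UNIV "\<lambda>t. ?M (y c t)"] by auto
      have "k = 0"
        using k [of 0] c_cent y0 [OF c] by (simp add: centered_def)
      then show ?thesis using k by (simp add: centered_def)
    qed
    (* Rescaling space and time by the same large factor turns the weak force into Newton's. *)
    define q where "q = (\<lambda>t. (1 / \<epsilon>) *\<^sub>R y c (\<epsilon> * t))"
    define v where "v = (\<lambda>t. p c (\<epsilon> * t))"
    have time: "((\<lambda>t. \<epsilon> * t) has_vector_derivative \<epsilon>) (at t)" for t
      unfolding has_real_derivative_iff_has_vector_derivative [symmetric]
      by (auto intro!: derivative_eq_intros)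
    have q': "(q has_vector_derivative v t) (at t)" for t
    proof -
      have "((\<lambda>t. y c (\<epsilon> * t)) has_vector_derivative \<epsilon> *\<^sub>R p c (\<epsilon> * t)) (at t)"
        using vector_diff_chain_at [OF time y' [OF c]] by (simp add: o_def)
      from bounded_linear.has_vector_derivative [OF bounded_linear_scaleR_right this, of "1 / \<epsilon>"]
      show ?thesis using \<epsilon> by (simp add: q_def v_def)
    qed
    have v': "(v has_vector_derivative force m (q t)) (at t)" for t
    proof -
      have "(v has_vector_derivative \<epsilon> *\<^sub>R (\<epsilon> *\<^sub>R force m (y c (\<epsilon> * t)))) (at t)"
        using vector_diff_chain_at [OF time p' [OF c]] by (simp add: o_def v_def)
      moreover have "force m (q t) = \<epsilon> *\<^sub>R (\<epsilon> *\<^sub>R force m (y c (\<epsilon> * t)))"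
        using force_scaleR [of "1 / \<epsilon>" m "y c (\<epsilon> * t)"] \<epsilon> by (simp add: q_def power2_eq_square)
      ultimately show ?thesis by simp
    qed
    have q_free: "q t \<in> centered_free m" for t
      using y_cent [of "\<epsilon> * t"] sol_free [OF y_sep [OF c, of "\<epsilon> * t"]] \<epsilon>
      by (auto simp: centered_free_def q_def collisions_def intro!: centered_linear_simps)
    have "filterlim (\<lambda>t. \<epsilon> * t) at_bot at_bot" "filterlim (\<lambda>t. \<epsilon> * t) at_top at_top"
      using \<epsilon> by (auto intro!: filterlim_tendsto_pos_mult_at_bot filterlim_tendsto_pos_mult_at_top filterlim_ident tendsto_const)
    then have v_lim: "(v \<longlongrightarrow> A) at_bot" "(v \<longlongrightarrow> B) at_top"
      unfolding v_def B_def by (auto intro: filterlim_compose [OF p_bot [OF c]] filterlim_compose [OF p_top [OF c]])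
    have "mass_norm m B = mass_norm m A" "scatters m A B"
      by (rule newtonian_trajectory_scatters [OF n2 mass_pos q_free q' v' A_free B_free v_lim])+
    then show ?thesis
      using B_free BA PB by blast
  qed
  show ?thesis
  proof (rule that [OF \<epsilon> \<beta>])
    show "z0 \<in> centered m"
      unfolding z0_def by (rule total_kick_centered)
    show "?mi A z0 = 0"
      unfolding z0_def by (simp add: mass_inner_commute [of m A] mass_inner_total_kick_incoming)
  qed (rule attained)
qed

lemma scattering_image_interior:
  fixes m :: "'n::{finite,linorder} \<Rightarrow> real" and A :: "('d::finite, 'n) config"
  assumes n2: "CARD('n) \<ge> 2" and d2: "CARD('d) \<ge> 2" and mass_pos: "\<And>i. m i > 0"
    and A: "A \<in> generic_velocities m"
  shows "top_of_set (mass_sphere m (mass_norm m A)) interior_of scattering_image m A \<noteq> {}"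
proof -
  let ?mi = "mass_inner m" and ?S = "mass_sphere m (mass_norm m A)"
  have A_free: "A \<in> centered_free m"
    using A by (simp add: generic_velocities_def)
  then have A_cent: "A \<in> centered m"
    by (simp add: centered_free_def)
  have AA: "?mi A A > 0"
    using mass_inner_nonneg [of m A, OF mass_pos] mass_inner_eq_0_iff [of m A, OF mass_pos]
      centered_free_nonzero [OF n2 A_free]
    by (simp add: less_le)
  have cont_A: "continuous_on UNIV (\<lambda>x. ?mi A x)"
    by (intro continuous_on_mass_inner continuous_intros)
  then have "open {x. ?mi A x > 0}"
    using open_Collect_less [OF continuous_on_const] by blast
  then obtain r1 where r1: "r1 > 0" "\<And>x. dist x A < r1 \<Longrightarrow> ?mi A x > 0"
    using AA unfolding open_dist by blast
  define P where "P = (\<lambda>x. x - (?mi A x / ?mi A A) *\<^sub>R A)"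
  obtain \<epsilon> \<beta> z0 where \<epsilon>: "\<epsilon> > 0" and \<beta>: "\<beta> > 0" and z0: "z0 \<in> centered m" "?mi A z0 = 0"
    and onto: "\<And>z. z \<in> centered m \<Longrightarrow> ?mi A z = 0 \<Longrightarrow> norm (z - z0) \<le> \<beta> \<Longrightarrow>
      \<exists>B. B \<in> centered_free m \<and> scatters m A B \<and> mass_norm m B = mass_norm m A \<and>
        norm (B - A) \<le> r1 / 2 \<and> P (B - A) = \<epsilon> *\<^sub>R z"
    unfolding P_def
    by (rule scattering_locally_onto [OF n2 d2 mass_pos A, of "r1 / 2"]) (use r1 that in auto)
  have pos: "?mi A B > 0" if "norm (B - A) \<le> r1 / 2" for B
    using that r1 by (intro r1(2)) (auto simp: dist_norm)
  have P_A: "P (B - A) = P B" for B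
    using AA by (simp add: P_def mass_inner_linear_simps diff_divide_distrib scaleR_diff_left)
  have P_orth: "?mi A (P x) = 0" for x
    using AA by (simp add: P_def mass_inner_linear_simps)
  have P_cont: "continuous_on UNIV P"
    unfolding P_def by (intro continuous_intros cont_A) (use AA in auto)
  define W where "W = {B. norm ((1 / \<epsilon>) *\<^sub>R P (B - A) - z0) < \<beta>} \<inter> {B. ?mi A B > 0}"
  have "open W"
    unfolding W_def P_A using cont_A
    by (intro open_Int open_Collect_less continuous_intros P_cont) auto
  then have "openin (top_of_set ?S) (?S \<inter> W)"
    by (rule openin_open_Int)
  moreover have "?S \<inter> W \<subseteq> scattering_image m A"
  proof
    fix A' assume "A' \<in> ?S \<inter> W"
    then have A': "A' \<in> centered m" "mass_norm m A' = mass_norm m A" "?mi A A' > 0"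
      "norm ((1 / \<epsilon>) *\<^sub>R P (A' - A) - z0) < \<beta>"
      by (auto simp: W_def mass_sphere_def)
    have "P (A' - A) \<in> centered m"
      unfolding P_def by (intro centered_linear_simps A' A_cent)
    then have "(1 / \<epsilon>) *\<^sub>R P (A' - A) \<in> centered m"
      by (intro centered_linear_simps)
    moreover have "?mi A ((1 / \<epsilon>) *\<^sub>R P (A' - A)) = 0"
      by (simp add: mass_inner_linear_simps P_orth)
    ultimately obtain B where B: "B \<in> centered_free m" "scatters m A B" "mass_norm m B = mass_norm m A"
      "norm (B - A) \<le> r1 / 2" "P (B - A) = \<epsilon> *\<^sub>R ((1 / \<epsilon>) *\<^sub>R P (A' - A))"
      using onto A'(4) by (meson less_imp_le)
    (* A vector is determined by its norm, its component orthogonal to \<open>A\<close>, and the sign of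
      its inner product with \<open>A\<close>. *)
    have PB: "P B = P A'"
      using B(5) \<epsilon> by (simp add: P_A)
    have split: "?mi x x = ?mi (P x) (P x) + (?mi A x)\<^sup>2 / ?mi A A" for x
      using AA by (simp add: P_def mass_inner_linear_simps mass_inner_commute [of m x A] power2_eq_square field_simps)
    have "?mi B B = ?mi A' A'"
      using B(3) A'(2) by (simp add: mass_norm_power2 [of m, OF mass_pos, symmetric])
    then have "(?mi A B)\<^sup>2 = (?mi A A')\<^sup>2"
      using split [of B] split [of A'] PB AA by simp
    then have "?mi A B = ?mi A A'"
      using pos [OF B(4)] A'(3) by (simp add: power2_eq_iff)
    then have "B = A'"
      using PB by (simp add: P_def)
    then show "A' \<in> scattering_image m A"
      using B by (simp add: scattering_image_def)
  qed
  moreover have "?S \<inter> W \<noteq> {}"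
  proof -
    obtain B where B: "B \<in> centered_free m" "mass_norm m B = mass_norm m A"
      "norm (B - A) \<le> r1 / 2" "P (B - A) = \<epsilon> *\<^sub>R z0"
      using onto [OF z0] \<beta> by auto
    then have "B \<in> ?S \<inter> W"
      using pos [OF B(3)] \<epsilon> \<beta> by (simp add: W_def mass_sphere_def centered_free_def)
    then show ?thesis by blast
  qed
  ultimately show ?thesis
    using interior_of_maximal by blast
qed

theorem mainTheorem1:
  fixes m :: "'n::{finite,linorder} \<Rightarrow> real"
  assumes "CARD('n) \<ge> 2" and "CARD('d::finite) \<ge> 2"
    and "\<And>i. m i > 0"
  shows "\<exists>G :: ('d, 'n) config set.
    openin (top_of_set (centered_free m)) G \<and>
    top_of_set (centered_free m) closure_of G = centered_free m \<and>
    (\<forall>A\<in>G. top_of_set (mass_sphere m (mass_norm m A)) interior_of scattering_image m A \<noteq> {})"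
proof (intro exI conjI ballI)
  let ?G = "generic_velocities m :: ('d, 'n) config set"
  show "openin (top_of_set (centered_free m)) ?G"
    by (rule openin_generic_velocities)
  have "?G \<subseteq> centered_free m"
    by (auto simp: generic_velocities_def)
  then show "top_of_set (centered_free m) closure_of ?G = centered_free m"
    using generic_velocities_dense [of m, OF assms(3,2)]
    by (simp add: closure_of_subtopology Int_absorb1 Int_absorb2)
  show "top_of_set (mass_sphere m (mass_norm m A)) interior_of scattering_image m A \<noteq> {}" if "A \<in> ?G" for A
    using assms that by (intro scattering_image_interior)
qed

end
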